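(* Let $A_{\mathrm{can}}\in\mathbb C^{n\times n}$ be a canonical matrix for *congruence, i.e. a matrix of the form $$A_{\mathrm{can}}=\bigoplus_i H_{2p_i}(\lambda_i)\ \oplus\ \bigoplus_j\mu_j\Delta_{q_j}\ \oplus\ \bigoplus_l J_{r_l}(0),\qquad r_1\ge r_2\ge\cdots,$$ with all $|\lambda_i|>1$ and all $|\mu_j|=1$, and let $\mathcal D:=\mathcal D\langle A_{\mathrm{can}}\rangle$ be the $(0,*,\circ,\bullet)$ matrix associated with it in the context. Then there exist a neighborhood $U$ of $0_n$ in $\mathbb C^{n\times n}$ and a map $\mathcal S:U\to\mathbb C^{n\times n}$ such that (1) $\mathcal S(X)$ is an analytic function of the entries of $X$ and its complex conjugate $\bar X$ on $U$, $\mathcal S(X)$ is nonsingular for all $X\in U$, and $\mathcal S(0_n)=I_n$; (2) $\mathcal S(X)^*(A_{\mathrm{can}}+X)\,\mathcal S(X)\in A_{\mathrm{can}}+\mathcal D(\mathbb C)$ for all $X\in U$, and the entries of this matrix are analytic functions of the entries of $X$ and $\bar X$ on $U$. Moreover, the number $\dim_{\mathbb R}\mathcal D(\mathbb C)$ is the smallest that can be attained by such transformations: if $\mathcal D'$ is any $n\times n$ $(0,*,\circ,\bullet)$ matrix for which there exist a neighborhood $U'$ of $0_n$ and a map $\mathcal S':U'\to\mathbb C^{n\times n}$ satisfying (1) and (2) with $U',\mathcal S',\mathcal D'$ in place of $U,\mathcal S,\mathcal D$, then $\dim_{\mathbb R}\mathcal D'(\mathbb C)\ge\dim_{\mathbb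 R}\mathcal D(\mathbb C)$. Finally, $\dim_{\mathbb R}\mathcal D(\mathbb C)$ is equal to the codimension over $\mathbb R$ of the *congruence class of $A_{\mathrm{can}}$.
   Context: **Basic notions.** $S^*$ is the conjugate transpose of $S$; *congruence transformations are $A\mapsto S^*AS$ with $S$ nonsingular. For $A\in\mathbb C^{n\times n}$ put $T(A):=\{X^*A+AX\mid X\in\mathbb C^{n\times n}\}$ (a real vector space); the codimension over $\mathbb R$ of the *congruence class of $A$ is defined to be $2n^2-\dim_{\mathbb R}T(A)$. "Analytic in the entries of $X$ and $\bar X$" means locally given by convergent power series in these entries (equivalently, real-analytic in the entries of $\operatorname{Re}X$ and $\operatorname{Im}X$). **Canonical blocks.** $J_n(\lambda)$ is the $n\times n$ upper triangular Jordan block with eigenvalue $\lambda$ (ones on the superdiagonal). $\Delta_n$ is the $n\times n$ matrix with $(j,n+1-j)$ entry $1$ for $j=1,\dots,n$, $(j,n+2-j)$ entry $i=\sqrt{-1}$ for $j=2,\dots,n$, and all other entries $0$. $H_{2m}(\lambda):=\begin{bmatrix} 0 & I_m \\ J_m(\lambda) & 0 \end{bmatrix}$. **$(0,*,\circ,\bullet)$ matrices.** These are matrices each of whose entries is one of the symbols $0,*,\circ,\bullet$. For such a matrix $\mathcal D$, $\mathcal D(\mathbb C)$ is the real vector space of all matrices obtained from $\mathcal D$ by replacing its entries $*$, $\circ$, $\bullet$ by arbitrary complex, real, and purely imaginary numbers, respectively. The following are used (entries not mentioned are $0$): - $0^{\swarrow}$ of size $m\times n$: all entries of the first column are $*$ if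 $m\le n$; all entries of the last row are $*$ if $m\ge n$ (either form may be taken if $m=n$). - $0^{\nearrow}$ of size $m\times n$: all entries of the last column are $*$ if $m\le n$; all entries of the first row are $*$ if $m\ge n$ (either if $m=n$). - $0^{\nwarrow}$ of size $m\times n$: all entries of the first column are $*$ if $m\le n$; all entries of the first row are $*$ if $m\ge n$ (either if $m=n$). - $0^{\mathrm{alt}}$ of size $m\times n$: if $m\le n$, the entries $(m,1),(m-2,1),(m-4,1),\dots$ of the first column are $*$; if $m\ge n$, the entries $(m,1),(m,3),(m,5),\dots$ of the last row are $*$ (either if $m=n$). - $0^{\circ}$ of size $n\times n$: $\operatorname{diag}( *,\dots,*,0,\dots,0)$ with $k$ stars if $n=2k$; $\operatorname{diag}( *,\dots,*,\circ,0,\dots,0)$ with $k$ stars followed by one $\circ$ and $k$ zeros if $n=2k+1$. - $0^{\bullet}$ of size $n\times n$: the same as $0^\circ$ with $\circ$ replaced by $\bullet$. - $0^{\updownarrow}$ of size $m\times n$: either the matrix whose first row consists of stars, or the matrix whose last row consists of stars (either form may be taken). - $\mathcal P_{mn}$ of size $m\times n$, $m\le n$: the entries $(m,m+2),(m,m+3),\dots,(m,n)$ are $*$ (so there are $n-m-1$ stars if $m<n$, none if $m=n$). **The matrix $\mathcal D\langle A_{\mathrm{can}}\rangle$.** Write $A_{\mathrm{can}}=A_1\oplus\dots\oplus A_t$ with the summands in the order displayed in the claim (first the $H$'s, then the $\mu\Delta$'s, then the $J(0)$'s with nonincreasing sizes). $\mathcal D\langle A_{\mathrm{can}}\rangle=[\mathcal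 D_{ij}]_{i,j=1}^t$ is partitioned conformally with $A_{\mathrm{can}}$. Write $\mathcal D\langle A_i\rangle:=\mathcal D_{ii}$ and $\mathcal D\langle A_i,A_j\rangle:=(\mathcal D_{ji},\mathcal D_{ij})$ for $i<j$. With $|\lambda|,|\lambda'|>1$ and $|\mu|=|\mu'|=1$ the blocks are: (i) Diagonal blocks: $\mathcal D\langle H_{2m}(\lambda)\rangle=\begin{bmatrix} 0 & 0 \\ 0^{\swarrow} & 0 \end{bmatrix}$ (with $m\times m$ blocks); $\mathcal D\langle\mu\Delta_n\rangle=0^{\circ}$ if $\mu\notin\mathbb R$, and $=0^{\bullet}$ if $\mu\in\mathbb R$ ($0^{\bullet}$ can be used instead of $0^{\circ}$ if $\mu\notin\mathbb R\cup i\mathbb R$); $\mathcal D\langle J_n(0)\rangle=0^{\mathrm{alt}}$. (ii) Off-diagonal blocks for summands of the same type: $\mathcal D\langle H_{2m}(\lambda),H_{2n}(\lambda')\rangle=(0,0)$ if $\lambda\ne\lambda'$, and $=\left(\begin{bmatrix} 0 & 0^{\nearrow} \\ 0^{\swarrow} & 0 \end{bmatrix},0\right)$ (with $n\times m$ blocks) if $\lambda=\lambda'$; $\mathcal D\langle\mu\Delta_m,\mu'\Delta_n\rangle=(0,0)$ if $\mu\ne\pm\mu'$, and $=(0^{\nwarrow},0)$ if $\mu=\pm\mu'$; for $m\ge n$: $\mathcal D\langle J_m(0),J_n(0)\rangle=(0^{\mathrm{alt}},0^{\mathrm{alt}})$ if $n$ is even, and $=(0^{\mathrm{alt}}+\mathcal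 P_{nm},\,0^{\mathrm{alt}})$ if $n$ is odd (the sum means that stars are placed at all positions having a star in $0^{\mathrm{alt}}$ or in $\mathcal P_{nm}$). (iii) Off-diagonal blocks for summands of distinct types: $\mathcal D\langle H_{2m}(\lambda),\mu\Delta_n\rangle=(0,0)$; $\mathcal D\langle H_{2m}(\lambda),J_n(0)\rangle$ and $\mathcal D\langle\mu\Delta_m,J_n(0)\rangle$ are equal to $(0,0)$ if $n$ is even and to $(0^{\updownarrow},0)$ if $n$ is odd. Sizes of all blocks are determined by the conformal partition. *)

theory Defs
  imports
    "HOL-Analysis.Infinite_Sum"
    "Jordan_Normal_Form.Jordan_Normal_Form"
    "Jordan_Normal_Form.Schur_Decomposition"
    "Jordan_Normal_Form.VS_Connect"
begin

text \<open>Matrices are those of \<^theory>\<open>Jordan_Normal_Form.Matrix\<close>: rows and columns are numbered from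
  \<open>0\<close>, so the position written \<open>(j, k)\<close> in the usual numbering is \<open>(j - 1, k - 1)\<close> here.\<close>

section \<open>Canonical matrices for *congruence\<close>

definition Delta_mat :: "nat \<Rightarrow> complex mat" where
  "Delta_mat n = mat n n (\<lambda>(i, j). if i + j + 1 = n then 1 else if i + j = n then \<i> else 0)"

definition H_mat :: "nat \<Rightarrow> complex \<Rightarrow> complex mat" where
  "H_mat m \<nu> = four_block_mat (0\<^sub>m m m) (1\<^sub>m m) (jordan_block m \<nu>) (0\<^sub>m m m)"

text \<open>\<open>HBlock m \<nu>\<close>, \<open>DeltaBlock \<mu> n\<close> and \<open>JBlock n\<close> stand for $H_{2m}(\nu)$, $\mu\Delta_n$ and
  $J_n(0)$.\<close>

datatype summand = HBlock nat complex | DeltaBlock complex nat | JBlock nat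

fun summand_mat :: "summand \<Rightarrow> complex mat" where
  "summand_mat (HBlock m \<nu>) = H_mat m \<nu>"
| "summand_mat (DeltaBlock \<mu> n) = \<mu> \<cdot>\<^sub>m Delta_mat n"
| "summand_mat (JBlock n) = jordan_block n 0"

definition canonical_summands ::
  "(nat \<times> complex) list \<Rightarrow> (complex \<times> nat) list \<Rightarrow> nat list \<Rightarrow> summand list" where
  "canonical_summands Hs Ds Js =
     map (\<lambda>(p, \<nu>). HBlock p \<nu>) Hs @ map (\<lambda>(\<mu>, q). DeltaBlock \<mu> q) Ds @ map JBlock Js"

definition canonical_mat :: "summand list \<Rightarrow> complex mat" where
  "canonical_mat bs = diag_block_mat (map summand_mat bs)"

section \<open>Matrices of symbols\<close>

datatype symbol = Zero | Star | Circ | Bullet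

fun symbol_values :: "symbol \<Rightarrow> complex set" where
  "symbol_values Zero = {0}"
| "symbol_values Star = UNIV"
| "symbol_values Circ = \<real>"
| "symbol_values Bullet = {z. Re z = 0}"

definition symbol_space :: "symbol mat \<Rightarrow> complex mat set" where
  "symbol_space D = {M \<in> carrier_mat (dim_row D) (dim_col D).
     \<forall>i<dim_row D. \<forall>j<dim_col D. M $$ (i, j) \<in> symbol_values (D $$ (i, j))}"

definition stars :: "nat \<Rightarrow> nat \<Rightarrow> (nat \<Rightarrow> nat \<Rightarrow> bool) \<Rightarrow> symbol mat" where
  "stars m n P = mat m n (\<lambda>(i, j). if P i j then Star else Zero)"

definition zeros :: "nat \<Rightarrow> nat \<Rightarrow> symbol mat" where
  "zeros m n = stars m n (\<lambda>i j. False)"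

text \<open>Where the text leaves a choice between several forms of a block, the block is represented by
  the set of all its admissible forms.\<close>

definition sw_forms :: "nat \<Rightarrow> nat \<Rightarrow> symbol mat set" where
  "sw_forms m n =
     (if m \<le> n then {stars m n (\<lambda>i j. j = 0)} else {}) \<union>
     (if m \<ge> n then {stars m n (\<lambda>i j. i + 1 = m)} else {})"

definition ne_forms :: "nat \<Rightarrow> nat \<Rightarrow> symbol mat set" where
  "ne_forms m n =
     (if m \<le> n then {stars m n (\<lambda>i j. j + 1 = n)} else {}) \<union>
     (if m \<ge> n then {stars m n (\<lambda>i j. i = 0)} else {})"

definition nw_forms :: "nat \<Rightarrow> nat \<Rightarrow> symbol mat set" where
  "nw_forms m n =
     (if m \<le> n then {stars m n (\<lambda>i j. j = 0)} else {}) \<union>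
     (if m \<ge> n then {stars m n (\<lambda>i j. i = 0)} else {})"

text \<open>In the usual numbering the stars are at \<open>(m, 1), (m - 2, 1), \<dots>\<close> or at \<open>(m, 1), (m, 3), \<dots>\<close>.\<close>

definition alt_forms :: "nat \<Rightarrow> nat \<Rightarrow> symbol mat set" where
  "alt_forms m n =
     (if m \<le> n then {stars m n (\<lambda>i j. j = 0 \<and> even (m - (i + 1)))} else {}) \<union>
     (if m \<ge> n then {stars m n (\<lambda>i j. i + 1 = m \<and> even j)} else {})"

definition updown_forms :: "nat \<Rightarrow> nat \<Rightarrow> symbol mat set" where
  "updown_forms m n = {stars m n (\<lambda>i j. i = 0), stars m n (\<lambda>i j. i + 1 = m)}"

text \<open>$0^\circ$ for \<open>s = Circ\<close> and $0^\bullet$ for \<open>s = Bullet\<close>; the middle diagonal entry \<open>s\<close>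
  occurs only for odd \<open>n\<close>.\<close>

definition half_diag :: "nat \<Rightarrow> symbol \<Rightarrow> symbol mat" where
  "half_diag n s = mat n n (\<lambda>(i, j).
     if i = j then (if 2 * i + 1 < n then Star else if 2 * i + 1 = n then s else Zero) else Zero)"

text \<open>Stars at \<open>(m, m + 2), \<dots>, (m, n)\<close> in the usual numbering.\<close>

definition P_mat :: "nat \<Rightarrow> nat \<Rightarrow> symbol mat" where
  "P_mat m n = stars m n (\<lambda>i j. i + 1 = m \<and> m + 1 \<le> j)"

definition star_union :: "symbol mat \<Rightarrow> symbol mat \<Rightarrow> symbol mat" where
  "star_union D E = stars (dim_row D) (dim_col D)
     (\<lambda>i j. D $$ (i, j) = Star \<or> E $$ (i, j) = Star)"

section \<open>The matrices $\mathcal{D}\langle A_{can}\rangle$\<close>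

fun diag_forms :: "summand \<Rightarrow> symbol mat set" where
  "diag_forms (HBlock m \<nu>) =
     {four_block_mat (zeros m m) (zeros m m) Q (zeros m m) | Q. Q \<in> sw_forms m m}"
| "diag_forms (DeltaBlock \<mu> n) =
     (if \<mu> \<in> \<real> then {half_diag n Bullet}
      else if Re \<mu> = 0 then {half_diag n Circ}
      else {half_diag n Circ, half_diag n Bullet})"
| "diag_forms (JBlock n) = alt_forms n n"

text \<open>For summands \<open>A\<close> of size \<open>a\<close> and \<open>B\<close> of size \<open>b\<close>, with \<open>A\<close> preceding \<open>B\<close>,
  \<open>offdiag_forms A B\<close> is the set of admissible pairs consisting of the block below the diagonal
  (of size \<open>b \<times> a\<close>) and the block above the diagonal (of size \<open>a \<times> b\<close>), in this order. Pairs of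
  types that contradict the ordering of the summands do not occur; they are given the value \<open>{}\<close>.\<close>

fun offdiag_forms :: "summand \<Rightarrow> summand \<Rightarrow> (symbol mat \<times> symbol mat) set" where
  "offdiag_forms (HBlock m \<nu>) (HBlock n \<nu>') =
     (if \<nu> = \<nu>'
      then {(four_block_mat (zeros n m) Q R (zeros n m), zeros (2 * m) (2 * n)) | Q R.
              Q \<in> ne_forms n m \<and> R \<in> sw_forms n m}
      else {(zeros (2 * n) (2 * m), zeros (2 * m) (2 * n))})"
| "offdiag_forms (DeltaBlock \<mu> m) (DeltaBlock \<mu>' n) =
     (if \<mu> = \<mu>' \<or> \<mu> = - \<mu>'
      then {(Q, zeros m n) | Q. Q \<in> nw_forms n m}
      else {(zeros n m, zeros m n)})"
| "offdiag_forms (JBlock m) (JBlock n) =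
     (if even n then alt_forms n m \<times> alt_forms m n
      else {(star_union Q (P_mat n m), R) | Q R. Q \<in> alt_forms n m \<and> R \<in> alt_forms m n})"
| "offdiag_forms (HBlock m \<nu>) (DeltaBlock \<mu> n) = {(zeros n (2 * m), zeros (2 * m) n)}"
| "offdiag_forms (HBlock m \<nu>) (JBlock n) =
     (if even n then {(zeros n (2 * m), zeros (2 * m) n)}
      else {(Q, zeros (2 * m) n) | Q. Q \<in> updown_forms n (2 * m)})"
| "offdiag_forms (DeltaBlock \<mu> m) (JBlock n) =
     (if even n then {(zeros n m, zeros m n)}
      else {(Q, zeros m n) | Q. Q \<in> updown_forms n m})"
| "offdiag_forms _ _ = {}"

definition summand_dim :: "summand \<Rightarrow> nat" where
  "summand_dim b = dim_row (summand_mat b)"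

definition block_start :: "summand list \<Rightarrow> nat \<Rightarrow> nat" where
  "block_start bs k = sum_list (map summand_dim (take k bs))"

text \<open>The \<open>(k, l)\<close> block of \<open>D\<close> in the partition conformal with \<open>canonical_mat bs\<close>.\<close>

definition block_at :: "summand list \<Rightarrow> 'a mat \<Rightarrow> nat \<Rightarrow> nat \<Rightarrow> 'a mat" where
  "block_at bs D k l = mat (summand_dim (bs ! k)) (summand_dim (bs ! l))
     (\<lambda>(i, j). D $$ (block_start bs k + i, block_start bs l + j))"

text \<open>The set of all matrices obtained by making, independently in each block, one of the admissible
  choices.\<close>

definition associated_symbol_mats :: "summand list \<Rightarrow> symbol mat set" where
  "associated_symbol_mats bs =
     {D \<in> carrier_mat (dim_row (canonical_mat bs)) (dim_row (canonical_mat bs)).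
        (\<forall>k<length bs. block_at bs D k k \<in> diag_forms (bs ! k)) \<and>
        (\<forall>l<length bs. \<forall>k<l.
           (block_at bs D l k, block_at bs D k l) \<in> offdiag_forms (bs ! k) (bs ! l))}"

section \<open>Real dimension and codimension\<close>

definition real_mat_space :: "nat \<Rightarrow> (real, complex mat) module" where
  "real_mat_space n = \<lparr>carrier = carrier_mat n n, mult = (*), one = 1\<^sub>m n, zero = 0\<^sub>m n n,
     add = (+), smult = (\<lambda>r M. complex_of_real r \<cdot>\<^sub>m M)\<rparr>"

text \<open>Meaningful for real subspaces \<open>W\<close> of the space of complex \<open>n \<times> n\<close> matrices.\<close>

definition real_dim :: "nat \<Rightarrow> complex mat set \<Rightarrow> nat" where
  "real_dim n W = vectorspace.dim class_ring (real_mat_space n\<lparr>carrier := W\<rparr>)"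

definition starcong_tangent :: "nat \<Rightarrow> complex mat \<Rightarrow> complex mat set" where
  "starcong_tangent n A = {mat_adjoint X * A + A * X | X. X \<in> carrier_mat n n}"

definition starcong_codim :: "nat \<Rightarrow> complex mat \<Rightarrow> int" where
  "starcong_codim n A = 2 * (int n)\<^sup>2 - int (real_dim n (starcong_tangent n A))"

section \<open>Analytic dependence on a matrix and its conjugate\<close>

definition mat_ball :: "nat \<Rightarrow> complex mat \<Rightarrow> real \<Rightarrow> complex mat set" where
  "mat_ball n A \<epsilon> =
     {X \<in> carrier_mat n n. \<forall>i<n. \<forall>j<n. cmod (X $$ (i, j) - A $$ (i, j)) < \<epsilon>}"

definition open_mats :: "nat \<Rightarrow> complex mat set \<Rightarrow> bool" where
  "open_mats n U \<longleftrightarrow> U \<subseteq> carrier_mat n n \<and> (\<forall>A\<in>U. \<exists>\<epsilon>>0. mat_ball n A \<epsilon> \<subseteq> U)"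

text \<open>Exponents of monomials in the entries of an \<open>n \<times> n\<close> matrix; they vanish off the index range,
  so that each monomial has exactly one exponent.\<close>

definition exponents :: "nat \<Rightarrow> (nat \<times> nat \<Rightarrow> nat) set" where
  "exponents n = {\<alpha>. \<forall>p. p \<notin> {..<n} \<times> {..<n} \<longrightarrow> \<alpha> p = 0}"

definition entry_monomial ::
  "nat \<Rightarrow> (nat \<times> nat \<Rightarrow> nat) \<Rightarrow> (nat \<times> nat \<Rightarrow> nat) \<Rightarrow> complex mat \<Rightarrow> complex" where
  "entry_monomial n \<alpha> \<beta> X =
     (\<Prod>p\<in>{..<n} \<times> {..<n}. (X $$ p) ^ \<alpha> p * (cnj (X $$ p)) ^ \<beta> p)"

text \<open>The multi-index series is summed unconditionally.\<close>

definition entry_analytic_at :: "nat \<Rightarrow> (complex mat \<Rightarrow> complex) \<Rightarrow> complex mat \<Rightarrow> bool" where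
  "entry_analytic_at n f A \<longleftrightarrow>
     (\<exists>c :: (nat \<times> nat \<Rightarrow> nat) \<Rightarrow> (nat \<times> nat \<Rightarrow> nat) \<Rightarrow> complex. \<exists>\<epsilon>>0. \<forall>X\<in>mat_ball n A \<epsilon>.
        ((\<lambda>(\<alpha>, \<beta>). c \<alpha> \<beta> * entry_monomial n \<alpha> \<beta> (X - A)) has_sum f X)
          (exponents n \<times> exponents n))"

text \<open>To be used for open \<open>U\<close> only.\<close>

definition analytic_mat_fun :: "nat \<Rightarrow> (complex mat \<Rightarrow> complex mat) \<Rightarrow> complex mat set \<Rightarrow> bool" where
  "analytic_mat_fun n F U \<longleftrightarrow>
     (\<forall>i<n. \<forall>j<n. \<forall>A\<in>U. entry_analytic_at n (\<lambda>X. F X $$ (i, j)) A)"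

definition reducing_map ::
  "nat \<Rightarrow> complex mat \<Rightarrow> symbol mat \<Rightarrow> complex mat set \<Rightarrow> (complex mat \<Rightarrow> complex mat) \<Rightarrow> bool" where
  "reducing_map n A D U S \<longleftrightarrow>
     open_mats n U \<and> 0\<^sub>m n n \<in> U \<and> S ` U \<subseteq> carrier_mat n n \<and>
     analytic_mat_fun n S U \<and> (\<forall>X\<in>U. invertible_mat (S X)) \<and> S (0\<^sub>m n n) = 1\<^sub>m n \<and>
     (\<forall>X\<in>U. mat_adjoint (S X) * (A + X) * S X \<in> (\<lambda>M. A + M) ` symbol_space D) \<and>
     analytic_mat_fun n (\<lambda>X. mat_adjoint (S X) * (A + X) * S X) U"

end

theory Submission
  imports Defs
begin

text \<open>Everything rests on the decomposition of the real space of all matrices as the direct sum of the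
  tangent space \<open>T(A)\<close> and \<open>D(\<complex>)\<close>. Since \<open>X \<mapsto> X\<^sup>* A + A X\<close> respects the block partition, it
  splits into one statement for each diagonal block and one for each pair of symmetric off-diagonal
  blocks. In a pair with an invertible summand one of the two blocks can be eliminated, and the
  remaining Sylvester map is triangular with nonzero diagonal for different eigenvalues and a shift
  along diagonals for equal ones.

  Given the decomposition, put \<open>S(X) = I + Y\<close>. The reduction asks that the sum of the tangent map at
  \<open>Y\<close> and of a remainder \<open>R(X, Y)\<close>, which has no term linear in \<open>Y\<close> alone, lie in \<open>D(\<complex>)\<close>. With a
  real linear map \<open>P\<close> for which \<open>B + X\<^sup>* A + A X \<in> D(\<complex>)\<close> at \<open>X = P B\<close>, it suffices that
  \<open>Y = P (R(X, Y))\<close>, and this contraction is solved in the algebra of power series in the entries of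
  \<open>X\<close> and their conjugates with absolutely summable coefficients.

  Conversely, the derivative of \<open>S(t B)\<^sup>* (A + t B) S(t B)\<close> at \<open>t = 0\<close> shows that \<open>T(A)\<close> and
  \<open>D'(\<complex>)\<close> span all matrices whenever \<open>D'\<close> admits a reducing map, so \<open>dim D'(\<complex>)\<close> is at
  least the codimension of \<open>T(A)\<close>, which is \<open>dim D(\<complex>)\<close>.\<close>

section \<open>Complements of the range of a linear map\<close>

text \<open>The tangent map may have a large kernel (the infinitesimal stabiliser of A), so its
  solutions are not unique. For this reason \<open>complements\<close> speaks of values only: every
  right-hand side is hit modulo D, and a value lying in D is 0. Since X also enters through its
  conjugate transpose, all maps are merely real linear. Hence the units 1 and i at a position are
  treated separately, all linear combinations have real coefficients, and all dimensions are real.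
  The order of the summands makes the first member of a pair invertible unless both are nilpotent
  Jordan blocks. Analyticity is required at every point of U, not only at 0. Therefore the whole
  iteration takes place on one fixed polydisc with one coefficient norm, and the resulting series
  are recentred afterwards. The lower bound uses no directness for D': projecting along T(A) maps D'
  onto D as soon as D' and T(A) span.\<close>

type_synonym entries = "nat \<times> nat \<Rightarrow> complex"

abbreviation grid :: "nat \<Rightarrow> nat \<Rightarrow> (nat \<times> nat) set" where
  "grid n m \<equiv> {..<n} \<times> {..<m}"

text \<open>For additive \<open>L\<close> and sets \<open>W e\<close> that are subgroups: the functions on \<open>E\<close> are the direct sum
  of the range of \<open>L\<close> and of the product of the sets \<open>W e\<close>.\<close>

definition complements ::
  "(('v \<Rightarrow> complex) \<Rightarrow> 'e \<Rightarrow> complex) \<Rightarrow> 'e set \<Rightarrow> ('e \<Rightarrow> complex set) \<Rightarrow> bool" where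
  "complements L E W \<longleftrightarrow>
     (\<forall>b. \<exists>x. \<forall>e\<in>E. b e - L x e \<in> W e) \<and>
     (\<forall>x. (\<forall>e\<in>E. L x e \<in> W e) \<longrightarrow> (\<forall>e\<in>E. L x e = 0))"

lemma complementsI:
  assumes "\<And>b. \<exists>x. \<forall>e\<in>E. b e - L x e \<in> W e"
    and "\<And>x e. \<lbrakk>\<forall>e\<in>E. L x e \<in> W e; e \<in> E\<rbrakk> \<Longrightarrow> L x e = 0"
  shows "complements L E W"
  using assms unfolding complements_def by blast

lemma complements_solve:
  "complements L E W \<Longrightarrow> \<exists>x. \<forall>e\<in>E. b e - L x e \<in> W e"
  unfolding complements_def by blast

lemma complements_trivial:
  "\<lbrakk>complements L E W; \<forall>e\<in>E. L x e \<in> W e; e \<in> E\<rbrakk> \<Longrightarrow> L x e = 0"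
  unfolding complements_def by blast

text \<open>For zero \<open>W\<close> the second condition of \<open>complements\<close> is
  automatic, so solvability is all that has to be shown. This serves the blocks that are prescribed
  to vanish.\<close>

lemma complements_zeroI:
  assumes "\<And>b. \<exists>x. \<forall>e\<in>E. L x e = b e" and "\<And>e. e \<in> E \<Longrightarrow> W e = {0}"
  shows "complements L E W"
proof (rule complementsI)
  fix b
  obtain x where "\<forall>e\<in>E. L x e = b e" using assms(1) by blast
  then show "\<exists>x. \<forall>e\<in>E. b e - L x e \<in> W e"
    using assms(2) by (intro exI[of _ x]) auto
qed (use assms(2) in auto)

text \<open>Only the range of \<open>L\<close> on \<open>E\<close> matters, so the unknowns may be
  scaled, reflected or re-parametrised.\<close>

lemma complements_same_image:
  assumes "complements L' E W"
    and "\<And>x. \<exists>y. \<forall>e\<in>E. L' y e = L x e"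
    and "\<And>y. \<exists>x. \<forall>e\<in>E. L x e = L' y e"
    and "\<And>e. e \<in> E \<Longrightarrow> W' e = W e"
  shows "complements L E W'"
proof (rule complementsI)
  fix b
  obtain y where "\<forall>e\<in>E. b e - L' y e \<in> W e"
    using complements_solve[OF assms(1)] by blast
  moreover obtain x where "\<forall>e\<in>E. L x e = L' y e" using assms(3) by blast
  ultimately show "\<exists>x. \<forall>e\<in>E. b e - L x e \<in> W' e"
    using assms(4) by (intro exI[of _ x]) simp
next
  fix x e assume L: "\<forall>e\<in>E. L x e \<in> W' e" and e: "e \<in> E"
  obtain y where y: "\<forall>e\<in>E. L' y e = L x e" using assms(2) by blast
  then show "L x e = 0"
    using complements_trivial[OF assms(1), of y e] L e assms(4) by simp
qed

text \<open>Here the equations are renamed as well, along the bijection \<open>h\<close>.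
  Transposition, reversal of rows and the embedding of a block into the full matrix are all of this
  kind.\<close>

lemma complements_reindex:
  assumes "complements L' E' (\<lambda>e. W (h e))" and "h ` E' = E" and "inj_on h E'"
    and "\<And>x. \<exists>y. \<forall>e\<in>E'. L' y e = L x (h e)"
    and "\<And>y. \<exists>x. \<forall>e\<in>E'. L x (h e) = L' y e"
  shows "complements L E W"
proof (rule complementsI)
  fix b
  obtain y where "\<forall>e\<in>E'. b (h e) - L' y e \<in> W (h e)"
    using complements_solve[OF assms(1), of "\<lambda>e. b (h e)"] by blast
  moreover obtain x where "\<forall>e\<in>E'. L x (h e) = L' y e" using assms(5) by blast
  ultimately show "\<exists>x. \<forall>e\<in>E. b e - L x e \<in> W e" using assms(2) by (intro exI[of _ x]) auto
next
  fix x e assume L: "\<forall>e\<in>E. L x e \<in> W e" and e: "e \<in> E"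
  obtain y where y: "\<forall>e\<in>E'. L' y e = L x (h e)" using assms(4) by blast
  obtain e' where e': "e' \<in> E'" "e = h e'" using e assms(2) by blast
  have "\<forall>e\<in>E'. L' y e \<in> W (h e)" using y L assms(2) by auto
  then have "L' y e' = 0" using complements_trivial[OF assms(1)] e' by blast
  then show "L x e = 0" using y e' by simp
qed

text \<open>The equations in \<open>E c\<close> involve only the unknowns in \<open>V c\<close>, and no unknown is shared.\<close>

lemma complements_Union:
  assumes "\<And>c. c \<in> C \<Longrightarrow> complements L (E c) W"
    and "\<And>c x y e. \<lbrakk>c \<in> C; e \<in> E c; \<forall>v\<in>V c. x v = y v\<rbrakk> \<Longrightarrow> L x e = L y e"
    and "\<And>c c'. \<lbrakk>c \<in> C; c' \<in> C; c \<noteq> c'\<rbrakk> \<Longrightarrow> V c \<inter> V c' = {}"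
  shows "complements L (\<Union>c\<in>C. E c) W"
proof (rule complementsI)
  fix b
  have "\<forall>c\<in>C. \<exists>x. \<forall>e\<in>E c. b e - L x e \<in> W e"
    using complements_solve[OF assms(1)] by simp
  then obtain x where x: "\<And>c e. \<lbrakk>c \<in> C; e \<in> E c\<rbrakk> \<Longrightarrow> b e - L (x c) e \<in> W e" by metis
  \<comment> \<open>The local solutions are glued: an unknown lies in at most one \<open>V c\<close>
    and takes its value from the solution belonging to that \<open>c\<close>.\<close>
  define y where "y v = x (THE c. c \<in> C \<and> v \<in> V c) v" for v
  have "y v = x c v" if "c \<in> C" "v \<in> V c" for c v
  proof -
    have "(THE c. c \<in> C \<and> v \<in> V c) = c" using that assms(3) by (intro the_equality) blast+
    then show ?thesis by (simp add: y_def)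
  qed
  then have "L y e = L (x c) e" if "c \<in> C" "e \<in> E c" for c e
    using assms(2) that by blast
  then show "\<exists>x. \<forall>e\<in>(\<Union>c\<in>C. E c). b e - L x e \<in> W e"
    using x by (intro exI[of _ y]) auto
next
  fix x e assume "\<forall>e\<in>(\<Union>c\<in>C. E c). L x e \<in> W e" "e \<in> (\<Union>c\<in>C. E c)"
  then obtain c where "c \<in> C" "e \<in> E c" "\<forall>e\<in>E c. L x e \<in> W e" by blast
  then show "L x e = 0" using complements_trivial[OF assms(1)] by blast
qed

text \<open>Well-founded recursion along the rank \<open>\<mu>\<close>, in a form usable inside
  proofs, where the recursion equation depends on local data such as a right-hand side.\<close>

lemma recursive_fun_exists:
  fixes \<mu> :: "'e \<Rightarrow> nat" and F :: "('e \<Rightarrow> 'a) \<Rightarrow> 'e \<Rightarrow> 'a"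
  assumes "\<And>e f g. (\<And>e'. \<mu> e' < \<mu> e \<Longrightarrow> f e' = g e') \<Longrightarrow> F f e = F g e"
  shows "\<exists>f. \<forall>e. f e = F f e"
proof -
  have "adm_wf (measure \<mu>) F" unfolding adm_wf_def
  proof (intro allI impI)
    fix f g :: "'e \<Rightarrow> 'a" and e assume "\<forall>z. (z, e) \<in> measure \<mu> \<longrightarrow> f z = g z"
    then show "F f e = F g e" by (intro assms) simp
  qed
  then have "\<forall>e. wfrec (measure \<mu>) F e = F (wfrec (measure \<mu>) F) e"
    using wfrec_fixpoint[OF wf_measure, of \<mu> F] by simp
  then show ?thesis by blast
qed

text \<open>A triangular system: up to the relabelling \<open>\<tau>\<close> of the unknowns, equation \<open>e\<close> has the
  diagonal term \<open>c e * x (\<tau> e)\<close> and otherwise only unknowns of lower rank \<open>\<mu>\<close>.\<close>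

lemma triangular_solve:
  fixes \<mu> :: "'e \<Rightarrow> nat" and L :: "('v \<Rightarrow> complex) \<Rightarrow> 'e \<Rightarrow> complex"
  assumes L: "\<And>x e. e \<in> E \<Longrightarrow> L x e = c e * x (\<tau> e) + N x e"
    and c: "\<And>e. e \<in> E \<Longrightarrow> c e \<noteq> 0"
    and \<tau>: "inj_on \<tau> E"
    and N: "\<And>x y e. \<lbrakk>e \<in> E; \<And>e'. \<lbrakk>e' \<in> E; \<mu> e' < \<mu> e\<rbrakk> \<Longrightarrow> x (\<tau> e') = y (\<tau> e')\<rbrakk> \<Longrightarrow> N x e = N y e"
  shows "\<exists>x. \<forall>e\<in>E. L x e = b e"
proof -
  \<comment> \<open>The recursion runs over equations; \<open>ext\<close> carries the value found at
    \<open>e\<close> to the unknown \<open>\<tau> e\<close> and puts 0 at unknowns that are diagonal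
    for no equation.\<close>
  define ext where "ext f v = (if v \<in> \<tau> ` E then f (the_inv_into E \<tau> v) else 0)"
    for f :: "'e \<Rightarrow> complex" and v
  have ext: "ext f (\<tau> e) = f e" if "e \<in> E" for f e
    using that \<tau> by (simp add: ext_def the_inv_into_f_f)
  define F where "F f e = (if e \<in> E then (b e - N (ext f) e) / c e else 0)" for f e
  have "\<exists>f. \<forall>e. f e = F f e"
  proof (rule recursive_fun_exists)
    fix e and f g :: "'e \<Rightarrow> complex" assume fg: "\<And>e'. \<mu> e' < \<mu> e \<Longrightarrow> f e' = g e'"
    show "F f e = F g e"
    proof (cases "e \<in> E")
      case True
      then have "N (ext f) e = N (ext g) e" using N ext fg by metis
      then show ?thesis by (simp add: F_def)
    qed (simp add: F_def)
  qed
  then obtain f where f: "\<And>e. f e = F f e" by blast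
  have "L (ext f) e = b e" if "e \<in> E" for e
    using f[of e] that L[OF that, of "ext f"] ext[OF that, of f] c[OF that]
    by (simp add: F_def field_simps)
  then show ?thesis by blast
qed

lemma triangular_solve_grid:
  fixes N :: "entries \<Rightarrow> entries" and \<mu> :: "nat \<Rightarrow> nat \<Rightarrow> nat"
  assumes "c \<noteq> 0"
    and N: "\<And>x y i j. \<lbrakk>i < n; j < m; \<And>i' j'. \<lbrakk>i' < n; j' < m; \<mu> i' j' < \<mu> i j\<rbrakk> \<Longrightarrow> x (i', j') = y (i', j')\<rbrakk> \<Longrightarrow>
      N x (i, j) = N y (i, j)"
  shows "\<exists>x. \<forall>e\<in>grid n m. c * x e + N x e = b e"
proof (rule triangular_solve[where c = "\<lambda>_. c" and \<tau> = "\<lambda>e. e" and \<mu> = "\<lambda>(i, j). \<mu> i j" and N = N])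
  fix x y :: "entries" and e
  assume e: "e \<in> grid n m"
    and xy: "\<And>e'. \<lbrakk>e' \<in> grid n m; (case e' of (i, j) \<Rightarrow> \<mu> i j) < (case e of (i, j) \<Rightarrow> \<mu> i j)\<rbrakk> \<Longrightarrow> x e' = y e'"
  obtain i j where ij: "e = (i, j)" "i < n" "j < m" using e by auto
  show "N x e = N y e" unfolding ij(1) by (rule N[OF ij(2,3)]) (use ij xy in auto)
qed (use assms(1) in auto)

section \<open>Shift maps\<close>

text \<open>In matrix form this is J^T x - x J for nilpotent Jordan blocks J of the two sizes. It
  refers only to smaller indices, so the sizes need not be parameters.\<close>

definition nw_shift :: "entries \<Rightarrow> entries" where
  "nw_shift x = (\<lambda>(i, j). (if 0 < i then x (i - 1, j) else 0) - (if 0 < j then x (i, j - 1) else 0))"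

text \<open>The equation at \<open>(i, j)\<close> with \<open>0 < j\<close> expresses
  \<open>x (i, j - 1)\<close> through \<open>x (i - 1, j)\<close>, so the rows can be filled from
  the top.\<close>

lemma nw_shift_solve:
  "\<exists>x. \<forall>i j. 0 < j \<longrightarrow> j < m \<longrightarrow> nw_shift x (i, j) = b (i, j)"
proof -
  define f where "f = rec_nat (\<lambda>j. - b (0, j + 1)) (\<lambda>i r j. r (j + 1) - b (Suc i, j + 1))"
  have f: "f 0 j = - b (0, j + 1)" "f (Suc i) j = f i (j + 1) - b (Suc i, j + 1)" for i j
    by (simp_all add: f_def)
  have "nw_shift (\<lambda>(i, j). f i j) (i, j) = b (i, j)" if "0 < j" for i j
    using that by (cases i; cases j) (simp_all add: nw_shift_def f)
  then show ?thesis by blast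
qed

text \<open>If the value vanishes off the first column, then following antidiagonals down from row 0
  gives \<open>x (i, j) = 0\<close> whenever \<open>i + j + 1 < m\<close>. Because
  \<open>n \<le> m\<close>, the entry \<open>x (i - 1, 0)\<close> seen by the first column lies in
  that region, so the first column vanishes too.\<close>

lemma nw_shift_complement_column:
  assumes "n \<le> m"
    and "\<And>i j. \<lbrakk>i < n; j < m\<rbrakk> \<Longrightarrow> W (i, j) = (if j = 0 then UNIV else {0})"
  shows "complements nw_shift (grid n m) W"
proof (rule complementsI)
  fix b :: "entries"
  obtain x where "\<forall>i j. 0 < j \<longrightarrow> j < m \<longrightarrow> nw_shift x (i, j) = b (i, j)"
    using nw_shift_solve by blast
  then show "\<exists>x. \<forall>e\<in>grid n m. b e - nw_shift x e \<in> W e"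
    using assms(2) by (intro exI[of _ x]) auto
next
  fix x e assume L: "\<forall>e\<in>grid n m. nw_shift x e \<in> W e" and e: "e \<in> grid n m"
  have z: "nw_shift x (i, j) = 0" if "i < n" "j < m" "0 < j" for i j
    using L assms(2)[of i j] that by force
  have x: "x (i, j) = 0" if "i < n" "i + j + 1 < m" for i j
    using that
  proof (induction i arbitrary: j)
    case 0
    then show ?case using z[of 0 "Suc j"] by (simp add: nw_shift_def)
  next
    case (Suc i)
    then show ?case using z[of "Suc i" "Suc j"] Suc.IH[of "Suc j"] by (simp add: nw_shift_def)
  qed
  obtain i j where ij: "e = (i, j)" "i < n" "j < m" using e by auto
  show "nw_shift x e = 0"
  proof (cases "j = 0")
    case True
    then show ?thesis using ij x[of "i - 1" 0] assms(1) by (simp add: nw_shift_def)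
  qed (use ij z in simp)
qed

lemma nw_shift_swap: "nw_shift (\<lambda>(i, j). - x (j, i)) (i, j) = nw_shift x (j, i)"
  by (simp add: nw_shift_def)

text \<open>Transposition together with a sign exchanges the two terms of the shift.\<close>

lemma nw_shift_complement_row:
  assumes "m \<le> n"
    and "\<And>i j. \<lbrakk>i < n; j < m\<rbrakk> \<Longrightarrow> W (i, j) = (if i = 0 then UNIV else {0})"
  shows "complements nw_shift (grid n m) W"
proof (rule complements_reindex[where L' = nw_shift and h = prod.swap])
  show "complements nw_shift (grid m n) (\<lambda>e. W (prod.swap e))"
    using assms by (intro nw_shift_complement_column) auto
  show "\<exists>y. \<forall>e\<in>grid m n. nw_shift y e = nw_shift x (prod.swap e)" for x
    by (intro exI[of _ "\<lambda>(i, j). - x (j, i)"]) (auto simp: nw_shift_swap)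
  show "\<exists>x. \<forall>e\<in>grid m n. nw_shift x (prod.swap e) = nw_shift y e" for y
    by (intro exI[of _ "\<lambda>(i, j). - y (j, i)"]) (auto simp: nw_shift_swap)
qed auto

text \<open>In matrix form this is J x - x J with nilpotent Jordan blocks, and
  \<open>ne_shift\<close> below is x J^T - J^T x. The size parameter marks the border beyond which
  the neighbour with the larger index is missing.\<close>

definition sw_shift :: "nat \<Rightarrow> entries \<Rightarrow> entries" where
  "sw_shift n x = (\<lambda>(i, j). (if i + 1 < n then x (i + 1, j) else 0) - (if 0 < j then x (i, j - 1) else 0))"

definition ne_shift :: "nat \<Rightarrow> entries \<Rightarrow> entries" where
  "ne_shift m x = (\<lambda>(i, j). (if j + 1 < m then x (i, j + 1) else 0) - (if 0 < i then x (i - 1, j) else 0))"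

text \<open>Reversing the rows conjugates J into its transpose, which turns one shift into the
  other.\<close>

lemma sw_shift_reverse:
  assumes "i < n"
  shows "sw_shift n x (n - 1 - i, j) = nw_shift (\<lambda>(i, j). x (n - 1 - i, j)) (i, j)"
proof (cases i)
  case (Suc k)
  then have "Suc (n - Suc (Suc k)) = n - Suc k" "Suc (n - Suc (Suc k)) < n" using assms by auto
  then show ?thesis using assms Suc by (simp add: sw_shift_def nw_shift_def)
qed (use assms in \<open>simp add: sw_shift_def nw_shift_def\<close>)

lemma bij_reverse_fst:
  "(\<lambda>(i, j). (n - 1 - i, j)) ` (grid n m) = grid n m"
  "inj_on (\<lambda>(i, j). (n - 1 - i, j)) (grid n m)"
proof -
  show "inj_on (\<lambda>(i, j). (n - 1 - i, j)) (grid n m)" by (auto simp: inj_on_def)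
  then show "(\<lambda>(i, j). (n - 1 - i, j)) ` (grid n m) = grid n m"
    by (intro endo_inj_surj) auto
qed

definition nw_pattern :: "nat \<Rightarrow> nat \<Rightarrow> (nat \<times> nat \<Rightarrow> complex set) \<Rightarrow> bool" where
  "nw_pattern n m W \<longleftrightarrow> (n \<le> m \<and> (\<forall>i<n. \<forall>j<m. W (i, j) = (if j = 0 then UNIV else {0}))) \<or>
    (m \<le> n \<and> (\<forall>i<n. \<forall>j<m. W (i, j) = (if i = 0 then UNIV else {0})))"

definition sw_pattern :: "nat \<Rightarrow> nat \<Rightarrow> (nat \<times> nat \<Rightarrow> complex set) \<Rightarrow> bool" where
  "sw_pattern n m W \<longleftrightarrow> (n \<le> m \<and> (\<forall>i<n. \<forall>j<m. W (i, j) = (if j = 0 then UNIV else {0}))) \<or>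
    (m \<le> n \<and> (\<forall>i<n. \<forall>j<m. W (i, j) = (if i + 1 = n then UNIV else {0})))"

definition ne_pattern :: "nat \<Rightarrow> nat \<Rightarrow> (nat \<times> nat \<Rightarrow> complex set) \<Rightarrow> bool" where
  "ne_pattern n m W \<longleftrightarrow> (n \<le> m \<and> (\<forall>i<n. \<forall>j<m. W (i, j) = (if j + 1 = m then UNIV else {0}))) \<or>
    (m \<le> n \<and> (\<forall>i<n. \<forall>j<m. W (i, j) = (if i = 0 then UNIV else {0})))"

lemma nw_shift_pattern:
  assumes "nw_pattern n m W"
  shows "complements nw_shift (grid n m) W"
  using assms unfolding nw_pattern_def
proof
  assume "n \<le> m \<and> (\<forall>i<n. \<forall>j<m. W (i, j) = (if j = 0 then UNIV else {0}))"
  then show ?thesis by (intro nw_shift_complement_column) auto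
next
  assume "m \<le> n \<and> (\<forall>i<n. \<forall>j<m. W (i, j) = (if i = 0 then UNIV else {0}))"
  then show ?thesis by (intro nw_shift_complement_row) auto
qed

lemma sw_shift_pattern:
  assumes "sw_pattern n m W"
  shows "complements (sw_shift n) (grid n m) W"
proof (rule complements_reindex[where L' = nw_shift and h = "\<lambda>(i, j). (n - 1 - i, j)"])
  show "complements nw_shift (grid n m) (\<lambda>e. W (case e of (i, j) \<Rightarrow> (n - 1 - i, j)))"
  proof (rule nw_shift_pattern)
    show "nw_pattern n m (\<lambda>e. W (case e of (i, j) \<Rightarrow> (n - 1 - i, j)))"
      using assms unfolding nw_pattern_def sw_pattern_def
    proof (elim disjE, goal_cases)
      case 1
      then show ?case by (intro disjI1) auto
    next
      case 2
      then show ?case by (intro disjI2) auto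
    qed
  qed
  show "\<exists>y. \<forall>e\<in>grid n m. nw_shift y e = sw_shift n x (case e of (i, j) \<Rightarrow> (n - 1 - i, j))" for x
    using sw_shift_reverse by (intro exI[of _ "\<lambda>(i, j). x (n - 1 - i, j)"]) auto
  show "\<exists>x. \<forall>e\<in>grid n m. sw_shift n x (case e of (i, j) \<Rightarrow> (n - 1 - i, j)) = nw_shift y e" for y
  proof (intro exI[of _ "\<lambda>(i, j). y (n - 1 - i, j)"] ballI)
    fix e assume e: "e \<in> grid n m"
    then show "sw_shift n (\<lambda>(i, j). y (n - 1 - i, j)) (case e of (i, j) \<Rightarrow> (n - 1 - i, j)) = nw_shift y e"
      using sw_shift_reverse[of "fst e" n "\<lambda>(i, j). y (n - 1 - i, j)" "snd e"]
      by (auto simp: nw_shift_def)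
  qed
qed (rule bij_reverse_fst)+

lemma ne_shift_swap: "ne_shift m x (i, j) = sw_shift m (\<lambda>(i, j). x (j, i)) (j, i)"
  by (simp add: ne_shift_def sw_shift_def)

lemma ne_shift_pattern:
  assumes "ne_pattern n m W"
  shows "complements (ne_shift m) (grid n m) W"
proof (rule complements_reindex[where L' = "sw_shift m" and h = prod.swap])
  show "complements (sw_shift m) (grid m n) (\<lambda>e. W (prod.swap e))"
    using assms by (intro sw_shift_pattern) (auto simp: ne_pattern_def sw_pattern_def)
  show "\<exists>y. \<forall>e\<in>grid m n. sw_shift m y e = ne_shift m x (prod.swap e)" for x
    by (intro exI[of _ "\<lambda>(i, j). x (j, i)"]) (auto simp: ne_shift_swap)
  show "\<exists>x. \<forall>e\<in>grid m n. ne_shift m x (prod.swap e) = sw_shift m y e" for y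
    by (intro exI[of _ "\<lambda>(i, j). y (j, i)"]) (auto simp: ne_shift_def sw_shift_def)
qed auto

section \<open>Sparse row and column sums of the canonical blocks\<close>

definition jordan_entry :: "complex \<Rightarrow> nat \<Rightarrow> nat \<Rightarrow> complex" where
  "jordan_entry a i j = (if i = j then a else if j = i + 1 then 1 else 0)"

definition H_entry :: "nat \<Rightarrow> complex \<Rightarrow> nat \<Rightarrow> nat \<Rightarrow> complex" where
  "H_entry m a i j = (if i < m then (if j = m + i then 1 else 0)
     else if j < m then jordan_entry a (i - m) j else 0)"

text \<open>The parameter \<open>c\<close> is i for the canonical block itself and -i after
  conjugation, so that the family is closed under \<open>cnj\<close>.\<close>

definition Delta_entry :: "nat \<Rightarrow> complex \<Rightarrow> nat \<Rightarrow> nat \<Rightarrow> complex" where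
  "Delta_entry n c i j = (if i + j + 1 = n then 1 else if i + j = n then c else 0)"

lemma cnj_entry:
  "cnj (jordan_entry a i j) = jordan_entry (cnj a) i j"
  "cnj (H_entry m a i j) = H_entry m (cnj a) i j"
  "cnj (Delta_entry n c i j) = Delta_entry n (cnj c) i j"
  by (simp_all add: jordan_entry_def H_entry_def Delta_entry_def)

text \<open>Every row and column of a canonical block has at most two nonzero entries. The positions
  \<open>p\<close> and \<open>q\<close> may lie out of range, and they may coincide, as happens at
  the borders, where \<open>b\<close> is 0.\<close>

lemma sum_two_terms:
  fixes f g :: "nat \<Rightarrow> complex"
  assumes "\<And>k. k < n \<Longrightarrow> g k = (if k = p then a else 0) + (if k = q then b else 0)"
  shows "(\<Sum>k<n. g k * f k) = (if p < n then a * f p else 0) + (if q < n then b * f q else 0)"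
proof -
  have "(\<Sum>k<n. g k * f k) = (\<Sum>k<n. (if k = p then a * f k else 0) + (if k = q then b * f k else 0))"
    using assms by (intro sum.cong) (auto simp: algebra_simps)
  also have "\<dots> = (if p < n then a * f p else 0) + (if q < n then b * f q else 0)"
    by (simp add: sum.distrib sum.delta')
  finally show ?thesis .
qed

lemma jordan_row:
  "i < n \<Longrightarrow> (\<Sum>k<n. jordan_entry a i k * f k) = a * f i + (if i + 1 < n then f (i + 1) else 0)"
  by (subst sum_two_terms[where p = i and q = "i + 1" and a = a and b = 1])
     (auto simp: jordan_entry_def)

lemma jordan_col:
  "j < n \<Longrightarrow> (\<Sum>k<n. jordan_entry a k j * f k) = a * f j + (if 0 < j then f (j - 1) else 0)"
  by (subst sum_two_terms[where p = j and q = "j - 1" and a = a and b = "if 0 < j then 1 else 0"])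
     (auto simp: jordan_entry_def)

lemma H_row:
  assumes "i < 2 * m"
  shows "(\<Sum>k<2 * m. H_entry m a i k * f k) =
    (if i < m then f (m + i) else a * f (i - m) + (if i - m + 1 < m then f (i - m + 1) else 0))"
proof (cases "i < m")
  case True
  then show ?thesis
    by (subst sum_two_terms[where p = "m + i" and q = 0 and a = 1 and b = 0]) (auto simp: H_entry_def)
next
  case False
  then show ?thesis using assms
    by (subst sum_two_terms[where p = "i - m" and q = "i - m + 1" and a = a
          and b = "if i - m + 1 < m then 1 else 0"]) (auto simp: H_entry_def jordan_entry_def)
qed

lemma H_col:
  assumes "j < 2 * m"
  shows "(\<Sum>k<2 * m. H_entry m a k j * f k) =
    (if j < m then a * f (m + j) + (if 0 < j then f (m + j - 1) else 0) else f (j - m))"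
proof (cases "j < m")
  case True
  then show ?thesis
    by (subst sum_two_terms[where p = "m + j" and q = "m + j - 1" and a = a
          and b = "if 0 < j then 1 else 0"]) (auto simp: H_entry_def jordan_entry_def)
next
  case False
  then show ?thesis using assms
    by (subst sum_two_terms[where p = "j - m" and q = 0 and a = 1 and b = 0]) (auto simp: H_entry_def)
qed

lemma Delta_row:
  assumes "i < n"
  shows "(\<Sum>k<n. Delta_entry n c i k * f k) = f (n - 1 - i) + (if 0 < i then c * f (n - i) else 0)"
proof -
  have "Delta_entry n c i k = (if k = n - 1 - i then 1 else 0) + (if k = n - i then c else 0)"
    if "k < n" for k
  proof -
    have "i + k + 1 = n \<longleftrightarrow> k = n - 1 - i" "i + k = n \<longleftrightarrow> k = n - i" "n - 1 - i \<noteq> n - i"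
      using assms that by arith+
    then show ?thesis by (simp add: Delta_entry_def)
  qed
  from sum_two_terms[OF this] show ?thesis using assms by simp
qed

lemma Delta_col:
  assumes "j < n"
  shows "(\<Sum>k<n. Delta_entry n c k j * f k) = f (n - 1 - j) + (if 0 < j then c * f (n - j) else 0)"
proof -
  have "Delta_entry n c k j = Delta_entry n c j k" for k
    unfolding Delta_entry_def by (simp only: add.commute[of k j])
  then show ?thesis using Delta_row[OF assms] by simp
qed

section \<open>The tangent map on blocks\<close>

text \<open>\<open>x (u, i, j)\<close> is the \<open>(i, j)\<close> entry of the block in block row \<open>u\<close> and block column \<open>t u\<close>, where \<open>t\<close>
  is an involution: the identity of \<open>unit\<close> for a diagonal block, the negation of \<open>bool\<close> for a pair
  of off-diagonal blocks.\<close>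

definition tangent :: "('u \<Rightarrow> 'u) \<Rightarrow> ('u \<Rightarrow> nat) \<Rightarrow> ('u \<Rightarrow> nat \<Rightarrow> nat \<Rightarrow> complex) \<Rightarrow>
    ('u \<times> nat \<times> nat \<Rightarrow> complex) \<Rightarrow> 'u \<times> nat \<times> nat \<Rightarrow> complex" where
  "tangent t s M x = (\<lambda>(u, i, j). (\<Sum>k<s (t u). M (t u) k j * cnj (x (t u, k, i))) +
     (\<Sum>k<s u. M u i k * x (u, k, j)))"

definition positions :: "('u \<Rightarrow> 'u) \<Rightarrow> ('u \<Rightarrow> nat) \<Rightarrow> ('u \<times> nat \<times> nat) set" where
  "positions t s = {(u, i, j). i < s u \<and> j < s (t u)}"

text \<open>The map \<open>q \<mapsto> N q M\<^sup>* - N\<^sup>* q M\<close>, which remains of the tangent map on a pair of blocks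
  after the equation for one of them has been solved.\<close>

definition reduced_tangent :: "nat \<Rightarrow> nat \<Rightarrow> (nat \<Rightarrow> nat \<Rightarrow> complex) \<Rightarrow> (nat \<Rightarrow> nat \<Rightarrow> complex) \<Rightarrow>
    entries \<Rightarrow> entries" where
  "reduced_tangent m n M N q = (\<lambda>(i, j). (\<Sum>k<n. N i k * (\<Sum>l<m. cnj (M j l) * q (k, l))) -
     (\<Sum>k<n. cnj (N k i) * (\<Sum>l<m. M l j * q (k, l))))"

definition inverse_entries :: "nat \<Rightarrow> (nat \<Rightarrow> nat \<Rightarrow> complex) \<Rightarrow> (nat \<Rightarrow> nat \<Rightarrow> complex) \<Rightarrow> bool" where
  "inverse_entries m M M' \<longleftrightarrow> (\<forall>i<m. \<forall>j<m. (\<Sum>k<m. M i k * M' k j) = (if i = j then 1 else 0)) \<and>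
     (\<forall>i<m. \<forall>j<m. (\<Sum>k<m. M' i k * M k j) = (if i = j then 1 else 0))"

lemma sum_swap_assoc:
  fixes a b :: "nat \<Rightarrow> complex"
  shows "(\<Sum>k<m. a k * (\<Sum>l<n. c k l * b l)) = (\<Sum>l<n. (\<Sum>k<m. a k * c k l) * b l)"
proof -
  have "(\<Sum>k<m. a k * (\<Sum>l<n. c k l * b l)) = (\<Sum>k<m. \<Sum>l<n. a k * c k l * b l)"
    by (simp add: sum_distrib_left mult.assoc)
  also have "\<dots> = (\<Sum>l<n. \<Sum>k<m. a k * c k l * b l)" by (rule sum.swap)
  finally show ?thesis by (simp add: sum_distrib_right)
qed

lemma inverse_entries_cancel:
  assumes "inverse_entries m M M'" "i < m"
  shows "(\<Sum>k<m. M i k * (\<Sum>l<m. M' k l * f l)) = f i"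
    and "(\<Sum>k<m. M' i k * (\<Sum>l<m. M k l * f l)) = f i"
    and "(\<Sum>k<m. M k i * (\<Sum>l<m. M' l k * f l)) = f i"
    and "(\<Sum>k<m. M' k i * (\<Sum>l<m. M l k * f l)) = f i"
proof -
  have 1: "(\<Sum>k<m. A i k * (\<Sum>l<m. B k l * f l)) = f i"
    if "\<And>j. j < m \<Longrightarrow> (\<Sum>k<m. A i k * B k j) = (if i = j then 1 else 0)" for A B :: "nat \<Rightarrow> nat \<Rightarrow> complex"
  proof -
    have "(\<Sum>k<m. A i k * (\<Sum>l<m. B k l * f l)) = (\<Sum>l<m. (\<Sum>k<m. A i k * B k l) * f l)"
      by (rule sum_swap_assoc)
    also have "\<dots> = (\<Sum>l<m. if l = i then f l else 0)" using that by (intro sum.cong) auto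
    finally show ?thesis using assms(2) by simp
  qed
  have M: "(\<Sum>k<m. M i k * M' k j) = (if i = j then 1 else 0)"
    "(\<Sum>k<m. M' i k * M k j) = (if i = j then 1 else 0)"
    "(\<Sum>k<m. M k i * M' j k) = (if i = j then 1 else 0)"
    "(\<Sum>k<m. M' k i * M j k) = (if i = j then 1 else 0)" if "j < m" for j
    using assms that by (simp_all add: inverse_entries_def mult.commute[of "M _ i"] mult.commute[of "M' _ i"])
  show "(\<Sum>k<m. M i k * (\<Sum>l<m. M' k l * f l)) = f i"
    by (rule 1[of M M']) (rule M)
  show "(\<Sum>k<m. M' i k * (\<Sum>l<m. M k l * f l)) = f i"
    by (rule 1[of M' M]) (rule M)
  show "(\<Sum>k<m. M k i * (\<Sum>l<m. M' l k * f l)) = f i"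
    by (rule 1[of "\<lambda>i k. M k i" "\<lambda>k l. M' l k"]) (rule M)
  show "(\<Sum>k<m. M' k i * (\<Sum>l<m. M l k * f l)) = f i"
    by (rule 1[of "\<lambda>i k. M' k i" "\<lambda>k l. M l k"]) (rule M)
qed

text \<open>Write M, N for the blocks \<open>M False\<close>, \<open>M True\<close> and H for the
  conjugate transpose. The two components of the map are X_T^H N + M X_F and X_F^H M + N X_T.
  Substituting X_T = q M^H and X_F = z - q^H N cancels the mixed term of the first, leaving M z, and
  turns the second into N q M^H - N^H q M + z^H M.\<close>

lemma tangent_reduced:
  fixes s :: "bool \<Rightarrow> nat" and M :: "bool \<Rightarrow> nat \<Rightarrow> nat \<Rightarrow> complex" and x :: "bool \<times> nat \<times> nat \<Rightarrow> complex"
    and q z :: "entries"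
  defines "m \<equiv> s False" and "n \<equiv> s True" and "L \<equiv> tangent Not s M x"
  assumes R: "\<And>k i. \<lbrakk>k < n; i < m\<rbrakk> \<Longrightarrow> x (True, k, i) = (\<Sum>l<m. cnj (M False i l) * q (k, l))"
    and S: "\<And>k j. \<lbrakk>k < m; j < n\<rbrakk> \<Longrightarrow> x (False, k, j) = z (k, j) - (\<Sum>l<n. M True l j * cnj (q (l, k)))"
  shows "\<lbrakk>i < m; j < n\<rbrakk> \<Longrightarrow> L (False, i, j) = (\<Sum>k<m. M False i k * z (k, j))"
    and "\<lbrakk>i < n; j < m\<rbrakk> \<Longrightarrow> L (True, i, j) =
      reduced_tangent m n (M False) (M True) q (i, j) + (\<Sum>k<m. M False k j * cnj (z (k, i)))"
proof -
  assume ij: "i < m" "j < n"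
  have "(\<Sum>k<n. M True k j * cnj (x (True, k, i))) =
      (\<Sum>k<n. M True k j * (\<Sum>l<m. M False i l * cnj (q (k, l))))"
    using R ij by (intro sum.cong) (auto simp: cnj_sum)
  also have "\<dots> = (\<Sum>k<m. M False i k * (\<Sum>l<n. M True l j * cnj (q (l, k))))"
    by (simp add: sum_distrib_left) (subst sum.swap, simp add: mult_ac)
  finally have *: "(\<Sum>k<n. M True k j * cnj (x (True, k, i))) =
    (\<Sum>k<m. M False i k * (\<Sum>l<n. M True l j * cnj (q (l, k))))" .
  have "(\<Sum>k<m. M False i k * x (False, k, j)) =
      (\<Sum>k<m. M False i k * z (k, j)) - (\<Sum>k<m. M False i k * (\<Sum>l<n. M True l j * cnj (q (l, k))))"
    using S ij by (simp add: right_diff_distrib sum_subtractf)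
  then show "L (False, i, j) = (\<Sum>k<m. M False i k * z (k, j))"
    using * by (simp add: L_def tangent_def m_def n_def)
next
  assume ij: "i < n" "j < m"
  have "(\<Sum>k<m. M False k j * cnj (x (False, k, i))) = (\<Sum>k<m. M False k j * cnj (z (k, i))) -
      (\<Sum>k<m. M False k j * (\<Sum>l<n. cnj (M True l i) * q (l, k)))"
    using S ij by (simp add: right_diff_distrib sum_subtractf cnj_sum)
  moreover have "(\<Sum>k<m. M False k j * (\<Sum>l<n. cnj (M True l i) * q (l, k))) =
      (\<Sum>k<n. cnj (M True k i) * (\<Sum>l<m. M False l j * q (k, l)))"
    by (simp add: sum_distrib_left) (subst sum.swap, simp add: mult_ac)
  moreover have "(\<Sum>k<n. M True i k * x (True, k, j)) =
      (\<Sum>k<n. M True i k * (\<Sum>l<m. cnj (M False j l) * q (k, l)))"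
    using R ij by simp
  ultimately show "L (True, i, j) =
      reduced_tangent m n (M False) (M True) q (i, j) + (\<Sum>k<m. M False k j * cnj (z (k, i)))"
    by (simp add: L_def tangent_def m_def n_def reduced_tangent_def)
qed

text \<open>For invertible \<open>M False\<close> the substitution of \<open>tangent_reduced\<close>
  is a bijective change of unknowns, and M z is arbitrary. So the block \<open>False\<close> can
  always be cleared, and the cokernel is that of the reduced map in the block
  \<open>True\<close>.\<close>

lemma complements_pair_invertible:
  fixes s :: "bool \<Rightarrow> nat" and M :: "bool \<Rightarrow> nat \<Rightarrow> nat \<Rightarrow> complex"
  defines "m \<equiv> s False" and "n \<equiv> s True"
  assumes inv: "inverse_entries m (M False) M'"
    and compl: "complements (reduced_tangent m n (M False) (M True)) (grid n m) W'"
    and W: "\<And>i j. \<lbrakk>i < m; j < n\<rbrakk> \<Longrightarrow> W (False, i, j) = {0}"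
           "\<And>i j. \<lbrakk>i < n; j < m\<rbrakk> \<Longrightarrow> W (True, i, j) = W' (i, j)"
  shows "complements (tangent Not s M) (positions Not s) W"
proof (rule complementsI)
  fix b
  \<comment> \<open>\<open>z\<close> makes the block \<open>False\<close> exact. Afterwards
    \<open>q\<close> has to absorb, modulo \<open>W'\<close>, what is left in the block
    \<open>True\<close> once the contribution of \<open>z\<close> is subtracted.\<close>
  define z where "z = (\<lambda>(i :: nat, j :: nat). \<Sum>k<m. M' i k * b (False, k, j))"
  obtain q where q: "\<forall>e\<in>grid n m. (case e of (i, j) \<Rightarrow> b (True, i, j) -
      (\<Sum>k<m. M False k j * cnj (z (k, i)))) - reduced_tangent m n (M False) (M True) q e \<in> W' e"
    using complements_solve[OF compl] by blast
  define x where "x = (\<lambda>(u, k :: nat, i :: nat). if u then (\<Sum>l<m. cnj (M False i l) * q (k, l))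
    else z (k, i) - (\<Sum>l<n. M True l i * cnj (q (l, k))))"
  have "tangent Not s M x (False, i, j) = b (False, i, j)" if "i < m" "j < n" for i j
  proof -
    have "tangent Not s M x (False, i, j) = (\<Sum>k<m. M False i k * z (k, j))"
      by (rule tangent_reduced(1)[where q = q and z = z and s = s and M = M and x = x, folded m_def n_def])
        (use that in \<open>auto simp: x_def\<close>)
    also have "\<dots> = b (False, i, j)"
      using inverse_entries_cancel(1)[OF inv that(1)] by (simp add: z_def)
    finally show ?thesis .
  qed
  moreover have "tangent Not s M x (True, i, j) =
    reduced_tangent m n (M False) (M True) q (i, j) + (\<Sum>k<m. M False k j * cnj (z (k, i)))"
    if "i < n" "j < m" for i j
    by (rule tangent_reduced(2)[where q = q and z = z and s = s and M = M and x = x, folded m_def n_def])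
      (use that in \<open>auto simp: x_def\<close>)
  ultimately have "b (u, i, j) - tangent Not s M x (u, i, j) \<in> W (u, i, j)"
    if "(u, i, j) \<in> positions Not s" for u i j
    using that q W by (cases u) (auto simp: positions_def m_def n_def algebra_simps)
  then show "\<exists>x. \<forall>e\<in>positions Not s. b e - tangent Not s M x e \<in> W e"
    by (intro exI[of _ x]) auto
next
  fix x e assume L: "\<forall>e\<in>positions Not s. tangent Not s M x e \<in> W e" and e: "e \<in> positions Not s"
  \<comment> \<open>The substitution is inverted for the given \<open>x\<close>. Since
    \<open>W\<close> is zero in the block \<open>False\<close>, M z = 0 and hence \<open>z\<close>
    vanishes, so only the reduced map remains.\<close>
  define q where "q = (\<lambda>(k :: nat, l :: nat). \<Sum>i<m. cnj (M' l i) * x (True, k, i))"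
  have R: "x (True, k, i) = (\<Sum>l<m. cnj (M False i l) * q (k, l))" if "i < m" for k i
  proof -
    have "cnj (\<Sum>l<m. cnj (M False i l) * q (k, l)) =
        (\<Sum>l<m. M False i l * (\<Sum>i<m. M' l i * cnj (x (True, k, i))))"
      by (simp add: q_def cnj_sum)
    also have "\<dots> = cnj (x (True, k, i))" using inverse_entries_cancel(1)[OF inv that] by simp
    finally show ?thesis by (simp only: complex_cnj_cancel_iff)
  qed
  define z where "z = (\<lambda>(k :: nat, j :: nat). x (False, k, j) + (\<Sum>l<n. M True l j * cnj (q (l, k))))"
  have S: "x (False, k, j) = z (k, j) - (\<Sum>l<n. M True l j * cnj (q (l, k)))" for k j
    by (simp add: z_def)
  have 0: "tangent Not s M x (False, i, j) = 0" if "i < m" "j < n" for i j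
    using L W that by (fastforce simp: positions_def m_def n_def)
  have Mz: "(\<Sum>k<m. M False i k * z (k, j)) = 0" if "i < m" "j < n" for i j
  proof -
    have "tangent Not s M x (False, i, j) = (\<Sum>k<m. M False i k * z (k, j))"
      by (rule tangent_reduced(1)[where q = q and z = z and s = s and M = M and x = x, folded m_def n_def])
        (use R S that in auto)
    then show ?thesis using 0[OF that] by simp
  qed
  have z: "z (i, j) = 0" if "i < m" "j < n" for i j
    using inverse_entries_cancel(2)[OF inv that(1), of "\<lambda>k. z (k, j)"] Mz that by simp
  have 1: "tangent Not s M x (True, i, j) = reduced_tangent m n (M False) (M True) q (i, j)"
    if "i < n" "j < m" for i j
  proof -
    have "tangent Not s M x (True, i, j) =
        reduced_tangent m n (M False) (M True) q (i, j) + (\<Sum>k<m. M False k j * cnj (z (k, i)))"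
      by (rule tangent_reduced(2)[where q = q and z = z and s = s and M = M and x = x, folded m_def n_def])
        (use R S that in auto)
    then show ?thesis using z that by simp
  qed
  have "reduced_tangent m n (M False) (M True) q e \<in> W' e" if "e \<in> grid n m" for e
    using that 1 W L by (fastforce simp: positions_def m_def n_def)
  then have "reduced_tangent m n (M False) (M True) q e = 0" if "e \<in> grid n m" for e
    using complements_trivial[OF compl] that by blast
  then show "tangent Not s M x e = 0"
    using 0 1 e by (cases "fst e") (auto simp: positions_def m_def n_def)
qed

section \<open>Pairs of blocks\<close>

lemma norm_mult_ne_one:
  assumes "1 < cmod a" "1 < cmod b"
  shows "1 - cnj b * a \<noteq> 0" "b * cnj a - 1 \<noteq> 0"
proof -
  have "1 < cmod b * cmod a" using assms less_1_mult by blast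
  then have "cmod (cnj b * a) \<noteq> 1" "cmod (b * cnj a) \<noteq> 1" by (simp_all add: norm_mult)
  then show "1 - cnj b * a \<noteq> 0" "b * cnj a - 1 \<noteq> 0" by auto
qed

text \<open>Four uncoupled systems, one per quadrant. Equations in a quadrant involve the unknowns
  of the opposite quadrant, because both blocks H have the antidiagonal 2 x 2 form; the solution is
  therefore assembled crosswise.\<close>

lemma complements_four_blocks:
  fixes L L1 L2 L3 L4 :: "entries \<Rightarrow> entries"
  assumes L: "\<And>x i j. \<lbrakk>i < n; j < m\<rbrakk> \<Longrightarrow> L x (i, j) = L1 (\<lambda>(i, j). x (n + i, m + j)) (i, j)"
    "\<And>x i j. \<lbrakk>i < n; j < m\<rbrakk> \<Longrightarrow> L x (i, m + j) = L2 (\<lambda>(i, j). x (n + i, j)) (i, j)"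
    "\<And>x i j. \<lbrakk>i < n; j < m\<rbrakk> \<Longrightarrow> L x (n + i, j) = L3 (\<lambda>(i, j). x (i, m + j)) (i, j)"
    "\<And>x i j. \<lbrakk>i < n; j < m\<rbrakk> \<Longrightarrow> L x (n + i, m + j) = L4 x (i, j)"
    and dep: "\<And>x y e. \<lbrakk>e \<in> grid n m; \<And>v. v \<in> grid n m \<Longrightarrow> x v = y v\<rbrakk> \<Longrightarrow>
      L1 x e = L1 y e \<and> L2 x e = L2 y e \<and> L3 x e = L3 y e \<and> L4 x e = L4 y e"
    and c: "complements L1 (grid n m) W" "complements L2 (grid n m) (\<lambda>(i, j). W (i, m + j))"
      "complements L3 (grid n m) (\<lambda>(i, j). W (n + i, j))"
      "complements L4 (grid n m) (\<lambda>(i, j). W (n + i, m + j))"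
  shows "complements L (grid (2 * n) (2 * m)) W"
proof (rule complementsI)
  let ?R = "grid n m"
  have quadrant: "(\<exists>i j. i < n \<and> j < m \<and> e = (i, j)) \<or> (\<exists>i j. i < n \<and> j < m \<and> e = (i, m + j)) \<or>
      (\<exists>i j. i < n \<and> j < m \<and> e = (n + i, j)) \<or> (\<exists>i j. i < n \<and> j < m \<and> e = (n + i, m + j))"
    if e: "e \<in> grid (2 * n) (2 * m)" for e
  proof -
    obtain i j where ij: "e = (i, j)" "i < 2 * n" "j < 2 * m" using e by auto
    have "i < n \<or> (\<exists>k<n. i = n + k)" "j < m \<or> (\<exists>k<m. j = m + k)"
      using ij by (metis add_diff_inverse_nat mult_2 nat_add_left_cancel_less)+
    then show ?thesis using ij(1) by blast
  qed
  {
    fix b :: "entries"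
    obtain x1 where x1: "\<forall>e\<in>?R. b e - L1 x1 e \<in> W e"
      using complements_solve[OF c(1), of b] by blast
    obtain x2 where x2: "\<forall>e\<in>?R. (case e of (i, j) \<Rightarrow> b (i, m + j)) - L2 x2 e \<in> (case e of (i, j) \<Rightarrow> W (i, m + j))"
      using complements_solve[OF c(2), of "\<lambda>(i, j). b (i, m + j)"] by blast
    obtain x3 where x3: "\<forall>e\<in>?R. (case e of (i, j) \<Rightarrow> b (n + i, j)) - L3 x3 e \<in> (case e of (i, j) \<Rightarrow> W (n + i, j))"
      using complements_solve[OF c(3), of "\<lambda>(i, j). b (n + i, j)"] by blast
    obtain x4 where x4: "\<forall>e\<in>?R. (case e of (i, j) \<Rightarrow> b (n + i, m + j)) - L4 x4 e \<in> (case e of (i, j) \<Rightarrow> W (n + i, m + j))"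
      using complements_solve[OF c(4), of "\<lambda>(i, j). b (n + i, m + j)"] by blast
    define x where "x = (\<lambda>(k, l). if k < n then (if l < m then x4 (k, l) else x3 (k, l - m))
      else if l < m then x2 (k - n, l) else x1 (k - n, l - m))"
    have "b e - L x e \<in> W e" if "e \<in> grid (2 * n) (2 * m)" for e
      using quadrant[OF that]
    proof (elim disjE exE conjE)
      fix i j assume ij: "i < n" "j < m" and e: "e = (i, j)"
      have "L x e = L1 x1 (i, j)"
        unfolding e L(1)[OF ij] using dep[of "(i, j)" "\<lambda>(i, j). x (n + i, m + j)" x1] ij by (auto simp: x_def)
      then show ?thesis using bspec[OF x1, of "(i, j)"] ij by (simp add: e)
    next
      fix i j assume ij: "i < n" "j < m" and e: "e = (i, m + j)"
      have "L x e = L2 x2 (i, j)"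
        unfolding e L(2)[OF ij] using dep[of "(i, j)" "\<lambda>(i, j). x (n + i, j)" x2] ij by (auto simp: x_def)
      then show ?thesis using bspec[OF x2, of "(i, j)"] ij by (simp add: e)
    next
      fix i j assume ij: "i < n" "j < m" and e: "e = (n + i, j)"
      have "L x e = L3 x3 (i, j)"
        unfolding e L(3)[OF ij] using dep[of "(i, j)" "\<lambda>(i, j). x (i, m + j)" x3] ij by (auto simp: x_def)
      then show ?thesis using bspec[OF x3, of "(i, j)"] ij by (simp add: e)
    next
      fix i j assume ij: "i < n" "j < m" and e: "e = (n + i, m + j)"
      have "L x e = L4 x4 (i, j)"
        unfolding e L(4)[OF ij] using dep[of "(i, j)" x x4] ij by (auto simp: x_def)
      then show ?thesis using bspec[OF x4, of "(i, j)"] ij by (simp add: e)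
    qed
    then show "\<exists>x. \<forall>e\<in>grid (2 * n) (2 * m). b e - L x e \<in> W e" by blast
  }
  fix x and e :: "nat \<times> nat"
  assume LW: "\<forall>e\<in>grid (2 * n) (2 * m). L x e \<in> W e" and e: "e \<in> grid (2 * n) (2 * m)"
  have LW': "L x (i, j) \<in> W (i, j)" if "i < 2 * n" "j < 2 * m" for i j using LW that by simp
  show "L x e = 0"
    using quadrant[OF e]
  proof (elim disjE exE conjE)
    fix i j assume ij: "i < n" "j < m" and e: "e = (i, j)"
    have "\<forall>e\<in>?R. L1 (\<lambda>(i, j). x (n + i, m + j)) e \<in> W e"
      by (auto simp: L(1)[where x = x, symmetric] intro!: LW')
    then show ?thesis unfolding e L(1)[OF ij] by (rule complements_trivial[OF c(1)]) (use ij in auto)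
  next
    fix i j assume ij: "i < n" "j < m" and e: "e = (i, m + j)"
    have "\<forall>e\<in>?R. L2 (\<lambda>(i, j). x (n + i, j)) e \<in> (case e of (i, j) \<Rightarrow> W (i, m + j))"
      by (auto simp: L(2)[where x = x, symmetric] intro!: LW')
    then show ?thesis unfolding e L(2)[OF ij] by (rule complements_trivial[OF c(2)]) (use ij in auto)
  next
    fix i j assume ij: "i < n" "j < m" and e: "e = (n + i, j)"
    have "\<forall>e\<in>?R. L3 (\<lambda>(i, j). x (i, m + j)) e \<in> (case e of (i, j) \<Rightarrow> W (n + i, j))"
      by (auto simp: L(3)[where x = x, symmetric] intro!: LW')
    then show ?thesis unfolding e L(3)[OF ij] by (rule complements_trivial[OF c(3)]) (use ij in auto)
  next
    fix i j assume ij: "i < n" "j < m" and e: "e = (n + i, m + j)"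
    have "\<forall>e\<in>?R. L4 x e \<in> (case e of (i, j) \<Rightarrow> W (n + i, m + j))"
      by (auto simp: L(4)[where x = x, symmetric] intro!: LW')
    then show ?thesis unfolding e L(4)[OF ij] by (rule complements_trivial[OF c(4)]) (use ij in auto)
  qed
qed

lemma reduced_tangent_H_H:
  fixes m n :: nat and a a' :: complex
  defines "L \<equiv> reduced_tangent (2 * m) (2 * n) (H_entry m a) (H_entry n a')"
  assumes "i < n" "j < m"
  shows "L q (i, j) = q (n + i, m + j) -
      (cnj a' * (a * q (n + i, m + j) + (if 0 < j then q (n + i, m + j - 1) else 0)) +
       (if 0 < i then a * q (n + i - 1, m + j) + (if 0 < j then q (n + i - 1, m + j - 1) else 0) else 0))"
    and "L q (i, m + j) = cnj a * q (n + i, j) + (if j + 1 < m then q (n + i, j + 1) else 0) -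
      (cnj a' * q (n + i, j) + (if 0 < i then q (n + i - 1, j) else 0))"
    and "L q (n + i, j) = a' * q (i, m + j) + (if i + 1 < n then q (i + 1, m + j) else 0) -
      (a * q (i, m + j) + (if 0 < j then q (i, m + j - 1) else 0))"
    and "L q (n + i, m + j) = a' * (cnj a * q (i, j) + (if j + 1 < m then q (i, j + 1) else 0)) +
      (if i + 1 < n then cnj a * q (i + 1, j) + (if j + 1 < m then q (i + 1, j + 1) else 0) else 0) - q (i, j)"
  unfolding L_def reduced_tangent_def using assms(2,3)
  by (simp_all add: H_row H_col cnj_entry)

text \<open>On the two diagonal quadrants the leading coefficients are 1 - cnj a' a and a' cnj a -
  1, nonzero because both moduli exceed 1. On the other two they are cnj (a - a') and a' - a. These
  vanish for equal eigenvalues, and then the pure shifts \<open>ne_shift\<close> and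
  \<open>sw_shift\<close> remain, whose cokernels are the prescribed patterns.\<close>

lemma complements_H_H:
  assumes a: "1 < cmod a" "1 < cmod a'"
    and W0: "\<And>i j. \<lbrakk>i < n; j < m\<rbrakk> \<Longrightarrow> W (i, j) = {0} \<and> W (n + i, m + j) = {0}"
    and W1: "\<And>i j. \<lbrakk>a \<noteq> a'; i < n; j < m\<rbrakk> \<Longrightarrow> W (i, m + j) = {0} \<and> W (n + i, j) = {0}"
    and W2: "a = a' \<Longrightarrow> ne_pattern n m (\<lambda>(i, j). W (i, m + j))" "a = a' \<Longrightarrow> sw_pattern n m (\<lambda>(i, j). W (n + i, j))"
  shows "complements (reduced_tangent (2 * m) (2 * n) (H_entry m a) (H_entry n a')) (grid (2 * n) (2 * m)) W"
proof -
  define N1 where "N1 x = (\<lambda>(i, j). - (cnj a' * (if 0 < j then x (i, j - 1) else 0)) -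
      (if 0 < i then a * x (i - 1, j) + (if 0 < j then x (i - 1, j - 1) else 0) else 0))"
    for x :: "entries"
  define N4 where "N4 x = (\<lambda>(i, j). a' * (if j + 1 < m then x (i, j + 1) else 0) +
      (if i + 1 < n then cnj a * x (i + 1, j) + (if j + 1 < m then x (i + 1, j + 1) else 0) else 0))"
    for x :: "entries"
  define L1 where "L1 x e = (1 - cnj a' * a) * x e + N1 x e" for x e
  define L2 where "L2 x e = cnj (a - a') * x e + ne_shift m x e" for x e
  define L3 where "L3 x e = (a' - a) * x e + sw_shift n x e" for x e
  define L4 where "L4 x e = (a' * cnj a - 1) * x e + N4 x e" for x e
  let ?R = "grid n m"
  have c1: "complements L1 ?R W"
  proof (rule complements_zeroI)
    \<comment> \<open>The rank falls in the directions to which the remainder refers: here up and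
      left. In the other quadrants rows or columns are counted from the opposite border
      accordingly.\<close>
    show "\<exists>x. \<forall>e\<in>?R. L1 x e = b e" for b unfolding L1_def
      by (rule triangular_solve_grid[where \<mu> = "\<lambda>i j. i + j"])
        (use norm_mult_ne_one[OF a] in \<open>auto simp: N1_def\<close>)
  qed (use W0 in auto)
  have c4: "complements L4 ?R (\<lambda>(i, j). W (n + i, m + j))"
  proof (rule complements_zeroI)
    show "\<exists>x. \<forall>e\<in>?R. L4 x e = b e" for b unfolding L4_def
      by (rule triangular_solve_grid[where \<mu> = "\<lambda>i j. (n - i) + (m - j)"])
        (use norm_mult_ne_one[OF a] in \<open>auto simp: N4_def\<close>)
  qed (use W0 in auto)
  have c2: "complements L2 ?R (\<lambda>(i, j). W (i, m + j))"
  proof (cases "a = a'")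
    case True
    then have "L2 = ne_shift m" by (simp add: L2_def fun_eq_iff)
    then show ?thesis using ne_shift_pattern[OF W2(1)[OF True]] by simp
  next
    case False
    show ?thesis
    proof (rule complements_zeroI)
      show "\<exists>x. \<forall>e\<in>?R. L2 x e = b e" for b unfolding L2_def
        by (rule triangular_solve_grid[where \<mu> = "\<lambda>i j. i + (m - j)"]) (use False in \<open>auto simp: ne_shift_def\<close>)
    qed (use W1 False in auto)
  qed
  have c3: "complements L3 ?R (\<lambda>(i, j). W (n + i, j))"
  proof (cases "a = a'")
    case True
    then have "L3 = sw_shift n" by (simp add: L3_def fun_eq_iff)
    then show ?thesis using sw_shift_pattern[OF W2(2)[OF True]] by simp
  next
    case False
    show ?thesis
    proof (rule complements_zeroI)
      show "\<exists>x. \<forall>e\<in>?R. L3 x e = b e" for b unfolding L3_def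
        by (rule triangular_solve_grid[where \<mu> = "\<lambda>i j. (n - i) + j"]) (use False in \<open>auto simp: sw_shift_def\<close>)
    qed (use W1 False in auto)
  qed
  show ?thesis
  proof (rule complements_four_blocks[OF _ _ _ _ _ c1 c2 c3 c4])
    fix x :: "entries" and i j assume ij: "i < n" "j < m"
    let ?L = "reduced_tangent (2 * m) (2 * n) (H_entry m a) (H_entry n a') x"
    show "?L (i, j) = L1 (\<lambda>(i, j). x (n + i, m + j)) (i, j)"
      unfolding reduced_tangent_H_H(1)[OF ij] L1_def N1_def
      by (cases "0 < i"; cases "0 < j") (simp_all add: algebra_simps)
    show "?L (i, m + j) = L2 (\<lambda>(i, j). x (n + i, j)) (i, j)"
      unfolding reduced_tangent_H_H(2)[OF ij] L2_def ne_shift_def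
      by (cases "0 < i") (simp_all add: algebra_simps)
    show "?L (n + i, j) = L3 (\<lambda>(i, j). x (i, m + j)) (i, j)"
      unfolding reduced_tangent_H_H(3)[OF ij] L3_def sw_shift_def
      by (cases "0 < j") (simp_all add: algebra_simps)
    show "?L (n + i, m + j) = L4 x (i, j)"
      unfolding reduced_tangent_H_H(4)[OF ij] L4_def N4_def by (simp add: algebra_simps)
  next
    fix x y :: "entries" and e
    assume e: "e \<in> ?R" and xy: "\<And>v. v \<in> ?R \<Longrightarrow> x v = y v"
    obtain i j where ij: "e = (i, j)" "i < n" "j < m" using e by auto
    have "x (i', j') = y (i', j')" if "i' < n" "j' < m" for i' j' using xy that by simp
    then show "L1 x e = L1 y e \<and> L2 x e = L2 y e \<and> L3 x e = L3 y e \<and> L4 x e = L4 y e"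
      using ij by (auto simp: L1_def L2_def L3_def L4_def N1_def N4_def ne_shift_def sw_shift_def)
  qed
qed

lemma Delta_scaled:
  assumes "i < n"
  shows "(\<Sum>k<n. \<mu> * Delta_entry n c i k * f k) = \<mu> * (f (n - 1 - i) + (if 0 < i then c * f (n - i) else 0))"
    and "(\<Sum>k<n. \<mu> * Delta_entry n c k i * f k) = \<mu> * (f (n - 1 - i) + (if 0 < i then c * f (n - i) else 0))"
  using Delta_row[OF assms, of c f] Delta_col[OF assms, of c f]
  by (simp_all add: mult.assoc sum_distrib_left[symmetric])

text \<open>Both leading coefficients compare a number of modulus 1 with one of modulus
  \<open>cmod a\<close>, so neither can vanish and the reduced map is onto.\<close>

lemma complements_H_Delta:
  assumes a: "1 < cmod a" and \<mu>: "cmod \<mu> = 1"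
    and W: "\<And>i j. \<lbrakk>i < n; j < 2 * m\<rbrakk> \<Longrightarrow> W (i, j) = {0}"
  shows "complements (reduced_tangent (2 * m) n (H_entry m a) (\<lambda>i j. \<mu> * Delta_entry n \<i> i j)) (grid n (2 * m)) W"
proof (rule complements_zeroI)
  fix b :: "entries"
  let ?R = "grid n m"
  have ne: "\<mu> - cnj \<mu> * a \<noteq> 0" "\<mu> * cnj a - cnj \<mu> \<noteq> 0"
  proof -
    have "cmod (cnj \<mu> * a) = cmod a" "cmod (\<mu> * cnj a) = cmod a" using \<mu> by (simp_all add: norm_mult)
    then have "\<mu> \<noteq> cnj \<mu> * a" "\<mu> * cnj a \<noteq> cnj \<mu>" using a \<mu> by (metis complex_mod_cnj less_irrefl)+
    then show "\<mu> - cnj \<mu> * a \<noteq> 0" "\<mu> * cnj a - cnj \<mu> \<noteq> 0" by auto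
  qed
  define N1 where "N1 x = (\<lambda>(i, j). \<mu> * (if 0 < i then \<i> * x (i - 1, j) else 0) -
      cnj \<mu> * ((if 0 < j then x (i, j - 1) else 0) +
        (if 0 < i then - \<i> * (a * x (i - 1, j) + (if 0 < j then x (i - 1, j - 1) else 0)) else 0)))"
    for x :: "entries"
  define N2 where "N2 x = (\<lambda>(i, j). \<mu> * ((if j + 1 < m then x (i, j + 1) else 0) +
        (if 0 < i then \<i> * (cnj a * x (i - 1, j) + (if j + 1 < m then x (i - 1, j + 1) else 0)) else 0)) -
      cnj \<mu> * (if 0 < i then - \<i> * x (i - 1, j) else 0))"
    for x :: "entries"
  have "\<exists>x. \<forall>e\<in>?R. (\<mu> - cnj \<mu> * a) * x e + N1 x e = b e"
    by (rule triangular_solve_grid[where \<mu> = "\<lambda>i j. i + j"]) (use ne in \<open>auto simp: N1_def\<close>)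
  then obtain x1 where x1: "\<forall>e\<in>?R. (\<mu> - cnj \<mu> * a) * x1 e + N1 x1 e = b e" by blast
  have "\<exists>x. \<forall>e\<in>?R. (\<mu> * cnj a - cnj \<mu>) * x e + N2 x e = (\<lambda>(i, j). b (i, m + j)) e"
    by (rule triangular_solve_grid[where \<mu> = "\<lambda>i j. i + (m - j)"]) (use ne in \<open>auto simp: N2_def\<close>)
  then obtain x2 where x2: "\<forall>e\<in>?R. (\<mu> * cnj a - cnj \<mu>) * x2 e + N2 x2 e = (\<lambda>(i, j). b (i, m + j)) e" by blast
  \<comment> \<open>Rows are reversed because Delta is antidiagonal up to lower order terms; the
    halves of the columns are exchanged because H is antidiagonal as a 2 x 2 block matrix.\<close>
  define x where "x = (\<lambda>(k, l). if l < m then x2 (n - 1 - k, l) else x1 (n - 1 - k, l - m))"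
  let ?L = "reduced_tangent (2 * m) n (H_entry m a) (\<lambda>i j. \<mu> * Delta_entry n \<i> i j) x"
  have L1: "?L (i, j) = b (i, j)" if ij: "i < n" "j < m" for i j
  proof -
    have j: "j < 2 * m" using ij by simp
    have "?L (i, j) = (\<mu> - cnj \<mu> * a) * x1 (i, j) + N1 x1 (i, j)"
      unfolding reduced_tangent_def prod.case complex_cnj_mult cnj_entry Delta_scaled[OF ij(1)] H_row[OF j] H_col[OF j]
      using ij
      by (cases "0 < i"; cases j)
        (simp_all add: x_def N1_def algebra_simps)
    then show ?thesis using bspec[OF x1, of "(i, j)"] ij by simp
  qed
  have L2: "?L (i, m + j) = b (i, m + j)" if ij: "i < n" "j < m" for i j
  proof -
    have j: "m + j < 2 * m" using ij by simp
    have "?L (i, m + j) = (\<mu> * cnj a - cnj \<mu>) * x2 (i, j) + N2 x2 (i, j)"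
      unfolding reduced_tangent_def prod.case complex_cnj_mult cnj_entry Delta_scaled[OF ij(1)] H_row[OF j] H_col[OF j]
      using ij
      by (cases "0 < i")
        (simp_all add: x_def N2_def algebra_simps)
    then show ?thesis using bspec[OF x2, of "(i, j)"] ij by simp
  qed
  have "?L (i, j) = b (i, j)" if ij: "i < n" "j < 2 * m" for i j
    using L1[of i j] L2[of i "j - m"] ij by (cases "j < m") auto
  then show "\<exists>x. \<forall>e\<in>grid n (2 * m). reduced_tangent (2 * m) n (H_entry m a) (\<lambda>i j. \<mu> * Delta_entry n \<i> i j) x e = b e"
    by (intro exI[of _ x]) auto
qed (use W in auto)

text \<open>In reversed coordinates each Delta acts as the identity plus i times a shift. With s =
  mu' cnj mu, the terms of order zero and two collect the factor s - cnj s, the two single shifts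
  the factor i (s + cnj s).\<close>

lemma reduced_tangent_Delta_Delta:
  assumes "i < n" "j < m"
  shows "reduced_tangent m n (\<lambda>i j. \<mu> * Delta_entry m \<i> i j) (\<lambda>i j. \<mu>' * Delta_entry n \<i> i j)
      (\<lambda>(k, l). p (n - 1 - k, m - 1 - l)) (i, j) =
    (\<mu>' * cnj \<mu> - cnj \<mu>' * \<mu>) * (p (i, j) + (if 0 < i \<and> 0 < j then p (i - 1, j - 1) else 0)) +
    \<i> * (\<mu>' * cnj \<mu> + cnj \<mu>' * \<mu>) * nw_shift p (i, j)"
  unfolding reduced_tangent_def prod.case complex_cnj_mult cnj_entry Delta_scaled[OF assms(1)] Delta_scaled[OF assms(2)]
  using assms by (cases "0 < i"; cases "0 < j") (simp_all add: nw_shift_def algebra_simps)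

text \<open>The number s = mu' cnj mu has modulus 1, so s - cnj s vanishes exactly for s = 1 or s =
  -1, that is, for mu = mu' or mu = -mu'. In that case a nonzero multiple of \<open>nw_shift\<close>
  remains; otherwise the system is triangular with this nonzero diagonal.\<close>

lemma complements_Delta_Delta:
  assumes \<mu>: "cmod \<mu> = 1" "cmod \<mu>' = 1"
    and W0: "\<And>i j. \<lbrakk>\<not> (\<mu> = \<mu>' \<or> \<mu> = - \<mu>'); i < n; j < m\<rbrakk> \<Longrightarrow> W (i, j) = {0}"
    and W1: "\<mu> = \<mu>' \<or> \<mu> = - \<mu>' \<Longrightarrow> nw_pattern n m W"
  shows "complements (reduced_tangent m n (\<lambda>i j. \<mu> * Delta_entry m \<i> i j) (\<lambda>i j. \<mu>' * Delta_entry n \<i> i j))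
    (grid n m) W"
proof -
  let ?L = "reduced_tangent m n (\<lambda>i j. \<mu> * Delta_entry m \<i> i j) (\<lambda>i j. \<mu>' * Delta_entry n \<i> i j)"
  have unit: "\<mu> * cnj \<mu> = 1" "\<mu>' * cnj \<mu>' = 1"
    using \<mu> by (simp_all add: complex_norm_square[symmetric])
  show ?thesis
  proof (cases "\<mu> = \<mu>' \<or> \<mu> = - \<mu>'")
    case True
    define s where "s = \<mu>' * cnj \<mu>"
    have s: "s = 1 \<or> s = -1" using True unit by (auto simp: s_def)
    have cs: "cnj \<mu>' * \<mu> = s" using s by (metis complex_cnj_mult complex_cnj_cnj complex_cnj_one complex_cnj_minus s_def)
    have L: "?L (\<lambda>(k, l). p (n - 1 - k, m - 1 - l)) e = nw_shift (\<lambda>e. 2 * \<i> * s * p e) e"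
      if e: "e \<in> grid n m" for p e
    proof -
      obtain i j where ij: "e = (i, j)" "i < n" "j < m" using e by auto
      show ?thesis unfolding ij(1) reduced_tangent_Delta_Delta[OF ij(2,3)] cs s_def[symmetric]
        by (simp add: nw_shift_def algebra_simps)
    qed
    show ?thesis
    proof (rule complements_same_image[OF nw_shift_pattern[OF W1[OF True]]])
      show "\<exists>y. \<forall>e\<in>grid n m. nw_shift y e = ?L x e" for x
      proof (intro exI ballI)
        fix e assume e: "e \<in> grid n m"
        define p where "p = (\<lambda>(i, j). x (n - 1 - i, m - 1 - j))"
        have "?L x e = ?L (\<lambda>(k, l). p (n - 1 - k, m - 1 - l)) e"
          using e by (auto simp: reduced_tangent_def p_def intro!: arg_cong2[where f = "(-)"] sum.cong)
        then show "nw_shift (\<lambda>e. 2 * \<i> * s * (\<lambda>(i, j). x (n - 1 - i, m - 1 - j)) e) e = ?L x e"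
          using L[OF e, of p] by (simp add: p_def)
      qed
      show "\<exists>x. \<forall>e\<in>grid n m. ?L x e = nw_shift y e" for y
      proof (intro exI ballI)
        fix e assume e: "e \<in> grid n m"
        have "(\<lambda>e. 2 * \<i> * s * (y e / (2 * \<i> * s))) = y" using s by auto
        then show "?L (\<lambda>(k, l). (\<lambda>e. y e / (2 * \<i> * s)) (n - 1 - k, m - 1 - l)) e = nw_shift y e"
          using L[OF e, of "\<lambda>e. y e / (2 * \<i> * s)"] by (simp only:)
      qed
    qed simp
  next
    case False
    define c where "c = \<mu>' * cnj \<mu> - cnj \<mu>' * \<mu>"
    have c: "c \<noteq> 0"
    proof
      assume "c = 0"
      then have "\<mu>' * cnj \<mu> * (\<mu>' * \<mu>) = cnj \<mu>' * \<mu> * (\<mu>' * \<mu>)" by (simp add: c_def)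
      then have "\<mu>' * \<mu>' * (\<mu> * cnj \<mu>) = \<mu> * \<mu> * (\<mu>' * cnj \<mu>')" by (simp only: mult_ac)
      then have "\<mu>' * \<mu>' = \<mu> * \<mu>" by (simp only: unit mult_1_right)
      then show False using False by (metis square_eq_iff)
    qed
    define N where "N p = (\<lambda>(i, j). c * (if 0 < i \<and> 0 < j then p (i - 1, j - 1) else 0) +
      \<i> * (\<mu>' * cnj \<mu> + cnj \<mu>' * \<mu>) * nw_shift p (i, j))" for p :: "entries"
    show ?thesis
    proof (rule complements_zeroI)
      fix b :: "entries"
      have "\<exists>p. \<forall>e\<in>grid n m. c * p e + N p e = b e"
        by (rule triangular_solve_grid[where \<mu> = "\<lambda>i j. i + j"]) (use c in \<open>auto simp: N_def nw_shift_def\<close>)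
      then obtain p where p: "\<forall>e\<in>grid n m. c * p e + N p e = b e" by blast
      have "?L (\<lambda>(k, l). p (n - 1 - k, m - 1 - l)) e = b e" if e: "e \<in> grid n m" for e
      proof -
        obtain i j where ij: "e = (i, j)" "i < n" "j < m" using e by auto
        show ?thesis using bspec[OF p e]
          unfolding ij(1) reduced_tangent_Delta_Delta[OF ij(2,3)] c_def[symmetric] N_def prod.case
          by (simp only: distrib_left add.assoc)
      qed
      then show "\<exists>x. \<forall>e\<in>grid n m. ?L x e = b e" by blast
    qed (use W0 False in auto)
  qed
qed

text \<open>Equation row i reads F (row i + 1) - G (row i - 1), with invertible maps F and G and
  missing rows dropped, so rows of equal parity form a chain. For even n both chains are solvable.
  For odd n the (n + 1) / 2 equation rows with even i contain only the (n - 1) / 2 odd rows of the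
  unknown, and one border equation row must be given up.\<close>

lemma complements_invertible_jordan:
  assumes inv: "inverse_entries m M M'"
    and even: "\<And>i j. \<lbrakk>even n; i < n; j < m\<rbrakk> \<Longrightarrow> W (i, j) = {0}"
    and odd: "odd n \<Longrightarrow> (\<forall>i<n. \<forall>j<m. W (i, j) = (if i = 0 then UNIV else {0})) \<or>
      (\<forall>i<n. \<forall>j<m. W (i, j) = (if i + 1 = n then UNIV else {0}))"
  shows "complements (reduced_tangent m n M (jordan_entry 0)) (grid n m) W"
proof -
  \<comment> \<open>For a row vector v, \<open>F v\<close> is v times the conjugate transpose of M,
    and \<open>G v\<close> is v M. The primed maps are their inverses.\<close>
  define F where "F v j = (\<Sum>l<m. cnj (M j l) * v l)" for v j
  define G where "G v j = (\<Sum>l<m. M l j * v l)" for v j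
  define F' where "F' w j = (\<Sum>l<m. cnj (M' j l) * w l)" for w j
  define G' where "G' w j = (\<Sum>l<m. M' l j * w l)" for w j
  have FF': "F (F' w) j = w j" "F' (F w) j = w j" if "j < m" for w j
  proof -
    have "cnj (F (F' w) j) = (\<Sum>k<m. M j k * (\<Sum>l<m. M' k l * cnj (w l)))"
      by (simp add: F_def F'_def cnj_sum)
    also have "\<dots> = cnj (w j)" by (rule inverse_entries_cancel(1)[OF inv that])
    finally show "F (F' w) j = w j" by (simp only: complex_cnj_cancel_iff)
    have "cnj (F' (F w) j) = (\<Sum>k<m. M' j k * (\<Sum>l<m. M k l * cnj (w l)))"
      by (simp add: F_def F'_def cnj_sum)
    also have "\<dots> = cnj (w j)" by (rule inverse_entries_cancel(2)[OF inv that])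
    finally show "F' (F w) j = w j" by (simp only: complex_cnj_cancel_iff)
  qed
  have GG': "G (G' w) j = w j" "G' (G w) j = w j" if "j < m" for w j
    unfolding G_def G'_def by (rule inverse_entries_cancel(3,4)[OF inv that])+
  have F_cong: "F v j = F w j" "F' v j = F' w j" "G v j = G w j" "G' v j = G' w j"
    if "\<And>l. l < m \<Longrightarrow> v l = w l" for v w j
    using that by (simp_all add: F_def G_def F'_def G'_def)
  have zero: "F (\<lambda>_. 0) j = 0" "G (\<lambda>_. 0) j = 0" "F' (\<lambda>_. 0) j = 0" "G' (\<lambda>_. 0) j = 0" for j
    by (simp_all add: F_def G_def F'_def G'_def)
  let ?L = "reduced_tangent m n M (jordan_entry 0)"
  have L: "?L q (i, j) = (if i + 1 < n then F (\<lambda>l. q (i + 1, l)) j else 0) -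
      (if 0 < i then G (\<lambda>l. q (i - 1, l)) j else 0)" if "i < n" for q i j
    using that by (simp add: reduced_tangent_def cnj_entry jordan_row jordan_col F_def G_def)
  \<comment> \<open>\<open>P k\<close> decides how row k is found: by \<open>F'\<close> from row k -
    2 through equation k - 1, or by \<open>G'\<close> from row k + 2 through equation k + 1. Period
    2 keeps the decision constant along each chain. The uses are \<open>odd\<close> for even n, and
    constant False or True when the first or the last equation row is given up.\<close>
  have solve: "\<exists>q. \<forall>i<n. \<forall>j<m. (if P (i + 1) then i + 1 < n else 0 < i) \<longrightarrow> ?L q (i, j) = b (i, j)"
    if P: "\<And>k. P (Suc (Suc k)) = P k" for b P
  proof -
    have "\<exists>f. \<forall>k. f k = (if k = 0 then (\<lambda>_. 0) else
        F' (\<lambda>j. b (k - 1, j) + (if 1 < k then G (f (k - 2)) j else 0)))"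
    proof (rule recursive_fun_exists[where \<mu> = "\<lambda>k. k"])
      fix k and f g :: "nat \<Rightarrow> nat \<Rightarrow> complex" assume fg: "\<And>k'. k' < k \<Longrightarrow> f k' = g k'"
      have "f (k - 2) = g (k - 2)" if "1 < k" using that by (intro fg) simp
      then show "(if k = 0 then (\<lambda>_. 0) else F' (\<lambda>j. b (k - 1, j) + (if 1 < k then G (f (k - 2)) j else 0))) =
          (if k = 0 then (\<lambda>_. 0) else F' (\<lambda>j. b (k - 1, j) + (if 1 < k then G (g (k - 2)) j else 0)))"
        by (cases "1 < k") simp_all
    qed
    then obtain f where f: "\<And>k. f k = (if k = 0 then (\<lambda>_. 0) else
        F' (\<lambda>j. b (k - 1, j) + (if 1 < k then G (f (k - 2)) j else 0)))" by blast
    have "\<exists>g. \<forall>k. g k = G' (\<lambda>j. (if k + 2 < n then F (g (k + 2)) j else 0) - b (k + 1, j))"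
    proof (rule recursive_fun_exists[where \<mu> = "\<lambda>k. n - k"])
      fix k and f g :: "nat \<Rightarrow> nat \<Rightarrow> complex" assume fg: "\<And>k'. n - k' < n - k \<Longrightarrow> f k' = g k'"
      have "f (k + 2) = g (k + 2)" if "k + 2 < n" using that by (intro fg) simp
      then show "G' (\<lambda>j. (if k + 2 < n then F (f (k + 2)) j else 0) - b (k + 1, j)) =
          G' (\<lambda>j. (if k + 2 < n then F (g (k + 2)) j else 0) - b (k + 1, j))"
        by (cases "k + 2 < n") simp_all
    qed
    then obtain g where g: "\<And>k. g k = G' (\<lambda>j. (if k + 2 < n then F (g (k + 2)) j else 0) - b (k + 1, j))"
      by blast
    define q where "q = (\<lambda>(k, l). if P k then f k l else g k l)"
    have "?L q (i, j) = b (i, j)"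
      if i: "i < n" and j: "j < m" and Pi: "if P (i + 1) then i + 1 < n else 0 < i" for i j
    proof (cases "P (i + 1)")
      case True
      have "f (i + 1) = F' (\<lambda>j. b (i, j) + (if 0 < i then G (f (i - 1)) j else 0))"
        by (subst f) (cases i; simp)
      then have "F (\<lambda>l. q (i + 1, l)) j = F (F' (\<lambda>j. b (i, j) + (if 0 < i then G (f (i - 1)) j else 0))) j"
        using True by (simp add: q_def)
      also have "\<dots> = b (i, j) + (if 0 < i then G (f (i - 1)) j else 0)" by (rule FF'(1)[OF j])
      finally have 1: "F (\<lambda>l. q (i + 1, l)) j = b (i, j) + (if 0 < i then G (f (i - 1)) j else 0)" .
      have 2: "(\<lambda>l. q (i - 1, l)) = f (i - 1)" if "0 < i"
        using True that P by (cases i) (auto simp: q_def)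
      show ?thesis using L[OF i, of q j] 1 2 Pi True by simp
    next
      case False
      then have i0: "0 < i" using Pi by simp
      then have nP: "\<not> P (i - 1)" using False P by (cases i) auto
      have "g (i - 1) = G' (\<lambda>j. (if i + 1 < n then F (g (i + 1)) j else 0) - b (i, j))"
      proof -
        have "i - 1 + 2 = i + 1" "i - 1 + 1 = i" using i0 by auto
        then show ?thesis using g[of "i - 1"] by (simp only:)
      qed
      then have "G (\<lambda>l. q (i - 1, l)) j = G (G' (\<lambda>j. (if i + 1 < n then F (g (i + 1)) j else 0) - b (i, j))) j"
        using nP by (simp add: q_def)
      also have "\<dots> = (if i + 1 < n then F (g (i + 1)) j else 0) - b (i, j)" by (rule GG'(1)[OF j])
      finally have 1: "G (\<lambda>l. q (i - 1, l)) j = (if i + 1 < n then F (g (i + 1)) j else 0) - b (i, j)" .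
      have 2: "(\<lambda>l. q (i + 1, l)) = g (i + 1)" using False by (auto simp: q_def)
      show ?thesis using L[OF i, of q j] 1 2 i0 by simp
    qed
    then show ?thesis by (intro exI[of _ q]) blast
  qed
  show ?thesis
  proof (cases "even n")
    case True
    show ?thesis
    proof (rule complements_zeroI)
      fix b
      obtain q where q: "\<forall>i<n. \<forall>j<m. (if odd (i + 1) then i + 1 < n else 0 < i) \<longrightarrow> ?L q (i, j) = b (i, j)"
        using solve[of odd b] by auto
      have "if odd (i + 1) then i + 1 < n else 0 < i" if "i < n" for i
        using that True by (cases "even i") (auto simp: odd_pos intro!: Suc_lessI)
      then have "?L q (i, j) = b (i, j)" if "i < n" "j < m" for i j using q that by blast
      then show "\<exists>x. \<forall>e\<in>grid n m. ?L x e = b e" by (intro exI[of _ q]) auto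
    qed (use even True in auto)
  next
    case n: False
    show ?thesis
      using odd[OF n]
    proof
      assume W: "\<forall>i<n. \<forall>j<m. W (i, j) = (if i = 0 then UNIV else {0})"
      show ?thesis
      proof (rule complementsI)
        fix b
        obtain q where "\<forall>i<n. \<forall>j<m. 0 < i \<longrightarrow> ?L q (i, j) = b (i, j)"
          using solve[of "\<lambda>_. False" b] by auto
        then show "\<exists>x. \<forall>e\<in>grid n m. b e - ?L x e \<in> W e" using W by (intro exI[of _ q]) auto
      next
        fix q and e :: "nat \<times> nat"
        assume LW: "\<forall>e\<in>grid n m. ?L q e \<in> W e" and e: "e \<in> grid n m"
        have L0: "?L q (i, j) = 0" if "i < n" "j < m" "i \<noteq> 0" for i j
          using bspec[OF LW, of "(i, j)"] W that by simp
        \<comment> \<open>The exempted equation 0 contains only row 1, so the odd rows are what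
          matters. They vanish from the bottom upwards: equation n - 1 has no F term and forces row
          n - 2 to be zero.\<close>
        have rows: "\<forall>l<m. q (i, l) = 0" if "Suc i < n" "odd i" for i
          using that
        proof (induction "n - i" arbitrary: i rule: less_induct)
          case less
          have "G (\<lambda>l. q (i, l)) j = 0" if j: "j < m" for j
          proof (cases "i + 2 < n")
            case True
            have "Suc (i + 2) < n" using True less.prems n by (metis Suc_lessI even_Suc even_add odd_one add_2_eq_Suc')
            then have "\<forall>l<m. q (i + 2, l) = 0" using less.prems by (intro less.hyps) auto
            then have "F (\<lambda>l. q (i + 2, l)) j = F (\<lambda>_. 0) j" by (intro F_cong) simp
            then show ?thesis using L0[of "i + 1" j] L[of "i + 1" q j] j True zero by simp
          next
            case False
            then show ?thesis using L0[of "i + 1" j] L[of "i + 1" q j] j less.prems by simp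
          qed
          then have "G' (G (\<lambda>l. q (i, l))) l = G' (\<lambda>_. 0) l" for l by (intro F_cong) simp
          then show ?case using GG'(2) zero by (metis (no_types, lifting))
        qed
        obtain i j where ij: "e = (i, j)" "i < n" "j < m" using e by auto
        show "?L q e = 0"
        proof (cases "i = 0")
          case True
          have "F (\<lambda>l. q (1, l)) j = 0" if "1 < n"
          proof -
            have "Suc 1 < n" using that n by (metis Suc_lessI even_Suc odd_one)
            then have "F (\<lambda>l. q (1, l)) j = F (\<lambda>_. 0) j" using rows[of 1] by (intro F_cong) simp
            then show ?thesis by (simp add: zero)
          qed
          then show ?thesis using L[of 0 q j] ij True by simp
        qed (use L0 ij in simp)
      qed
    next
      assume W: "\<forall>i<n. \<forall>j<m. W (i, j) = (if i + 1 = n then UNIV else {0})"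
      show ?thesis
      proof (rule complementsI)
        fix b
        obtain q where "\<forall>i<n. \<forall>j<m. i + 1 < n \<longrightarrow> ?L q (i, j) = b (i, j)"
          using solve[of "\<lambda>_. True" b] by auto
        then show "\<exists>x. \<forall>e\<in>grid n m. b e - ?L x e \<in> W e" using W by (intro exI[of _ q]) auto
      next
        fix q and e :: "nat \<times> nat"
        assume LW: "\<forall>e\<in>grid n m. ?L q e \<in> W e" and e: "e \<in> grid n m"
        have L0: "?L q (i, j) = 0" if "i < n" "j < m" "i + 1 \<noteq> n" for i j
          using bspec[OF LW, of "(i, j)"] W that by simp
        \<comment> \<open>The mirror image: equation 0 has no G term and forces row 1 to vanish, and
          the odd rows follow downwards.\<close>
        have rows: "\<forall>l<m. q (i, l) = 0" if "i < n" "odd i" for i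
          using that
        proof (induction i rule: less_induct)
          case (less i)
          then obtain k where k: "i = k + 1" by (cases i) auto
          have "F (\<lambda>l. q (i, l)) j = 0" if j: "j < m" for j
          proof (cases "0 < k")
            case True
            then have "\<forall>l<m. q (k - 1, l) = 0" using less.prems k by (intro less.IH) auto
            then have "G (\<lambda>l. q (k - 1, l)) j = G (\<lambda>_. 0) j" by (intro F_cong) simp
            then show ?thesis using L0[of k j] L[of k q j] j True zero less.prems k by simp
          next
            case False
            then show ?thesis using L0[of k j] L[of k q j] j less.prems k by simp
          qed
          then have "F' (F (\<lambda>l. q (i, l))) l = F' (\<lambda>_. 0) l" for l by (intro F_cong) simp
          then show ?case using FF'(2) zero by (metis (no_types, lifting))
        qed
        obtain i j where ij: "e = (i, j)" "i < n" "j < m" using e by auto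
        show "?L q e = 0"
        proof (cases "i + 1 = n")
          case True
          have "G (\<lambda>l. q (i - 1, l)) j = 0" if "0 < i"
          proof -
            have "odd (i - 1)" using True n that by (cases i) auto
            then have "G (\<lambda>l. q (i - 1, l)) j = G (\<lambda>_. 0) j" using rows[of "i - 1"] ij by (intro F_cong) simp
            then show ?thesis by (simp add: zero)
          qed
          then show ?thesis using L[of i q j] ij True by simp
        qed (use L0 ij in simp)
      qed
    qed
  qed
qed

section \<open>Diagonal blocks\<close>

lemma tangent_H:
  fixes x :: "unit \<times> nat \<times> nat \<Rightarrow> complex" and a :: complex and m :: nat
  defines "L \<equiv> tangent id (\<lambda>_. 2 * m) (\<lambda>_. H_entry m a) x"
  assumes "i < m" "j < m"
  shows "L ((), i, j) = a * cnj (x ((), m + j, i)) + (if 0 < j then cnj (x ((), m + j - 1, i)) else 0) + x ((), m + i, j)"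
    and "L ((), i, m + j) = cnj (x ((), j, i)) + x ((), m + i, m + j)"
    and "L ((), m + i, j) = a * cnj (x ((), m + j, m + i)) + (if 0 < j then cnj (x ((), m + j - 1, m + i)) else 0) +
      (a * x ((), i, j) + (if i + 1 < m then x ((), i + 1, j) else 0))"
    and "L ((), m + i, m + j) = cnj (x ((), j, m + i)) +
      (a * x ((), i, m + j) + (if i + 1 < m then x ((), i + 1, m + j) else 0))"
  unfolding L_def tangent_def using assms(2,3)
  by (simp_all add: H_row H_col)

text \<open>The two equations for the positions \<open>(i, j)\<close> and \<open>(j, i)\<close> form a regular system because
  \<open>cmod a \<noteq> 1\<close>.\<close>

lemma adjoint_plus_jordan_solve:
  fixes b :: "entries"
  assumes a: "1 < cmod a"
  shows "\<exists>y. \<forall>i j. y (i, j) + (a * cnj (y (j, i)) + (if 0 < j then cnj (y (j - 1, i)) else 0)) = b (i, j)"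
    and "\<exists>y. \<forall>i<m. \<forall>j<m. cnj (y (j, i)) + (a * y (i, j) + (if i + 1 < m then y (i + 1, j) else 0)) = b (i, j)"
proof -
  \<comment> \<open>The determinant of the system for \<open>y (i, j)\<close> and
    \<open>cnj (y (j, i))\<close>. It is real, so one value serves both orders of the indices, and
    \<open>F\<close> below is Cramer's rule.\<close>
  define d where "d = 1 - a * cnj a"
  have d: "d \<noteq> 0" "cnj d = d"
  proof -
    have "a * cnj a = of_real ((cmod a)\<^sup>2)" using complex_norm_square[of a] by simp
    moreover have "(cmod a)\<^sup>2 \<noteq> 1" using a by (metis norm_ge_zero one_less_power less_irrefl pos2)
    ultimately show "d \<noteq> 0" unfolding d_def by (metis eq_iff_diff_eq_0 of_real_eq_1_iff)
    show "cnj d = d" by (simp add: d_def mult.commute)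
  qed
  define F where "F y = (\<lambda>(i :: nat, j :: nat). ((b (i, j) - (if 0 < j then cnj (y (j - 1, i)) else 0)) -
      a * cnj (b (j, i) - (if 0 < i then cnj (y (i - 1, j)) else 0))) / d)" for y :: "entries"
  have "\<exists>y. \<forall>e. y e = F y e"
  proof (rule recursive_fun_exists[where \<mu> = "\<lambda>(i, j). i + j"])
    fix e :: "nat \<times> nat" and f g :: "entries"
    assume fg: "\<And>e'. (case e' of (i, j) \<Rightarrow> i + j) < (case e of (i, j) \<Rightarrow> i + j) \<Longrightarrow> f e' = g e'"
    obtain i j where e: "e = (i, j)" by (cases e)
    show "F f e = F g e" using fg[of "(j - 1, i)"] fg[of "(i - 1, j)"] by (auto simp: F_def e)
  qed
  then obtain y where y: "\<And>e. y e = F y e" by blast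
  have "y (i, j) + (a * cnj (y (j, i)) + (if 0 < j then cnj (y (j - 1, i)) else 0)) = b (i, j)" for i j
  proof -
    define p where "p = b (i, j) - (if 0 < j then cnj (y (j - 1, i)) else 0)"
    define q where "q = b (j, i) - (if 0 < i then cnj (y (i - 1, j)) else 0)"
    have "y (i, j) = (p - a * cnj q) / d" "y (j, i) = (q - a * cnj p) / d"
      using y[of "(i, j)"] y[of "(j, i)"] by (simp_all add: F_def p_def q_def)
    then have "y (i, j) + a * cnj (y (j, i)) = (p - a * cnj q) / d + a * (cnj q - cnj a * p) / d"
      by (simp add: d(2))
    also have "\<dots> = p * d / d" unfolding add_divide_distrib[symmetric]
      by (simp add: d_def algebra_simps)
    also have "\<dots> = p" using d by simp
    finally show ?thesis by (simp add: p_def algebra_simps)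
  qed
  then show "\<exists>y. \<forall>i j. y (i, j) + (a * cnj (y (j, i)) + (if 0 < j then cnj (y (j - 1, i)) else 0)) = b (i, j)"
    by blast
  \<comment> \<open>Here the shifted term lies in row i + 1, so the recursion starts at the lower
    right corner.\<close>
  define F' where "F' y = (\<lambda>(i :: nat, j :: nat). (cnj (b (j, i) - (if j + 1 < m then y (j + 1, i) else 0)) -
      cnj a * (b (i, j) - (if i + 1 < m then y (i + 1, j) else 0))) / d)" for y :: "entries"
  have "\<exists>y. \<forall>e. y e = F' y e"
  proof (rule recursive_fun_exists[where \<mu> = "\<lambda>(i, j). (m - i) + (m - j)"])
    fix e :: "nat \<times> nat" and f g :: "entries"
    assume fg: "\<And>e'. (case e' of (i, j) \<Rightarrow> (m - i) + (m - j)) < (case e of (i, j) \<Rightarrow> (m - i) + (m - j)) \<Longrightarrow> f e' = g e'"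
    obtain i j where e: "e = (i, j)" by (cases e)
    show "F' f e = F' g e" using fg[of "(j + 1, i)"] fg[of "(i + 1, j)"] by (auto simp: F'_def e)
  qed
  then obtain y where y: "\<And>e. y e = F' y e" by blast
  have "cnj (y (j, i)) + (a * y (i, j) + (if i + 1 < m then y (i + 1, j) else 0)) = b (i, j)" for i j
  proof -
    define p where "p = b (i, j) - (if i + 1 < m then y (i + 1, j) else 0)"
    define q where "q = b (j, i) - (if j + 1 < m then y (j + 1, i) else 0)"
    have "y (i, j) = (cnj q - cnj a * p) / d" "y (j, i) = (cnj p - cnj a * q) / d"
      using y[of "(i, j)"] y[of "(j, i)"] by (simp_all add: F'_def p_def q_def)
    then have "cnj (y (j, i)) + a * y (i, j) = (p - a * cnj q) / d + a * (cnj q - cnj a * p) / d"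
      by (simp add: d(2))
    also have "\<dots> = p * d / d" unfolding add_divide_distrib[symmetric]
      by (simp add: d_def algebra_simps)
    also have "\<dots> = p" using d by simp
    finally show ?thesis by (simp add: p_def algebra_simps)
  qed
  then show "\<exists>y. \<forall>i<m. \<forall>j<m. cnj (y (j, i)) + (a * y (i, j) + (if i + 1 < m then y (i + 1, j) else 0)) = b (i, j)"
    by blast
qed

text \<open>In 2 x 2 block form the four components are x21^H J + x21, x11^H + x22, x22^H J + J x11
  and x12^H + J x12. The first and last are solved by \<open>adjoint_plus_jordan_solve\<close>. The
  second determines x22 = b12 - x11^H, after which the third becomes J x11 - x11 J up to known
  terms: the eigenvalue cancels and \<open>sw_shift\<close> remains.\<close>

lemma complements_diag_H:
  assumes a: "1 < cmod a"
    and W0: "\<And>i j. \<lbrakk>i < m; j < m\<rbrakk> \<Longrightarrow> W ((), i, j) = {0} \<and> W ((), i, m + j) = {0} \<and> W ((), m + i, m + j) = {0}"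
    and W: "sw_pattern m m (\<lambda>(i, j). W ((), m + i, j))"
  shows "complements (tangent id (\<lambda>_. 2 * m) (\<lambda>_. H_entry m a)) (positions id (\<lambda>_. 2 * m)) W"
proof (rule complementsI)
  have quadrant: "(\<exists>i j. i < m \<and> j < m \<and> e = ((), i, j)) \<or> (\<exists>i j. i < m \<and> j < m \<and> e = ((), i, m + j)) \<or>
      (\<exists>i j. i < m \<and> j < m \<and> e = ((), m + i, j)) \<or> (\<exists>i j. i < m \<and> j < m \<and> e = ((), m + i, m + j))"
    if e: "e \<in> positions id (\<lambda>_. 2 * m)" for e
  proof -
    obtain i j where ij: "e = ((), i, j)" "i < 2 * m" "j < 2 * m" using e by (auto simp: positions_def)
    have "i < m \<or> (\<exists>k<m. i = m + k)" "j < m \<or> (\<exists>k<m. j = m + k)"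
      using ij by (metis add_diff_inverse_nat mult_2 nat_add_left_cancel_less)+
    then show ?thesis using ij(1) by blast
  qed
  note compl = sw_shift_pattern[OF W]
  {
    fix b :: "unit \<times> nat \<times> nat \<Rightarrow> complex"
    obtain y21 where y21: "\<And>i j. y21 (i, j) + (a * cnj (y21 (j, i)) + (if 0 < j then cnj (y21 (j - 1, i)) else 0)) = b ((), i, j)"
      using adjoint_plus_jordan_solve(1)[OF a, of "\<lambda>(i, j). b ((), i, j)"] by auto
    obtain y12 where y12: "\<And>i j. \<lbrakk>i < m; j < m\<rbrakk> \<Longrightarrow>
        cnj (y12 (j, i)) + (a * y12 (i, j) + (if i + 1 < m then y12 (i + 1, j) else 0)) = b ((), m + i, m + j)"
      using adjoint_plus_jordan_solve(2)[OF a, of m "\<lambda>(i, j). b ((), m + i, m + j)"] by auto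
    obtain z where z: "\<forall>e\<in>grid m m. (case e of (i, j) \<Rightarrow> b ((), m + i, j) -
        (a * cnj (b ((), j, m + i)) + (if 0 < j then cnj (b ((), j - 1, m + i)) else 0))) - sw_shift m z e
        \<in> (case e of (i, j) \<Rightarrow> W ((), m + i, j))"
      using complements_solve[OF compl] by blast
    define x where "x = (\<lambda>(u :: unit, i, j). if i < m then (if j < m then z (i, j) else y12 (i, j - m))
        else if j < m then y21 (i - m, j) else b ((), i - m, j) - cnj (z (j - m, i - m)))"
    have "b e - tangent id (\<lambda>_. 2 * m) (\<lambda>_. H_entry m a) x e \<in> W e" if "e \<in> positions id (\<lambda>_. 2 * m)" for e
      using quadrant[OF that]
    proof (elim disjE exE conjE)
      fix i j assume ij: "i < m" "j < m" and e: "e = ((), i, j)"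
      have "tangent id (\<lambda>_. 2 * m) (\<lambda>_. H_entry m a) x e = b e"
        unfolding e tangent_H(1)[OF ij] using ij y21[of i j] by (auto simp: x_def algebra_simps)
      then show ?thesis using W0 ij e by simp
    next
      fix i j assume ij: "i < m" "j < m" and e: "e = ((), i, m + j)"
      have "tangent id (\<lambda>_. 2 * m) (\<lambda>_. H_entry m a) x e = b e"
        unfolding e tangent_H(2)[OF ij] using ij by (simp add: x_def)
      then show ?thesis using W0 ij e by simp
    next
      fix i j assume ij: "i < m" "j < m" and e: "e = ((), m + i, j)"
      have "tangent id (\<lambda>_. 2 * m) (\<lambda>_. H_entry m a) x e =
          (a * cnj (b ((), j, m + i)) + (if 0 < j then cnj (b ((), j - 1, m + i)) else 0)) + sw_shift m z (i, j)"
      proof -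
        have "cnj (x ((), m + j, m + i)) = cnj (b ((), j, m + i)) - z (i, j)" using ij by (simp add: x_def)
        moreover have "cnj (x ((), m + j - 1, m + i)) = cnj (b ((), j - 1, m + i)) - z (i, j - 1)" if "0 < j"
        proof -
          have "m + j - 1 = m + (j - 1)" "\<not> m + (j - 1) < m" using that by auto
          then show ?thesis using ij that by (simp add: x_def del: One_nat_def)
        qed
        moreover have "x ((), i, j) = z (i, j)" "i + 1 < m \<Longrightarrow> x ((), i + 1, j) = z (i + 1, j)"
          using ij by (simp_all add: x_def)
        ultimately show ?thesis
          unfolding e tangent_H(3)[OF ij] sw_shift_def
          by (cases "j = 0"; cases "i + 1 < m") (simp_all add: right_diff_distrib)
      qed
      moreover have "b e - (a * cnj (b ((), j, m + i)) + (if 0 < j then cnj (b ((), j - 1, m + i)) else 0)) -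
          sw_shift m z (i, j) \<in> W e"
        using bspec[OF z, of "(i, j)"] ij by (simp add: e)
      ultimately show ?thesis by (simp only: diff_diff_eq)
    next
      fix i j assume ij: "i < m" "j < m" and e: "e = ((), m + i, m + j)"
      have "tangent id (\<lambda>_. 2 * m) (\<lambda>_. H_entry m a) x e = b e"
        unfolding e tangent_H(4)[OF ij] using ij y12[of i j] by (cases "i + 1 < m") (simp_all add: x_def)
      then show ?thesis using W0 ij e by simp
    qed
    then show "\<exists>x. \<forall>e\<in>positions id (\<lambda>_. 2 * m). b e - tangent id (\<lambda>_. 2 * m) (\<lambda>_. H_entry m a) x e \<in> W e"
      by blast
  }
  fix x and e :: "unit \<times> nat \<times> nat"
  assume L: "\<forall>e\<in>positions id (\<lambda>_. 2 * m). tangent id (\<lambda>_. 2 * m) (\<lambda>_. H_entry m a) x e \<in> W e"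
    and e: "e \<in> positions id (\<lambda>_. 2 * m)"
  let ?L = "tangent id (\<lambda>_. 2 * m) (\<lambda>_. H_entry m a) x"
  have LW: "?L ((), i, j) \<in> W ((), i, j)" if "i < 2 * m" "j < 2 * m" for i j
    using L that by (simp add: positions_def)
  have L0: "?L ((), i, j) = 0" "?L ((), i, m + j) = 0" "?L ((), m + i, m + j) = 0" if "i < m" "j < m" for i j
    using LW[of i j] LW[of i "m + j"] LW[of "m + i" "m + j"] W0[OF that] that by auto
  define z where "z = (\<lambda>(i, j). x ((), i, j))"
  have x22: "cnj (x ((), m + j, m + i)) = - z (i, j)" if "i < m" "j < m" for i j
  proof -
    have "cnj (x ((), i, j)) + x ((), m + j, m + i) = 0"
      using L0(2)[OF that(2,1)] unfolding tangent_H(2)[OF that(2,1)] .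
    then have "cnj (cnj (x ((), i, j)) + x ((), m + j, m + i)) = 0" by simp
    then show ?thesis by (simp add: z_def add_eq_0_iff2 add.commute)
  qed
  have L21: "?L ((), m + i, j) = sw_shift m z (i, j)" if ij: "i < m" "j < m" for i j
    unfolding tangent_H(3)[OF ij] using x22[OF ij] x22[of i "j - 1"] ij
    by (auto simp: sw_shift_def z_def)
  have "sw_shift m z p \<in> (case p of (i, j) \<Rightarrow> W ((), m + i, j))" if p: "p \<in> grid m m" for p
  proof -
    obtain i j where ij: "p = (i, j)" "i < m" "j < m" using p by auto
    have "?L ((), m + i, j) \<in> W ((), m + i, j)" using ij by (intro LW) auto
    then show ?thesis using L21 ij by simp
  qed
  then have "sw_shift m z (i, j) = 0" if "i < m" "j < m" for i j
    using complements_trivial[OF compl, of z "(i, j)"] that by blast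
  then show "?L e = 0" using quadrant[OF e] L0 L21 by auto
qed

text \<open>These functionals annihilate the range of \<open>nw_shift\<close>, because both of its
  terms contribute the sum over the preceding antidiagonal.\<close>

definition antidiag_sum :: "nat \<Rightarrow> entries \<Rightarrow> complex" where
  "antidiag_sum s h = (\<Sum>i\<le>s. h (i, s - i))"

lemma antidiag_sum_cong:
  "(\<And>i j. i + j = s \<Longrightarrow> g (i, j) = h (i, j)) \<Longrightarrow> antidiag_sum s g = antidiag_sum s h"
  unfolding antidiag_sum_def by (intro sum.cong) auto

lemma antidiag_sum_nw_shift: "antidiag_sum s (nw_shift x) = 0"
proof (cases s)
  case (Suc s')
  have "(\<Sum>i\<le>s. if 0 < i then x (i - 1, s - i) else 0) = (\<Sum>i\<le>s'. x (i, s' - i))"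
    unfolding Suc by (subst sum.atMost_Suc_shift) simp
  moreover have "(\<Sum>i\<le>s. if 0 < s - i then x (i, s - i - 1) else 0) = (\<Sum>i\<le>s'. x (i, s' - i))"
    unfolding Suc by (auto intro!: sum.cong simp: Suc_diff_le)
  ultimately show ?thesis by (simp add: antidiag_sum_def nw_shift_def sum_subtractf)
qed (simp add: antidiag_sum_def nw_shift_def)

text \<open>The antidiagonal i + j = s meets the main diagonal only for even s and its two
  neighbours only for odd s. This is what later separates the imaginary from the real parts of the
  diagonal corrections.\<close>

lemma antidiag_sum_diag:
  "antidiag_sum (2 * k) (\<lambda>(i, j). if i = j then f i else 0) = f k"
  "antidiag_sum (Suc (2 * k)) (\<lambda>(i, j). if i = j then f i else 0) = 0"
proof -
  have "antidiag_sum (2 * k) (\<lambda>(i, j). if i = j then f i else 0) = (\<Sum>i\<le>2 * k. if i = k then f i else 0)"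
    unfolding antidiag_sum_def by (intro sum.cong) auto
  then show "antidiag_sum (2 * k) (\<lambda>(i, j). if i = j then f i else 0) = f k" by simp
  show "antidiag_sum (Suc (2 * k)) (\<lambda>(i, j). if i = j then f i else 0) = 0"
    unfolding antidiag_sum_def by (intro sum.neutral ballI) (simp, presburger)
qed

lemma antidiag_sum_subdiag:
  "antidiag_sum (Suc (2 * k)) (\<lambda>(i, j). if j = i + 1 then f i else 0) = f k"
  "antidiag_sum (2 * k) (\<lambda>(i, j). if j = i + 1 then f i else 0) = 0"
  "antidiag_sum (Suc (2 * k)) (\<lambda>(i, j). if i = j + 1 then f j else 0) = f k"
  "antidiag_sum (2 * k) (\<lambda>(i, j). if i = j + 1 then f j else 0) = 0"
proof -
  have "antidiag_sum (Suc (2 * k)) (\<lambda>(i, j). if j = i + 1 then f i else 0) =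
      (\<Sum>i\<le>Suc (2 * k). if i = k then f i else 0)"
    unfolding antidiag_sum_def by (intro sum.cong) auto
  then show "antidiag_sum (Suc (2 * k)) (\<lambda>(i, j). if j = i + 1 then f i else 0) = f k" by simp
  show "antidiag_sum (2 * k) (\<lambda>(i, j). if j = i + 1 then f i else 0) = 0"
    unfolding antidiag_sum_def by (intro sum.neutral ballI) (simp, presburger)
  have "antidiag_sum (Suc (2 * k)) (\<lambda>(i, j). if i = j + 1 then f j else 0) =
      (\<Sum>i\<le>Suc (2 * k). if i = Suc k then f k else 0)"
    unfolding antidiag_sum_def by (intro sum.cong) auto
  then show "antidiag_sum (Suc (2 * k)) (\<lambda>(i, j). if i = j + 1 then f j else 0) = f k" by simp
  show "antidiag_sum (2 * k) (\<lambda>(i, j). if i = j + 1 then f j else 0) = 0"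
    unfolding antidiag_sum_def by (intro sum.neutral ballI) (simp, presburger)
qed

text \<open>Off the first column the shift can be solved freely. The antidiagonal s < n contains
  exactly one entry of the first column, \<open>(s, 0)\<close>, whose equation then holds because
  both antidiagonal sums are 0.\<close>

lemma nw_shift_solve_antidiag:
  assumes "\<And>s. s < n \<Longrightarrow> antidiag_sum s h = 0"
  shows "\<exists>x. \<forall>i<n. \<forall>j<n. nw_shift x (i, j) = h (i, j)"
proof -
  obtain x where x: "\<And>i j. \<lbrakk>0 < j; j < n\<rbrakk> \<Longrightarrow> nw_shift x (i, j) = h (i, j)"
    using nw_shift_solve by blast
  have "nw_shift x (s, 0) = h (s, 0)" if "s < n" for s
  proof -
    have "(\<Sum>i<s. nw_shift x (i, s - i)) = (\<Sum>i<s. h (i, s - i))"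
      using x that by (intro sum.cong) auto
    then have "(\<Sum>i<s. h (i, s - i)) + nw_shift x (s, 0) = 0"
      using antidiag_sum_nw_shift[of s x] by (simp add: antidiag_sum_def lessThan_Suc_atMost[symmetric])
    moreover have "(\<Sum>i<s. h (i, s - i)) + h (s, 0) = 0"
      using assms[OF that] by (simp add: antidiag_sum_def lessThan_Suc_atMost[symmetric])
    ultimately show ?thesis by (metis add_left_imp_eq)
  qed
  then have "nw_shift x (i, j) = h (i, j)" if "i < n" "j < n" for i j
    using x that by (cases "j = 0") auto
  then show ?thesis by blast
qed

lemma tangent_Delta:
  assumes "i < n" "j < n"
  shows "tangent id (\<lambda>_. n) (\<lambda>_ i j. \<mu> * Delta_entry n \<i> i j) x ((), i, j) =
    \<mu> * (x ((), n - 1 - i, j) + cnj (x ((), n - 1 - j, i)) +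
      \<i> * ((if 0 < i then x ((), n - i, j) else 0) + (if 0 < j then cnj (x ((), n - j, i)) else 0)))"
  using assms by (simp add: tangent_def mult.assoc sum_distrib_left[symmetric] Delta_row Delta_col algebra_simps)

text \<open>Split \<open>B / \<mu>\<close> into Hermitian and skew-Hermitian parts. With \<open>Y i j = X (n - 1 - i) j\<close> the
  Hermitian part fixes \<open>Y + Y\<^sup>*\<close>, and the rest is a shift of the skew-Hermitian part of \<open>Y\<close>, whose
  cokernel is detected by the sums over the first \<open>n\<close> antidiagonals.\<close>

lemma complements_diag_Delta:
  assumes \<mu>: "cmod \<mu> = 1" and w: "Im (w / \<mu>) \<noteq> 0"
    and W: "\<And>i j. \<lbrakk>i < n; j < n\<rbrakk> \<Longrightarrow> W ((), i, j) = (if i = j then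
      (if 2 * i + 1 < n then UNIV else if 2 * i + 1 = n then range (\<lambda>t. of_real t * w) else {0}) else {0})"
  shows "complements (tangent id (\<lambda>_. n) (\<lambda>_ i j. \<mu> * Delta_entry n \<i> i j)) (positions id (\<lambda>_. n)) W"
proof (rule complementsI)
  let ?L = "tangent id (\<lambda>_. n) (\<lambda>_ i j. \<mu> * Delta_entry n \<i> i j)"
  have \<mu>0: "\<mu> \<noteq> 0" using \<mu> by auto
  {
    fix b :: "unit \<times> nat \<times> nat \<Rightarrow> complex"
    define \<beta> where "\<beta> = (\<lambda>(i, j). b ((), i, j) / \<mu>)"
    define R where "R = (\<lambda>(i, j). (\<beta> (i, j) + cnj (\<beta> (j, i))) / 2)"
    define I where "I = (\<lambda>(i, j). (\<beta> (i, j) - cnj (\<beta> (j, i))) / (2 * \<i>))"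
    have RI: "R (i, j) + \<i> * I (i, j) = \<beta> (i, j)" for i j
      by (simp add: R_def I_def field_simps)
    have herm: "cnj (R (j, i)) = R (i, j)" "cnj (I (j, i)) = I (i, j)" for i j
      by (simp_all add: R_def I_def field_simps)
    \<comment> \<open>With Y = R / 2 + V and V skew-Hermitian, \<open>K\<close> is what the shift of
      V would have to be if no diagonal correction were made.\<close>
    define K where "K = (\<lambda>(i, j). I (i, j) -
      ((if 0 < i then R (i - 1, j) else 0) + (if 0 < j then R (i, j - 1) else 0)) / 2)"
    have K_herm: "cnj (K (j, i)) = K (i, j)" for i j
      using herm by (auto simp: K_def)
    have K_real: "of_real (Re (antidiag_sum s K)) = antidiag_sum s K" for s
    proof -
      have "cnj (antidiag_sum s K) = (\<Sum>i\<le>s. K (s - i, i))"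
        using K_herm by (simp add: antidiag_sum_def cnj_sum)
      also have "\<dots> = antidiag_sum s K"
        unfolding antidiag_sum_def by (rule sum.reindex_bij_witness[of _ "\<lambda>i. s - i" "\<lambda>i. s - i"]) auto
      finally show ?thesis by (simp add: complex_eq_iff)
    qed
    define t where "t = Re (antidiag_sum (n - 1) K) / Im (w / \<mu>)"
    define q where "q k = (if 2 * k < n then Re (antidiag_sum (2 * k) K) else 0)" for k
    define p where "p k = (if 2 * k + 1 < n then - Re (antidiag_sum (2 * k + 1) K)
      else if 2 * k + 1 = n then Re (of_real t * (w / \<mu>)) else 0)" for k
    define H where "H = (\<lambda>(i, j). K (i, j) - (if i = j then of_real (q i) else 0) +
      ((if j = i + 1 then of_real (p i) / 2 else 0) + (if i = j + 1 then of_real (p j) / 2 else 0)))"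
    have "antidiag_sum s H = 0" if s: "s < n" for s
    proof -
      have "antidiag_sum s H = antidiag_sum s K - antidiag_sum s (\<lambda>(i, j). if i = j then of_real (q i) else 0) +
          (antidiag_sum s (\<lambda>(i, j). if j = i + 1 then of_real (p i) / 2 else 0) +
           antidiag_sum s (\<lambda>(i, j). if i = j + 1 then of_real (p j) / 2 else 0))"
        unfolding antidiag_sum_def H_def by (simp only: sum.distrib sum_subtractf prod.case)
      also have "\<dots> = 0"
      proof (cases "even s")
        case True
        then obtain k where k: "s = 2 * k" by blast
        have "q k = Re (antidiag_sum s K)" using s by (simp add: q_def k)
        then have "of_real (q k) = antidiag_sum s K" by (simp only: K_real)
        then have "antidiag_sum s K - of_real (q k) + (0 + 0) = 0" by simp
        then show ?thesis unfolding k antidiag_sum_diag antidiag_sum_subdiag .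
      next
        case False
        then obtain k where k: "s = Suc (2 * k)" by (auto elim: oddE)
        have "p k = - Re (antidiag_sum s K)" using s by (simp add: p_def k)
        then have "of_real (p k) = - antidiag_sum s K" by (simp only: of_real_minus K_real)
        then have "antidiag_sum s K - 0 + (of_real (p k) / 2 + of_real (p k) / 2) = 0" by simp
        then show ?thesis unfolding k antidiag_sum_diag antidiag_sum_subdiag .
      qed
      finally show ?thesis .
    qed
    then obtain x0 where x0: "\<And>i j. \<lbrakk>i < n; j < n\<rbrakk> \<Longrightarrow> nw_shift x0 (i, j) = H (i, j)"
      using nw_shift_solve_antidiag[of n H] by auto
    \<comment> \<open>\<open>H\<close> is Hermitian, so the skew-Hermitian part of any solution of
      the shift equation is again a solution.\<close>
    define V where "V = (\<lambda>(i, j). (x0 (i, j) - cnj (x0 (j, i))) / 2)"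
    have V_skew: "cnj (V (j, i)) = - V (i, j)" for i j by (simp add: V_def field_simps)
    have V: "nw_shift V (i, j) = H (i, j)" if "i < n" "j < n" for i j
    proof -
      have "cnj (H (j, i)) = H (i, j)" using K_herm by (auto simp: H_def)
      moreover have "nw_shift V (i, j) = (nw_shift x0 (i, j) + cnj (nw_shift x0 (j, i))) / 2"
        by (auto simp: nw_shift_def V_def field_simps)
      ultimately show ?thesis using x0 that by simp
    qed
    define Y where "Y = (\<lambda>(i, j). (R (i, j) - (if i = j then of_real (p i) else 0)) / 2 + V (i, j))"
    have cY: "cnj (Y (j, i)) = (R (i, j) - (if i = j then of_real (p i) else 0)) / 2 - V (i, j)" for i j
      unfolding Y_def prod.case by (cases "i = j") (simp_all add: herm V_skew)
    have Y1: "Y (i, j) + cnj (Y (j, i)) = R (i, j) - (if i = j then of_real (p i) else 0)" for i j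
      unfolding cY by (simp add: Y_def field_simps)
    have Y2: "(if 0 < i then Y (i - 1, j) else 0) + (if 0 < j then cnj (Y (j - 1, i)) else 0) =
        I (i, j) - (if i = j then of_real (q i) else 0)" if ij: "i < n" "j < n" for i j
    proof -
      have "(if 0 < i then Y (i - 1, j) else 0) + (if 0 < j then cnj (Y (j - 1, i)) else 0) =
          nw_shift V (i, j) + ((if 0 < i then R (i - 1, j) else 0) + (if 0 < j then R (i, j - 1) else 0)) / 2 -
          ((if j = i + 1 then of_real (p i) / 2 else 0) + (if i = j + 1 then of_real (p j) / 2 else 0))"
        unfolding cY by (auto simp: Y_def nw_shift_def field_simps)
      also have "\<dots> = I (i, j) - (if i = j then of_real (q i) else 0)"
        unfolding V[OF ij] by (simp add: H_def K_def)
      finally show ?thesis .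
    qed
    define x where "x = (\<lambda>(u :: unit, k, j). Y (n - 1 - k, j))"
    have Lx: "?L x ((), i, j) = b ((), i, j) - (if i = j then \<mu> * (of_real (p i) + \<i> * of_real (q i)) else 0)"
      if ij: "i < n" "j < n" for i j
    proof -
      have "?L x ((), i, j) = \<mu> * (Y (i, j) + cnj (Y (j, i)) +
          \<i> * ((if 0 < i then Y (i - 1, j) else 0) + (if 0 < j then cnj (Y (j - 1, i)) else 0)))"
        unfolding tangent_Delta[OF ij] using ij by (simp add: x_def)
      also have "\<dots> = \<mu> * (R (i, j) + \<i> * I (i, j)) -
          (if i = j then \<mu> * (of_real (p i) + \<i> * of_real (q i)) else 0)"
        unfolding Y1 Y2[OF ij] by (simp add: algebra_simps)
      also have "\<mu> * (R (i, j) + \<i> * I (i, j)) = b ((), i, j)"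
        unfolding RI using \<mu>0 by (simp add: \<beta>_def)
      finally show ?thesis .
    qed
    have mid: "\<mu> * (of_real (p i) + \<i> * of_real (q i)) = of_real t * w" if "2 * i + 1 = n" for i
    proof -
      have "2 * i = n - 1" using that by simp
      then have "q i = t * Im (w / \<mu>)" using that w by (simp add: q_def t_def)
      moreover have "Im (of_real t * z) = t * Im z" for z by simp
      ultimately have "q i = Im (of_real t * (w / \<mu>))" by (simp only:)
      moreover have "p i = Re (of_real t * (w / \<mu>))" using that by (simp add: p_def)
      ultimately have "of_real (p i) + \<i> * of_real (q i) = of_real t * (w / \<mu>)"
        by (simp add: complex_eq_iff)
      then show ?thesis using \<mu>0 by simp
    qed
    have "b ((), i, j) - ?L x ((), i, j) \<in> W ((), i, j)" if "i < n" "j < n" for i j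
      unfolding Lx[OF that] W[OF that] using mid by (auto simp: p_def q_def)
    then show "\<exists>x. \<forall>e\<in>positions id (\<lambda>_. n). b e - ?L x e \<in> W e"
      by (intro exI[of _ x]) (auto simp: positions_def)
  }
  fix x and e :: "unit \<times> nat \<times> nat"
  assume L: "\<forall>e\<in>positions id (\<lambda>_. n). ?L x e \<in> W e" and e: "e \<in> positions id (\<lambda>_. n)"
  have LW: "?L x ((), i, j) \<in> W ((), i, j)" if "i < n" "j < n" for i j
    using L that by (simp add: positions_def)
  define Y where "Y = (\<lambda>(i, j). x ((), n - 1 - i, j))"
  \<comment> \<open>A value of the map that lies in \<open>W\<close> is diagonal. Its entries
    divided by mu are \<open>\<delta>\<close>, split below as R + i I with Hermitian R and
    I.\<close>
  define \<delta> where "\<delta> i = ?L x ((), i, i) / \<mu>" for i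
  define R where "R = (\<lambda>(i, j). Y (i, j) + cnj (Y (j, i)))"
  define I where "I = (\<lambda>(i, j). (if 0 < i then Y (i - 1, j) else 0) + (if 0 < j then cnj (Y (j - 1, i)) else 0))"
  have RI: "R (i, j) + \<i> * I (i, j) = (if i = j then \<delta> i else 0)" if ij: "i < n" "j < n" for i j
  proof -
    have 1: "?L x ((), i, j) = \<mu> * (R (i, j) + \<i> * I (i, j))"
      unfolding tangent_Delta[OF ij] using ij by (simp add: R_def I_def Y_def)
    show ?thesis
    proof (cases "i = j")
      case False
      then have "?L x ((), i, j) = 0" using LW[OF ij] W[OF ij] by simp
      then show ?thesis using 1 \<mu>0 False by simp
    qed (use 1 \<mu>0 in \<open>simp add: \<delta>_def\<close>)
  qed
  have herm: "cnj (R (j, i)) = R (i, j)" "cnj (I (j, i)) = I (i, j)" for i j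
    by (simp_all add: R_def I_def)
  have R: "R (i, j) = (if i = j then of_real (Re (\<delta> i)) else 0)"
    and I: "I (i, j) = (if i = j then of_real (Im (\<delta> i)) else 0)" if ij: "i < n" "j < n" for i j
  proof -
    have "R (i, j) - \<i> * I (i, j) = (if i = j then cnj (\<delta> i) else 0)"
      using arg_cong[OF RI[OF ij(2,1)], of cnj] herm by (simp split: if_splits)
    with RI[OF ij] have "2 * R (i, j) = (if i = j then \<delta> i + cnj (\<delta> i) else 0)"
      "2 * \<i> * I (i, j) = (if i = j then \<delta> i - cnj (\<delta> i) else 0)" by (auto simp: algebra_simps)
    then show "R (i, j) = (if i = j then of_real (Re (\<delta> i)) else 0)"
      "I (i, j) = (if i = j then of_real (Im (\<delta> i)) else 0)"
      by (auto simp: complex_eq_iff split: if_splits)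
  qed
  have I': "I (i, j) = nw_shift Y (i, j) + (if j = Suc i then of_real (Re (\<delta> i)) else 0)"
    if ij: "i < n" "j < n" for i j
  proof -
    have "I (i, j) = nw_shift Y (i, j) + (if 0 < j then R (i, j - 1) else 0)"
      by (simp add: I_def nw_shift_def R_def)
    then show ?thesis using R[of i "j - 1"] ij by auto
  qed
  \<comment> \<open>Antidiagonal sums remove the shift of Y. Even antidiagonals then yield Im
    (\<delta> k) = 0, odd ones Re (\<delta> k) = 0.\<close>
  have sums: "antidiag_sum s (\<lambda>(i, j). if i = j then of_real (Im (\<delta> i)) else 0) =
      antidiag_sum s (\<lambda>(i, j). if j = i + 1 then of_real (Re (\<delta> i)) else 0)" if s: "s < n" for s
  proof -
    have "antidiag_sum s (\<lambda>(i, j). if i = j then of_real (Im (\<delta> i)) else 0) = antidiag_sum s I"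
      using I s by (intro antidiag_sum_cong) simp
    also have "\<dots> = antidiag_sum s (\<lambda>e. nw_shift Y e + (case e of (i, j) \<Rightarrow> if j = i + 1 then of_real (Re (\<delta> i)) else 0))"
      using I' s by (intro antidiag_sum_cong) simp
    also have "\<dots> = antidiag_sum s (nw_shift Y) + antidiag_sum s (\<lambda>(i, j). if j = i + 1 then of_real (Re (\<delta> i)) else 0)"
      by (simp add: antidiag_sum_def sum.distrib)
    finally show ?thesis by (simp add: antidiag_sum_nw_shift)
  qed
  have Im0: "Im (\<delta> k) = 0" if "2 * k < n" for k
    using sums[OF that] unfolding antidiag_sum_diag antidiag_sum_subdiag by simp
  have Re0: "Re (\<delta> k) = 0" if "2 * k + 1 < n" for k
    using sums[of "Suc (2 * k)"] that unfolding antidiag_sum_diag antidiag_sum_subdiag by simp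
  obtain i j where ij: "e = ((), i, j)" "i < n" "j < n" using e by (auto simp: positions_def)
  show "?L x e = 0"
  proof (cases "i = j")
    case True
    consider "2 * i + 1 < n" | "2 * i + 1 = n" | "n < 2 * i + 1" by linarith
    then show ?thesis
    proof cases
      case 1
      then have "\<delta> i = 0" using Im0 Re0 by (simp add: complex_eq_iff)
      then show ?thesis using \<mu>0 ij True by (simp add: \<delta>_def)
    next
      case 2
      then obtain t where t: "?L x ((), i, i) = of_real t * w" using LW[of i i] W[of i i] ij by auto
      have "\<delta> i = of_real t * (w / \<mu>)" by (simp add: \<delta>_def t)
      moreover have "Im (of_real t * z) = t * Im z" for z by simp
      ultimately have "Im (\<delta> i) = t * Im (w / \<mu>)" by (simp only:)
      then have "t = 0" using Im0[of i] 2 w by simp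
      then show ?thesis using t ij True by simp
    qed (use LW[of i i] W[of i i] ij True in auto)
  qed (use LW[of i j] W[of i j] ij in auto)
qed

section \<open>Nilpotent Jordan blocks\<close>

lemma tangent_jordan_zero:
  assumes "i < s u" "j < s (t u)"
  shows "tangent t s (\<lambda>_. jordan_entry 0) x (u, i, j) =
    (if 0 < j then cnj (x (t u, j - 1, i)) else 0) + (if i + 1 < s u then x (u, i + 1, j) else 0)"
  using jordan_col[OF assms(2), of 0 "\<lambda>k. cnj (x (t u, k, i))"] jordan_row[OF assms(1), of 0 "\<lambda>k. x (u, k, j)"]
  by (simp add: tangent_def)

lemma sum_single:
  assumes "m \<in> K" "finite K" "\<And>k. \<lbrakk>k \<in> K; k \<noteq> m\<rbrakk> \<Longrightarrow> f k = (0 :: complex)"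
  shows "sum f K = f m"
proof -
  have "sum f K = sum f {m}" using assms by (intro sum.mono_neutral_right) auto
  then show ?thesis by simp
qed

text \<open>For nilpotent Jordan blocks each unknown occurs in at most two equations, so the equations
  form chains \<open>(u, i, j) \<rightarrow> (t u, j, i + 2) \<rightarrow> (u, i + 2, j + 2) \<rightarrow> \<dots>\<close>; a chain that both starts in a
  first column and ends in a last row has one equation too many.\<close>

lemma complements_jordan_zero:
  fixes t :: "'u :: finite \<Rightarrow> 'u" and s :: "'u \<Rightarrow> nat" and col :: "'u \<Rightarrow> bool"
  assumes t: "\<And>u. t (t u) = u"
    and col: "\<And>u. col u \<Longrightarrow> s u \<le> s (t u)" "\<And>u. \<not> col u \<Longrightarrow> s (t u) \<le> s u"
    and star: "\<And>u i j. star u i j \<longleftrightarrow>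
      (if col u then j = 0 \<and> even (s u - 1 - i) else i + 1 = s u \<and> even j) \<or>
      s u < s (t u) \<and> odd (s u) \<and> i + 1 = s u \<and> s u + 1 \<le> j"
    and W: "\<And>u i j. \<lbrakk>i < s u; j < s (t u)\<rbrakk> \<Longrightarrow> W (u, i, j) = (if star u i j then UNIV else {0})"
  shows "complements (tangent t s (\<lambda>_. jordan_entry 0)) (positions t s) W"
proof (rule complementsI)
  define L where "L = tangent t s (\<lambda>_. jordan_entry 0)"
  define E where "E = positions t s"
  have L: "L x (u, i, j) =
    (if 0 < j then cnj (x (t u, j - 1, i)) else 0) + (if i + 1 < s u then x (u, i + 1, j) else 0)"
    if "i < s u" "j < s (t u)" for x u i j
    using tangent_jordan_zero[of i s u j t x] that by (simp add: L_def)
  have E: "(u, i, j) \<in> E \<longleftrightarrow> i < s u \<and> j < s (t u)" for u i j by (simp add: E_def positions_def)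

  \<comment> \<open>Nilpotent blocks: every right-hand side is hit modulo the stars\<close>
  {
    \<comment> \<open>\<open>G b\<close> says that \<open>b\<close> is hit up to \<open>W\<close>.
      As \<open>L\<close> is only real linear, a unit vector is tested with all complex
      multiples.\<close>
    define G where "G b \<longleftrightarrow> (\<exists>x. \<forall>e\<in>E. b e - L x e \<in> W e)" for b
    define unit where "unit e c = (\<lambda>e'. if e' = e then c else 0 :: complex)" for e :: "'u \<times> nat \<times> nat" and c
    define good where "good u i j \<longleftrightarrow> (\<forall>c. G (unit (u, i, j) c))" for u i j
    have G_cong: "G b \<longleftrightarrow> G b'" if "\<And>e. e \<in> E \<Longrightarrow> b e = b' e" for b b'
      using that by (simp add: G_def)
    have L_add: "L (\<lambda>v. x v + y v) e = L x e + L y e" if "e \<in> E" for x y e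
      using that by (cases e) (auto simp: E L)
    have W0: "0 \<in> W e" if "e \<in> E" for e using that W by (cases e) (auto simp: E)
    have W_add: "z + w \<in> W e" if "e \<in> E" "z \<in> W e" "w \<in> W e" for e z w
      using that W by (cases e) (auto simp: E split: if_splits)
    have G_add: "G (\<lambda>e. b e + b' e)" if G: "G b" "G b'" for b b'
    proof -
      obtain x y where xy: "\<forall>e\<in>E. b e - L x e \<in> W e" "\<forall>e\<in>E. b' e - L y e \<in> W e"
        using G unfolding G_def by blast
      have "b e + b' e - L (\<lambda>v. x v + y v) e \<in> W e" if "e \<in> E" for e
      proof -
        have "b e + b' e - L (\<lambda>v. x v + y v) e = (b e - L x e) + (b' e - L y e)"
          using L_add[OF that] by simp
        moreover have "b e - L x e \<in> W e" "b' e - L y e \<in> W e" using xy that by blast+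
        ultimately show ?thesis using W_add[OF that] by presburger
      qed
      then show ?thesis unfolding G_def by (intro exI[of _ "\<lambda>v. x v + y v"]) simp
    qed
    have G_image: "G (L x)" for x unfolding G_def using W0 by (intro exI[of _ x]) simp
    \<comment> \<open>The unknown \<open>(u, i + 1, j)\<close> links two consecutive equations of a
      chain, with a conjugation in between; the second is absent if its column index runs out of
      range.\<close>
    have L_unit: "L (unit (u, i + 1, j) c) e = unit (u, i, j) c e +
        (if i + 2 < s u then unit (t u, j, i + 2) (cnj c) e else 0)"
      if "e \<in> E" "i + 1 < s u" for u i j c e
    proof -
      obtain u' i' j' where e: "e = (u', i', j')" by (cases e)
      have 1: "(if 0 < j' then cnj (unit (u, i + 1, j) c (t u', j' - 1, i')) else 0) =
          (if i + 2 < s u then unit (t u, j, i + 2) (cnj c) e else 0)"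
      proof (cases "0 < j' \<and> t u' = u \<and> j' - 1 = i + 1 \<and> i' = j")
        case True
        then have "u' = t u" "j' = i + 2" "i' = j" using t[of u'] by auto
        then show ?thesis using that by (simp add: unit_def e E t)
      next
        case False
        then have "(u', i', j') \<noteq> (t u, j, i + 2)" using t[of u] by auto
        then show ?thesis using False by (auto simp: unit_def e)
      qed
      have 2: "(if i' + 1 < s u' then unit (u, i + 1, j) c (u', i' + 1, j') else 0) = unit (u, i, j) c e"
        using that(2) by (auto simp: unit_def e)
      show ?thesis using L[of i' u' j' "unit (u, i + 1, j) c"] that(1) 1 2 by (simp add: e E)
    qed
    \<comment> \<open>In the last but one row the linking unknown has no second equation, so the
      chain ends freely.\<close>
    have good_end: "good u i j" if "i + 2 = s u" for u i j
      unfolding good_def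
    proof
      fix c
      have "G (unit (u, i, j) c) \<longleftrightarrow> G (L (unit (u, i + 1, j) c))"
        using that L_unit[of _ i u j c] by (intro G_cong) simp
      then show "G (unit (u, i, j) c)" using G_image by simp
    qed
    \<comment> \<open>In the second column the equation contains the unknown
      \<open>(t u, 0, i)\<close>. Lying in row 0, it occurs in no other equation.\<close>
    have good_start: "good u i 1" if "1 < s (t u)" for u i
      unfolding good_def
    proof
      fix c
      have "L (unit (t u, 0, i) (cnj c)) e = unit (u, i, 1) c e" if "e \<in> E" for e
      proof -
        obtain u' i' j' where e: "e = (u', i', j')" by (cases e)
        have "(if 0 < j' then cnj (unit (t u, 0, i) (cnj c) (t u', j' - 1, i')) else 0) = unit (u, i, 1) c e"
        proof (cases "0 < j' \<and> t u' = t u \<and> j' - 1 = 0 \<and> i' = i")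
          case True
          then have "u' = u" by (metis t)
          then have "u' = u" "j' = 1" "i' = i" using True by auto
          then show ?thesis by (simp add: unit_def e)
        next
          case False
          then have "(u', i', j') \<noteq> (u, i, 1)" by auto
          then show ?thesis using False by (auto simp: unit_def e)
        qed
        then show ?thesis using L[of i' u' j' "unit (t u, 0, i) (cnj c)"] that by (simp add: e E unit_def)
      qed
      then have "G (unit (u, i, 1) c) \<longleftrightarrow> G (L (unit (t u, 0, i) (cnj c)))" by (intro G_cong) simp
      then show "G (unit (u, i, 1) c)" using G_image by simp
    qed
    have good_step: "good u i j \<longleftrightarrow> good (t u) j (i + 2)" if i: "i + 2 < s u" for u i j
    proof -
      have *: "L (unit (u, i + 1, j) c) e = unit (u, i, j) c e + unit (t u, j, i + 2) (cnj c) e" if "e \<in> E" for c e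
        using L_unit[OF that, of i u j c] i by simp
      have "G (unit (u, i, j) c)" if "\<And>c. G (unit (t u, j, i + 2) c)" for c
      proof -
        have "G (\<lambda>e. L (unit (u, i + 1, j) c) e + unit (t u, j, i + 2) (- cnj c) e)"
          by (intro G_add G_image that)
        moreover have "G (\<lambda>e. L (unit (u, i + 1, j) c) e + unit (t u, j, i + 2) (- cnj c) e) \<longleftrightarrow> G (unit (u, i, j) c)"
        proof (rule G_cong)
          fix e assume "e \<in> E"
          from *[OF this, of c] show "L (unit (u, i + 1, j) c) e + unit (t u, j, i + 2) (- cnj c) e = unit (u, i, j) c e"
            by (simp add: unit_def)
        qed
        ultimately show ?thesis by (simp only:)
      qed
      moreover have "G (unit (t u, j, i + 2) c)" if "\<And>c. G (unit (u, i, j) c)" for c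
      proof -
        have "G (\<lambda>e. L (unit (u, i + 1, j) (cnj c)) e + unit (u, i, j) (- cnj c) e)"
          by (intro G_add G_image that)
        moreover have "G (\<lambda>e. L (unit (u, i + 1, j) (cnj c)) e + unit (u, i, j) (- cnj c) e) \<longleftrightarrow> G (unit (t u, j, i + 2) c)"
        proof (rule G_cong)
          fix e assume "e \<in> E"
          from *[OF this, of "cnj c"] show "L (unit (u, i + 1, j) (cnj c)) e + unit (u, i, j) (- cnj c) e = unit (t u, j, i + 2) c e"
            by (simp add: unit_def)
        qed
        ultimately show ?thesis by (simp only:)
      qed
      ultimately show ?thesis unfolding good_def by blast
    qed
    have good_star: "good u i j" if "star u i j" for u i j
    proof -
      have L0: "L (\<lambda>_. 0) e = 0" if "e \<in> E" for e using that by (cases e) (auto simp: E L)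
      have "unit (u, i, j) c e - L (\<lambda>_. 0) e \<in> W e" if "e \<in> E" for c e
        using L0[OF that] that W \<open>star u i j\<close> by (cases e) (auto simp: unit_def E)
      then show ?thesis unfolding good_def G_def by blast
    qed
    have good_walk: "good u i j \<longleftrightarrow> good u (i + 2 * k) (j + 2 * k)"
      if "i + 2 * k < s u" "j + 2 * k < s (t u)" for u i j k
      using that
    proof (induction k)
      case (Suc k)
      have "good u (i + 2 * k) (j + 2 * k) \<longleftrightarrow> good (t u) (j + 2 * k) (i + 2 * k + 2)"
        using Suc.prems by (intro good_step) simp
      also have "\<dots> \<longleftrightarrow> good (t (t u)) (i + 2 * k + 2) (j + 2 * k + 2)"
        using Suc.prems by (intro good_step) simp
      finally show ?case using Suc by (simp add: t)
    qed simp
    have good_begin: "good u i 0" if i: "i < s u" and c: "0 < s (t u)" for u i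
    proof -
      \<comment> \<open>A chain that starts in the first column is followed to its end: the last or
        last but one row of \<open>u\<close> (A, B), or the same for \<open>t u\<close> (C, D). B
        and D end freely; A and C have one equation too many and carry a star, in C the one supplied
        by the pattern \<open>P_mat\<close>.\<close>
      consider (A) k where "i + 2 * k + 1 = s u" "2 * k < s (t u)"
        | (B) k where "i + 2 * k + 2 = s u" "2 * k < s (t u)"
        | (C) k where "s (t u) = 2 * k + 1" "i + 2 * k + 2 < s u"
        | (D) k where "s (t u) = 2 * k + 2" "i + 2 * k + 2 < s u"
      proof -
        define l where "l = (s u - 1 - i) div 2"
        define k where "k = (s (t u) - 1) div 2"
        have l: "i + 2 * l + 1 = s u \<or> i + 2 * l + 2 = s u" unfolding l_def using i by presburger
        have k: "s (t u) = 2 * k + 1 \<or> s (t u) = 2 * k + 2" unfolding k_def using c by presburger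
        show ?thesis
        proof (cases "2 * l < s (t u)")
          case True
          then show ?thesis using l A B by blast
        next
          case False
          then have "i + 2 * k + 2 < s u" using l k by presburger
          then show ?thesis using k C D by blast
        qed
      qed
      then show ?thesis
      proof cases
        case A
        show ?thesis
        proof (cases "col u")
          case True
          have "s u - 1 - i = 2 * k" using A(1) by simp
          then have "star u i 0" using True by (simp add: star)
          then show ?thesis by (rule good_star)
        next
          case False
          then have "star u (i + 2 * k) (2 * k)" using A by (simp add: star)
          then show ?thesis using good_walk[of i k u 0] good_star A by simp
        qed
      next
        case B
        then show ?thesis using good_walk[of i k u 0] good_end[of "i + 2 * k" u "2 * k"] by simp
      next
        case C
        then have "star (t u) (2 * k) (i + 2 * k + 2)" by (simp add: star t)
        then show ?thesis using good_walk[of i k u 0] good_step[of "i + 2 * k" u "2 * k"] good_star C by simp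
      next
        case D
        then show ?thesis
          using good_walk[of i k u 0] good_step[of "i + 2 * k" u "2 * k"] good_end[of "2 * k" "t u" "i + 2 * k + 2"]
          by simp
      qed
    qed
    \<comment> \<open>Going backwards along a chain lowers i + j and ends in the first or the second
      column.\<close>
    have good_all: "good u i j" if "i < s u" "j < s (t u)" for u i j
      using that
    proof (induction "i + j" arbitrary: u i j rule: less_induct)
      case less
      consider "j = 0" | "j = 1" | k where "j = k + 2" by (metis One_nat_def add_2_eq_Suc' not0_implies_Suc)
      then show ?case
      proof cases
        case 3
        then have "good (t u) k i" using less.prems by (intro less.hyps) (auto simp: t)
        then show ?thesis using good_step[of k "t u" i] less.prems 3 by (simp add: t)
      qed (use less.prems good_begin good_start in auto)
    qed
    fix b
    have finite_E: "finite E"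
    proof -
      have "E \<subseteq> UNIV \<times> {..<Max (range s)} \<times> {..<Max (range s)}"
        using Max_ge[of "range s"] by (force simp: E_def positions_def intro: less_le_trans)
      then show ?thesis by (rule finite_subset) auto
    qed
    have G_sum: "G (\<lambda>e. \<Sum>e'\<in>N. unit e' (b e') e)" if "finite N" "N \<subseteq> E" for N
      using that
    proof (induction N rule: finite_induct)
      case empty
      show ?case unfolding G_def using W0 by (intro exI[of _ "\<lambda>_. 0"]) (auto simp: E L)
    next
      case (insert e N)
      obtain u i j where e: "e = (u, i, j)" by (cases e)
      have "G (\<lambda>e'. unit e (b e) e' + (\<Sum>e'' \<in>N. unit e'' (b e'') e'))"
        using insert good_all[of i u j] by (intro G_add) (auto simp: e E good_def)
      then show ?case using insert by simp
    qed
    have "(\<Sum>e'\<in>E. unit e' (b e') e) = b e" if "e \<in> E" for e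
      using that finite_E by (simp add: unit_def sum.delta')
    then have "G (\<lambda>e. \<Sum>e'\<in>E. unit e' (b e') e) \<longleftrightarrow> G b" by (rule G_cong)
    then have "G b" using G_sum[OF finite_E subset_refl] by (simp only:)
    then show "\<exists>x. \<forall>e\<in>positions t s. b e - tangent t s (\<lambda>_. jordan_entry 0) x e \<in> W e"
      by (simp add: G_def E_def L_def)
  }

  \<comment> \<open>Nilpotent blocks: a value supported on the stars vanishes\<close>
  fix x e
  assume LW: "\<forall>e\<in>positions t s. tangent t s (\<lambda>_. jordan_entry 0) x e \<in> W e" and e: "e \<in> positions t s"
  have zero: "L x (u, i, j) = 0" if "i < s u" "j < s (t u)" "\<not> star u i j" for u i j
  proof -
    have "L x (u, i, j) \<in> W (u, i, j)" using LW that by (simp add: L_def positions_def)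
    then show ?thesis using W that by simp
  qed
  \<comment> \<open>Consecutive equations of a chain share one unknown. Subtracting the conjugated
    equations of \<open>t u\<close> from those of \<open>u\<close> therefore telescopes and leaves
    at most the last unknown.\<close>
  have tele: "(\<Sum>l\<le>k. L x (u, i + 2 * l, 2 * l)) = (\<Sum>l<k. cnj (L x (t u, 2 * l, i + 2 * l + 2))) +
      (if i + 2 * k + 1 < s u then x (u, i + 2 * k + 1, 2 * k) else 0)"
    if "i + 2 * k < s u" "2 * k < s (t u)" for u i k
    using that
  proof (induction k)
    case 0
    then show ?case by (simp add: L)
  next
    case (Suc k)
    have "cnj (L x (t u, 2 * k, i + 2 * k + 2)) = x (u, i + 2 * k + 1, 2 * k) + cnj (x (t u, 2 * k + 1, i + 2 * k + 2))"
      using Suc.prems by (subst L) (auto simp: t)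
    moreover have "L x (u, i + 2 * Suc k, 2 * Suc k) = cnj (x (t u, 2 * k + 1, i + 2 * k + 2)) +
        (if i + 2 * Suc k + 1 < s u then x (u, i + 2 * Suc k + 1, 2 * Suc k) else 0)"
      using Suc.prems by (subst L) auto
    ultimately show ?case using Suc by simp
  qed
  have chain_u: "(\<Sum>l\<le>k. L x (u, i + 2 * l, 2 * l)) = (\<Sum>l<k. cnj (L x (t u, 2 * l, i + 2 * l + 2)))"
    if "i + 2 * k + 1 = s u" "2 * k < s (t u)" for u i k
    using tele[of i k u] that by simp
  have chain_tu: "(\<Sum>l\<le>k. L x (u, i + 2 * l, 2 * l)) = (\<Sum>l\<le>k. cnj (L x (t u, 2 * l, i + 2 * l + 2)))"
    if "2 * k + 1 = s (t u)" "i + 2 * k + 2 < s u" for u i k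
  proof -
    have "cnj (L x (t u, 2 * k, i + 2 * k + 2)) = x (u, i + 2 * k + 1, 2 * k)"
      using that by (subst L) (auto simp: t)
    then show ?thesis using tele[of i k u] that by (simp add: lessThan_Suc_atMost[symmetric])
  qed
  obtain u i j where e': "e = (u, i, j)" by (cases e)
  have ij: "i < s u" "j < s (t u)" using e by (auto simp: e' positions_def)
  have "L x (u, i, j) = 0"
  proof (cases "star u i j")
    case True
    \<comment> \<open>Each star lies on a chain running from a first column to a last row, where the
      telescoped identity has no remaining unknown. No other position of that chain carries a star,
      so the identity isolates the value at this one.\<close>
    consider (col) "col u" "j = 0" "even (s u - 1 - i)"
      | (row) "\<not> col u" "i + 1 = s u" "even j"
      | (P) "s u < s (t u)" "odd (s u)" "i + 1 = s u" "s u + 1 \<le> j"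
      using True unfolding star by (auto split: if_splits)
    then show ?thesis
    proof cases
      case col
      then obtain k where k: "i + 2 * k + 1 = s u" using ij(1)
        by (elim evenE) (metis Suc_diff_Suc Suc_eq_plus1 add.commute diff_Suc_1' le_add_diff_inverse less_imp_Suc_add less_or_eq_imp_le add_Suc_right diff_add_inverse)
      have c: "s u \<le> s (t u)" using assms(2) col(1) by blast
      have "(\<Sum>l\<le>k. L x (u, i + 2 * l, 2 * l)) = L x (u, i + 2 * 0, 2 * 0)"
        by (rule sum_single) (use k c in \<open>auto intro!: zero simp: star col(1) split: if_splits\<close>)
      moreover have "(\<Sum>l<k. cnj (L x (t u, 2 * l, i + 2 * l + 2))) = 0"
        by (rule sum.neutral) (use k c in \<open>auto intro!: zero simp: star t split: if_splits\<close>)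
      ultimately show ?thesis using chain_u[OF k] k c col(2) by simp
    next
      case row
      then obtain k where k: "j = 2 * k" by auto
      have c: "s (t u) \<le> s u" using assms(3) row(1) by blast
      define i0 where "i0 = i - 2 * k"
      have i0: "i = i0 + 2 * k" using k ij row(2) c by (simp add: i0_def)
      have "(\<Sum>l\<le>k. L x (u, i0 + 2 * l, 2 * l)) = L x (u, i0 + 2 * k, 2 * k)"
        by (rule sum_single) (use k c ij i0 row in \<open>auto intro!: zero simp: star split: if_splits\<close>)
      moreover have "(\<Sum>l<k. cnj (L x (t u, 2 * l, i0 + 2 * l + 2))) = 0"
        by (rule sum.neutral) (use k c ij i0 row in \<open>auto intro!: zero simp: star t split: if_splits\<close>)
      ultimately show ?thesis using chain_u[of i0 k u] k i0 row(2) ij by simp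
    next
      case P
      then obtain k where k: "s u = 2 * k + 1" by (elim oddE)
      \<comment> \<open>The chain through this star begins at \<open>(t u, i0, 0)\<close> and
        reaches the last row of \<open>u\<close> after \<open>2 * k + 1\<close> steps.\<close>
      define i0 where "i0 = j - (2 * k + 2)"
      have i0: "j = i0 + 2 * k + 2" using P k by (simp add: i0_def)
      have ncol: "\<not> col (t u)" using assms(2)[of "t u"] P(1) by (auto simp: t)
      have "(\<Sum>l\<le>k. L x (t u, i0 + 2 * l, 2 * l)) = 0"
        by (rule sum.neutral) (use k ij i0 P ncol in \<open>auto intro!: zero simp: star t split: if_splits\<close>)
      moreover have "(\<Sum>l\<le>k. cnj (L x (t (t u), 2 * l, i0 + 2 * l + 2))) = cnj (L x (t (t u), 2 * k, i0 + 2 * k + 2))"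
        by (rule sum_single) (use k ij i0 P in \<open>auto intro!: zero simp: star t split: if_splits\<close>)
      ultimately show ?thesis using chain_tu[of k "t u" i0] k i0 P ij by (simp add: t)
    qed
  qed (use zero ij in blast)
  then show "tangent t s (\<lambda>_. jordan_entry 0) x e = 0" by (simp add: e' L_def)
qed

section \<open>Power series in the entries and their conjugates\<close>

type_synonym multi_index = "(nat \<times> nat \<Rightarrow> nat) \<times> (nat \<times> nat \<Rightarrow> nat)"

abbreviation origin_ball :: "nat \<Rightarrow> real \<Rightarrow> complex mat set" where
  "origin_ball n \<equiv> mat_ball n (0\<^sub>m n n)"

definition index_set :: "nat \<Rightarrow> multi_index set" where
  "index_set n = exponents n \<times> exponents n"

text \<open>The value of the monomial when all entries are r, hence its supremum over the polydisc
  of radius r.\<close>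

definition weight :: "nat \<Rightarrow> real \<Rightarrow> multi_index \<Rightarrow> real" where
  "weight n r p = (\<Prod>q\<in>grid n n. r ^ fst p q * r ^ snd p q)"

abbreviation coeff_norm :: "nat \<Rightarrow> real \<Rightarrow> (multi_index \<Rightarrow> complex) \<Rightarrow> real" where
  "coeff_norm n r c \<equiv> \<Sum>\<^sub>\<infinity>p\<in>index_set n. cmod (c p) * weight n r p"

abbreviation monomial :: "nat \<Rightarrow> multi_index \<Rightarrow> complex mat \<Rightarrow> complex" where
  "monomial n p X \<equiv> entry_monomial n (fst p) (snd p) X"

text \<open>\<open>K\<close> bounds the weighted \<open>l\<^sup>1\<close> norm of the coefficients, a submultiplicative norm.\<close>

definition bounded_series :: "nat \<Rightarrow> real \<Rightarrow> real \<Rightarrow> (complex mat \<Rightarrow> complex) \<Rightarrow> bool" where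
  "bounded_series n r K f \<longleftrightarrow> (\<exists>c. (\<lambda>p. cmod (c p) * weight n r p) summable_on index_set n \<and>
     coeff_norm n r c \<le> K \<and>
     (\<forall>X\<in>origin_ball n r. ((\<lambda>p. c p * monomial n p X) has_sum f X) (index_set n)))"

lemma weight_pos: "0 < r \<Longrightarrow> 0 < weight n r p"
  by (simp add: weight_def prod_pos)

lemma cmod_monomial_le:
  assumes "\<And>q. q \<in> grid n n \<Longrightarrow> cmod (X $$ q) \<le> r"
  shows "cmod (monomial n p X) \<le> weight n r p"
  unfolding entry_monomial_def weight_def prod_norm[symmetric] norm_mult norm_power complex_mod_cnj
proof (rule prod_mono)
  fix q assume "q \<in> grid n n"
  then have "cmod (X $$ q) \<le> r" by (rule assms)
  moreover from this have "0 \<le> r" using norm_ge_zero order_trans by blast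
  ultimately show "0 \<le> cmod (X $$ q) ^ fst p q * cmod (X $$ q) ^ snd p q \<and>
      cmod (X $$ q) ^ fst p q * cmod (X $$ q) ^ snd p q \<le> r ^ fst p q * r ^ snd p q"
    by (intro conjI mult_mono power_mono) auto
qed

lemma mat_ball_0_entry:
  assumes "X \<in> origin_ball n r" "q \<in> grid n n"
  shows "cmod (X $$ q) < r"
proof -
  obtain i j where "q = (i, j)" "i < n" "j < n" using assms(2) by auto
  then show ?thesis using assms(1) by (force simp: mat_ball_def)
qed

lemma mat_ball_0_margin:
  assumes "0 < r" "A \<in> origin_ball n r"
  obtains e where "0 < e" "\<And>q. q \<in> grid n n \<Longrightarrow> cmod (A $$ q) + e \<le> r"
proof
  \<comment> \<open>Inserting \<open>r\<close> keeps the set nonempty when n = 0.\<close>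
  let ?e = "Min (insert r ((\<lambda>q. r - cmod (A $$ q)) ` (grid n n)))"
  show "0 < ?e" using assms(1) mat_ball_0_entry[OF assms(2)] by (subst Min_gr_iff) auto
  fix q assume "q \<in> grid n n"
  then have "?e \<le> r - cmod (A $$ q)" by (intro Min_le) auto
  then show "cmod (A $$ q) + ?e \<le> r" by simp
qed

lemma bounded_series_mono: "bounded_series n r K f \<Longrightarrow> K \<le> K' \<Longrightarrow> bounded_series n r K' f"
  unfolding bounded_series_def by fastforce

lemma bounded_series_cong:
  assumes "\<And>X. X \<in> origin_ball n r \<Longrightarrow> f X = g X"
  shows "bounded_series n r K f = bounded_series n r K g"
  unfolding bounded_series_def by (intro ex_cong1 conj_cong refl ball_cong) (simp add: assms)

text \<open>Summability of the double family is assumed; then its total exists and can only be the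
  iterated sum.\<close>

lemma has_sum_SigmaI_banach:
  fixes f :: "'i \<times> 'j \<Rightarrow> 'a :: banach"
  assumes "\<And>x. x \<in> A \<Longrightarrow> ((\<lambda>y. f (x, y)) has_sum g x) (B x)" "(g has_sum S) A" "f summable_on Sigma A B"
  shows "(f has_sum S) (Sigma A B)"
proof -
  have "(g has_sum infsum f (Sigma A B)) A"
    by (rule has_sum_Sigma[OF isUCont_plus has_sum_infsum[OF assms(3)] assms(1)])
  then have "infsum f (Sigma A B) = S" using assms(2) has_sum_unique by blast
  then show ?thesis using has_sum_infsum[OF assms(3)] by simp
qed

lemma has_sum_fibres:
  assumes "\<And>j. j \<in> J \<Longrightarrow> d j \<in> I" and "((\<lambda>j. g j (d j)) has_sum S) J"
  shows "((\<lambda>(s, j). g j s) has_sum S) (SIGMA s:I. {j\<in>J. d j = s})"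
proof -
  have bij: "bij_betw snd (SIGMA s:I. {j\<in>J. d j = s}) J"
    by (rule bij_betw_byWitness[where f' = "\<lambda>j. (d j, j)"]) (use assms(1) in auto)
  have "((\<lambda>x. g (snd x) (d (snd x))) has_sum S) (SIGMA s:I. {j\<in>J. d j = s})"
    using assms(2) by (subst has_sum_reindex_bij_betw[OF bij])
  then show ?thesis by (subst has_sum_cong[where g = "\<lambda>x. g (snd x) (d (snd x))"]) auto
qed

text \<open>The workhorse for the closure properties. A family of monomial terms over any index set,
  with repeated exponents, is collected along the fibres of \<open>d\<close>; the triangle
  inequality on each fibre shows that collecting does not increase the norm. Sums, Cauchy products,
  conjugates and single monomials all fit this scheme.\<close>

lemma bounded_series_regroup:
  fixes a :: "'j \<Rightarrow> complex"
  assumes r: "0 < r" and d: "\<And>j. j \<in> J \<Longrightarrow> d j \<in> index_set n"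
    and a: "((\<lambda>j. cmod (a j) * weight n r (d j)) has_sum K) J"
    and f: "\<And>X. X \<in> origin_ball n r \<Longrightarrow> ((\<lambda>j. a j * monomial n (d j) X) has_sum f X) J"
  shows "bounded_series n r K f"
proof -
  define B where "B s = {j\<in>J. d j = s}" for s
  define c where "c s = infsum a (B s)" for s
  define g where "g = (\<lambda>s. \<Sum>\<^sub>\<infinity>j\<in>B s. cmod (a j) * weight n r s)"
  have w: "((\<lambda>(s, j). cmod (a j) * weight n r s) has_sum K) (Sigma (index_set n) B)"
    unfolding B_def by (rule has_sum_fibres[where g = "\<lambda>j s. cmod (a j) * weight n r s"]) (use d a in auto)
  have sw: "(\<lambda>j. cmod (a j) * weight n r s) summable_on B s" if "s \<in> index_set n" for s
    using summable_on_SigmaD1[OF has_sum_imp_summable[OF w] that] .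
  have aa: "a abs_summable_on B s" if "s \<in> index_set n" for s
    using sw[OF that] weight_pos[OF r, of n s] by (simp add: summable_on_cmult_left')
  have g: "g summable_on index_set n" "infsum g (index_set n) = K"
    using summable_on_Sigma_banach[OF has_sum_imp_summable[OF w]]
      infsum_Sigma'_banach[OF has_sum_imp_summable[OF w]] infsumI[OF w] by (simp_all add: g_def)
  have cg: "cmod (c s) * weight n r s \<le> g s" if "s \<in> index_set n" for s
  proof -
    have "cmod (c s) * weight n r s \<le> (\<Sum>\<^sub>\<infinity>j\<in>B s. cmod (a j)) * weight n r s"
      using norm_infsum_bound[OF aa[OF that]] weight_pos[OF r, of n s]
      by (intro mult_right_mono) (auto simp: c_def)
    also have "\<dots> = g s" using aa[OF that] by (simp add: g_def infsum_cmult_left)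
    finally show ?thesis .
  qed
  have nonneg: "0 \<le> cmod (c s) * weight n r s" for s using weight_pos[OF r, of n s] by simp
  have sc: "(\<lambda>s. cmod (c s) * weight n r s) summable_on index_set n"
    by (rule summable_on_comparison_test[OF g(1)]) (use cg nonneg in auto)
  moreover have "(\<Sum>\<^sub>\<infinity>s\<in>index_set n. cmod (c s) * weight n r s) \<le> K"
    using infsum_mono[OF sc g(1)] cg g(2) by simp
  moreover have "((\<lambda>s. c s * monomial n s X) has_sum f X) (index_set n)"
    if "X \<in> origin_ball n r" for X
  proof (rule has_sum_Sigma')
    show "((\<lambda>(s, j). a j * monomial n s X) has_sum f X) (Sigma (index_set n) B)"
      unfolding B_def
      by (rule has_sum_fibres[where g = "\<lambda>j s. a j * monomial n s X"]) (use d f that in auto)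
    show "((\<lambda>j. case (s, j) of (s, j) \<Rightarrow> a j * monomial n s X) has_sum c s * monomial n s X) (B s)"
      if "s \<in> index_set n" for s
      using has_sum_cmult_left[OF has_sum_infsum[OF abs_summable_summable[OF aa[OF that]]]]
      by (simp add: c_def)
  qed
  ultimately show ?thesis unfolding bounded_series_def by (intro exI[of _ c]) simp
qed

lemma bounded_series_abs_summable:
  assumes "(\<lambda>p. cmod (c p) * weight n r (d p)) summable_on J" "X \<in> origin_ball n r"
  shows "(\<lambda>p. c p * monomial n (d p) X) abs_summable_on J"
proof (rule abs_summable_on_comparison_test'[OF assms(1)])
  fix p
  have "cmod (monomial n (d p) X) \<le> weight n r (d p)"
    using mat_ball_0_entry[OF assms(2)] by (intro cmod_monomial_le) (auto intro: less_imp_le)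
  then show "norm (c p * monomial n (d p) X) \<le> cmod (c p) * weight n r (d p)"
    by (simp add: norm_mult mult_left_mono)
qed

lemma bounded_series_norm_le:
  assumes "bounded_series n r K f" "X \<in> origin_ball n r"
  shows "cmod (f X) \<le> K"
proof -
  obtain c where c: "(\<lambda>p. cmod (c p) * weight n r p) summable_on index_set n"
     "coeff_norm n r c \<le> K"
     "((\<lambda>p. c p * monomial n p X) has_sum f X) (index_set n)"
    using assms unfolding bounded_series_def by blast
  have abs: "(\<lambda>p. c p * monomial n p X) abs_summable_on index_set n"
    using bounded_series_abs_summable[of c n r "\<lambda>p. p"] c(1) assms(2) by simp
  have "cmod (f X) \<le> (\<Sum>\<^sub>\<infinity>p\<in>index_set n. norm (c p * monomial n p X))"
    using norm_infsum_bound[OF abs] infsumI[OF c(3)] by simp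
  also have "\<dots> \<le> coeff_norm n r c"
  proof (rule infsum_mono[OF abs c(1)])
    fix p
    have "cmod (monomial n p X) \<le> weight n r p"
      using mat_ball_0_entry[OF assms(2)] by (intro cmod_monomial_le) (auto intro: less_imp_le)
    then show "norm (c p * monomial n p X) \<le> cmod (c p) * weight n r p"
      by (simp add: norm_mult mult_left_mono)
  qed
  finally show ?thesis using c(2) by simp
qed

text \<open>Completeness of the algebra: a sum of series with summable norms is a series. It
  provides the limit of the iteration and also the recentred expansions.\<close>

lemma bounded_series_has_sum:
  assumes r: "0 < r" and f: "\<And>k. k \<in> N \<Longrightarrow> bounded_series n r (K k) (f k)"
    and K: "(K has_sum S) N"
    and F: "\<And>X. X \<in> origin_ball n r \<Longrightarrow> ((\<lambda>k. f k X) has_sum F X) N"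
  shows "bounded_series n r S F"
proof -
  have "\<forall>k\<in>N. \<exists>c. (\<lambda>p. cmod (c p) * weight n r p) summable_on index_set n \<and>
      coeff_norm n r c \<le> K k \<and>
      (\<forall>X\<in>origin_ball n r. ((\<lambda>p. c p * monomial n p X) has_sum f k X) (index_set n))"
    using f unfolding bounded_series_def by simp
  from bchoice[OF this] obtain c where c:
    "\<And>k. k \<in> N \<Longrightarrow> (\<lambda>p. cmod (c k p) * weight n r p) summable_on index_set n"
    "\<And>k. k \<in> N \<Longrightarrow> (\<Sum>\<^sub>\<infinity>p\<in>index_set n. cmod (c k p) * weight n r p) \<le> K k"
    "\<And>k X. \<lbrakk>k \<in> N; X \<in> origin_ball n r\<rbrakk> \<Longrightarrow> ((\<lambda>p. c k p * monomial n p X) has_sum f k X) (index_set n)"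
    by blast
  \<comment> \<open>The bounds \<open>K k\<close> only dominate the norms, so the double family is
    summed with the exact norms \<open>h\<close> and compared with \<open>S\<close> at the
    end.\<close>
  define h where "h = (\<lambda>k. \<Sum>\<^sub>\<infinity>p\<in>index_set n. cmod (c k p) * weight n r p)"
  have w: "0 \<le> weight n r p" for p using weight_pos[OF r] less_imp_le by blast
  have h: "h summable_on N"
  proof (rule summable_on_comparison_test[OF has_sum_imp_summable[OF K]])
    show "h k \<le> K k" if "k \<in> N" for k using c(2)[OF that] by (simp add: h_def)
    show "0 \<le> h k" for k unfolding h_def by (intro infsum_nonneg mult_nonneg_nonneg w) simp
  qed
  have s: "(\<lambda>(k, p). cmod (c k p) * weight n r p) summable_on (N \<times> index_set n)"
    using has_sum_infsum[OF c(1)] h w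
    by (intro summable_on_SigmaI[where g = h]) (auto simp: h_def intro!: mult_nonneg_nonneg)
  have "infsum (\<lambda>(k, p). cmod (c k p) * weight n r p) (N \<times> index_set n) = infsum h N"
    using infsum_Sigma'_banach[OF s] by (simp add: h_def)
  then have hs: "((\<lambda>j. cmod (case j of (k, p) \<Rightarrow> c k p) * weight n r (snd j)) has_sum infsum h N) (N \<times> index_set n)"
    using has_sum_infsum[OF s] by (simp add: case_prod_unfold)
  have "bounded_series n r (infsum h N) F"
  proof (rule bounded_series_regroup[OF r _ hs])
    fix X assume X: "X \<in> origin_ball n r"
    show "((\<lambda>j. (case j of (k, p) \<Rightarrow> c k p) * monomial n (snd j) X) has_sum F X) (N \<times> index_set n)"
    proof (rule has_sum_SigmaI_banach[where g = "\<lambda>k. f k X"])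
      show "(\<lambda>j. (case j of (k, p) \<Rightarrow> c k p) * monomial n (snd j) X) summable_on N \<times> index_set n"
        using bounded_series_abs_summable[OF has_sum_imp_summable[OF hs] X]
        by (rule abs_summable_summable)
    qed (use c(3) X F in auto)
  qed auto
  moreover have "infsum h N \<le> S"
    using infsum_mono[OF h has_sum_imp_summable[OF K]] c(2) infsumI[OF K] by (simp add: h_def)
  ultimately show ?thesis by (rule bounded_series_mono)
qed

lemma bounded_series_sum:
  assumes "0 < r" "finite N" "\<And>k. k \<in> N \<Longrightarrow> bounded_series n r (K k) (f k)"
  shows "bounded_series n r (\<Sum>k\<in>N. K k) (\<lambda>X. \<Sum>k\<in>N. f k X)"
  by (rule bounded_series_has_sum[where f = f and K = K and N = N, OF assms(1)])
    (use assms in \<open>auto intro: has_sum_finiteI\<close>)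

lemma bounded_series_add:
  assumes "0 < r" "bounded_series n r K f" "bounded_series n r L g"
  shows "bounded_series n r (K + L) (\<lambda>X. f X + g X)"
proof -
  have "bounded_series n r (\<Sum>b\<in>UNIV. if b then K else L) (\<lambda>X. \<Sum>b\<in>UNIV. (if b then f else g) X)"
    by (rule bounded_series_sum[OF assms(1)]) (use assms in auto)
  then show ?thesis by (simp add: UNIV_bool add.commute)
qed

lemma bounded_series_monomial:
  assumes "0 < r" "p \<in> index_set n"
  shows "bounded_series n r (cmod a * weight n r p) (\<lambda>X. a * monomial n p X)"
  by (rule bounded_series_regroup[where J = "{()}" and d = "\<lambda>_. p" and a = "\<lambda>_. a", OF assms(1)])
    (use assms in \<open>auto intro: has_sum_finiteI\<close>)

lemma bounded_series_const:
  assumes "0 < r"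
  shows "bounded_series n r (cmod a) (\<lambda>_. a)"
  using bounded_series_monomial[OF assms, of "(\<lambda>_. 0, \<lambda>_. 0)" n a]
  by (simp add: index_set_def exponents_def weight_def entry_monomial_def)

lemma bounded_series_entry:
  assumes "0 < r" "q \<in> grid n n"
  shows "bounded_series n r r (\<lambda>X. X $$ q)"
proof -
  define p :: "multi_index" where "p = (\<lambda>q'. if q' = q then 1 else 0, \<lambda>_. 0)"
  have "p \<in> index_set n" using assms(2) by (auto simp: index_set_def exponents_def p_def)
  moreover have "weight n r p = r" using assms(2)
    by (simp add: weight_def p_def if_distrib[of "\<lambda>k. r ^ k"] prod.delta cong: if_cong)
  moreover have "monomial n p X = X $$ q" for X
  proof -
    have "monomial n p X = (\<Prod>q'\<in>grid n n. if q' = q then X $$ q' else 1)"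
      unfolding entry_monomial_def by (intro prod.cong) (auto simp: p_def)
    also have "\<dots> = X $$ q" using assms(2) by (simp add: prod.delta)
    finally show ?thesis .
  qed
  ultimately show ?thesis using bounded_series_monomial[OF assms(1), of p n 1] by simp
qed

text \<open>Conjugation exchanges the exponents of the entries with those of their conjugates, and
  the weight is symmetric in the two.\<close>

lemma bounded_series_cnj:
  assumes r: "0 < r" and f: "bounded_series n r K f"
  shows "bounded_series n r K (\<lambda>X. cnj (f X))"
proof -
  obtain c where c: "(\<lambda>p. cmod (c p) * weight n r p) summable_on index_set n"
     "coeff_norm n r c \<le> K"
     "\<And>X. X \<in> origin_ball n r \<Longrightarrow> ((\<lambda>p. c p * monomial n p X) has_sum f X) (index_set n)"
    using f unfolding bounded_series_def by blast
  have w: "weight n r (prod.swap p) = weight n r p" for p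
    by (simp add: weight_def mult.commute)
  have m: "monomial n (prod.swap p) X = cnj (monomial n p X)" for p X
    by (simp add: entry_monomial_def mult.commute)
  have "bounded_series n r (coeff_norm n r c) (\<lambda>X. cnj (f X))"
  proof (rule bounded_series_regroup[OF r, where d = prod.swap and a = "\<lambda>p. cnj (c p)" and J = "index_set n"])
    show "((\<lambda>j. cmod (cnj (c j)) * weight n r (prod.swap j)) has_sum
        coeff_norm n r c) (index_set n)"
      unfolding w complex_mod_cnj by (rule has_sum_infsum[OF c(1)])
    fix X assume "X \<in> origin_ball n r"
    then have "((\<lambda>p. cnj (c p * monomial n p X)) has_sum cnj (f X)) (index_set n)"
      unfolding has_sum_cnj_iff by (rule c(3))
    then show "((\<lambda>j. cnj (c j) * monomial n (prod.swap j) X) has_sum cnj (f X)) (index_set n)"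
      unfolding m complex_cnj_mult .
  qed (auto simp: index_set_def)
  then show ?thesis using c(2) by (rule bounded_series_mono)
qed

text \<open>The Cauchy product: exponents add and weights multiply, which makes the norm
  submultiplicative.\<close>

lemma bounded_series_mult:
  assumes r: "0 < r" and f: "bounded_series n r K f" and g: "bounded_series n r L g"
  shows "bounded_series n r (K * L) (\<lambda>X. f X * g X)"
proof -
  obtain c where c: "(\<lambda>p. cmod (c p) * weight n r p) summable_on index_set n"
     "coeff_norm n r c \<le> K"
     "\<And>X. X \<in> origin_ball n r \<Longrightarrow> ((\<lambda>p. c p * monomial n p X) has_sum f X) (index_set n)"
    using f unfolding bounded_series_def by blast
  obtain d where d: "(\<lambda>p. cmod (d p) * weight n r p) summable_on index_set n"
     "coeff_norm n r d \<le> L"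
     "\<And>X. X \<in> origin_ball n r \<Longrightarrow> ((\<lambda>p. d p * monomial n p X) has_sum g X) (index_set n)"
    using g unfolding bounded_series_def by blast
  define C where "C = coeff_norm n r c"
  define E where "E = coeff_norm n r d"
  define plus :: "multi_index \<times> multi_index \<Rightarrow> multi_index"
    where "plus = (\<lambda>(p, p'). (\<lambda>q. fst p q + fst p' q, \<lambda>q. snd p q + snd p' q))"
  have w0: "0 \<le> weight n r p" for p using weight_pos[OF r] less_imp_le by blast
  have w: "weight n r (plus (p, p')) = weight n r p * weight n r p'" for p p'
    unfolding weight_def prod.distrib[symmetric]
    by (intro prod.cong) (auto simp: plus_def power_add)
  have m: "monomial n (plus (p, p')) X = monomial n p X * monomial n p' X" for p p' X
    unfolding entry_monomial_def prod.distrib[symmetric]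
    by (intro prod.cong) (auto simp: plus_def power_add)
  have CE: "0 \<le> C" "0 \<le> E" by (auto simp: C_def E_def intro!: infsum_nonneg mult_nonneg_nonneg w0)
  define a where "a = (\<lambda>(p, p'). c p * d p')"
  have in1: "((\<lambda>p'. cmod (a (p, p')) * weight n r (plus (p, p'))) has_sum cmod (c p) * weight n r p * E) (index_set n)" for p
  proof -
    have "((\<lambda>p'. cmod (c p) * weight n r p * (cmod (d p') * weight n r p')) has_sum
        cmod (c p) * weight n r p * E) (index_set n)"
      unfolding E_def by (rule has_sum_cmult_right[OF has_sum_infsum[OF d(1)]])
    then show ?thesis by (simp add: a_def w norm_mult mult_ac)
  qed
  have out1: "((\<lambda>p. cmod (c p) * weight n r p * E) has_sum C * E) (index_set n)"
    unfolding C_def by (rule has_sum_cmult_left[OF has_sum_infsum[OF c(1)]])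
  have s: "(\<lambda>j. cmod (a j) * weight n r (plus j)) summable_on (index_set n \<times> index_set n)"
    using in1 has_sum_imp_summable[OF out1] w0 by (intro summable_on_SigmaI) auto
  have h: "((\<lambda>j. cmod (a j) * weight n r (plus j)) has_sum C * E) (index_set n \<times> index_set n)"
    by (rule has_sum_SigmaI_banach[OF in1 out1 s])
  have "bounded_series n r (C * E) (\<lambda>X. f X * g X)"
  proof (rule bounded_series_regroup[OF r _ h])
    fix X assume X: "X \<in> origin_ball n r"
    show "((\<lambda>j. a j * monomial n (plus j) X) has_sum f X * g X) (index_set n \<times> index_set n)"
    proof (rule has_sum_SigmaI_banach[where g = "\<lambda>p. c p * monomial n p X * g X"])
      show "(\<lambda>j. a j * monomial n (plus j) X) summable_on index_set n \<times> index_set n"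
        using bounded_series_abs_summable[OF s X] by (rule abs_summable_summable)
      show "((\<lambda>p. c p * monomial n p X * g X) has_sum f X * g X) (index_set n)"
        by (rule has_sum_cmult_left[OF c(3)[OF X]])
      show "((\<lambda>p'. a (p, p') * monomial n (plus (p, p')) X) has_sum c p * monomial n p X * g X) (index_set n)" for p
      proof -
        have "a (p, p') * monomial n (plus (p, p')) X = c p * monomial n p X * (d p' * monomial n p' X)" for p'
          by (simp add: a_def m)
        then show ?thesis using has_sum_cmult_right[OF d(3)[OF X], of "c p * monomial n p X"] by simp
      qed
    qed
  qed (auto simp: index_set_def exponents_def plus_def)
  moreover have "C * E \<le> K * L" using c(2) d(2) CE by (intro mult_mono) (auto simp: C_def E_def)
  ultimately show ?thesis by (rule bounded_series_mono)
qed

lemma bounded_series_cmult: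
  "\<lbrakk>0 < r; bounded_series n r K f\<rbrakk> \<Longrightarrow> bounded_series n r (cmod a * K) (\<lambda>X. a * f X)"
  by (rule bounded_series_mult[where f = "\<lambda>_. a", OF _ bounded_series_const])

lemma bounded_series_power:
  "\<lbrakk>0 < r; bounded_series n r K f\<rbrakk> \<Longrightarrow> bounded_series n r (K ^ k) (\<lambda>X. f X ^ k)"
proof (induction k)
  case 0
  then show ?case using bounded_series_const[of r n 1] by simp
next
  case (Suc k)
  then show ?case unfolding power_Suc by (intro bounded_series_mult[where f = f])
qed

lemma bounded_series_prod:
  assumes "0 < r" "finite N" "\<And>k. k \<in> N \<Longrightarrow> bounded_series n r (K k) (f k)"
  shows "bounded_series n r (\<Prod>k\<in>N. K k) (\<lambda>X. \<Prod>k\<in>N. f k X)"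
  using assms(2,3)
proof (induction N rule: finite_induct)
  case empty
  then show ?case using bounded_series_const[OF assms(1), of n 1] by simp
next
  case (insert k N)
  have "bounded_series n r (K k * (\<Prod>k\<in>N. K k)) (\<lambda>X. f k X * (\<Prod>k\<in>N. f k X))"
    using insert by (intro bounded_series_mult[OF assms(1)]) auto
  then show ?case using insert.hyps by simp
qed

text \<open>Recentring: each monomial in \<open>A + Z\<close> is a product of the series \<open>A $$ q + Z $$ q\<close> and their
  conjugates, with coefficient norms \<open>cmod (A $$ q) + \<epsilon> \<le> r\<close>.\<close>

lemma bounded_series_analytic:
  assumes r: "0 < r" and f: "bounded_series n r K f" and A: "A \<in> origin_ball n r"
  shows "entry_analytic_at n f A"
proof -
  let ?P = "grid n n"
  obtain c where c: "(\<lambda>p. cmod (c p) * weight n r p) summable_on index_set n"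
     "coeff_norm n r c \<le> K"
     "\<And>X. X \<in> origin_ball n r \<Longrightarrow> ((\<lambda>p. c p * monomial n p X) has_sum f X) (index_set n)"
    using f unfolding bounded_series_def by blast
  obtain e where e: "0 < e" "\<And>q. q \<in> ?P \<Longrightarrow> cmod (A $$ q) + e \<le> r"
    using mat_ball_0_margin[OF r A] by blast
  have Ac: "A \<in> carrier_mat n n" using A by (simp add: mat_ball_def)
  have shift: "A + Z \<in> origin_ball n r" "\<And>q. q \<in> ?P \<Longrightarrow> (A + Z) $$ q = A $$ q + Z $$ q"
    if Z: "Z \<in> origin_ball n e" for Z
  proof -
    have Zc: "Z \<in> carrier_mat n n" using Z by (simp add: mat_ball_def)
    show *: "(A + Z) $$ q = A $$ q + Z $$ q" if "q \<in> ?P" for q using that Ac Zc by auto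
    have "cmod ((A + Z) $$ q) < r" if "q \<in> ?P" for q
      using *[OF that] e(2)[OF that] mat_ball_0_entry[OF Z that] norm_triangle_ineq[of "A $$ q" "Z $$ q"]
      by simp
    then show "A + Z \<in> origin_ball n r" using Ac Zc by (auto simp: mat_ball_def)
  qed
  have "bounded_series n e (coeff_norm n r c) (\<lambda>Z. f (A + Z))"
  proof (rule bounded_series_has_sum[OF e(1) _ has_sum_infsum[OF c(1)], where f = "\<lambda>p Z. c p * monomial n p (A + Z)"])
    fix p assume "p \<in> index_set n"
    have q: "bounded_series n e (cmod (A $$ q) + e) (\<lambda>Z. A $$ q + Z $$ q)" if "q \<in> ?P" for q
      using that e by (intro bounded_series_add bounded_series_const bounded_series_entry) auto
    have "bounded_series n e (\<Prod>q\<in>?P. (cmod (A $$ q) + e) ^ fst p q * (cmod (A $$ q) + e) ^ snd p q)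
        (\<lambda>Z. \<Prod>q\<in>?P. (A $$ q + Z $$ q) ^ fst p q * cnj (A $$ q + Z $$ q) ^ snd p q)"
      using q e(1)
      by (intro bounded_series_prod bounded_series_mult bounded_series_power bounded_series_cnj) auto
    moreover have "(\<Prod>q\<in>?P. (cmod (A $$ q) + e) ^ fst p q * (cmod (A $$ q) + e) ^ snd p q) \<le> weight n r p"
      unfolding weight_def
    proof (rule prod_mono)
      fix q assume "q \<in> ?P"
      then show "0 \<le> (cmod (A $$ q) + e) ^ fst p q * (cmod (A $$ q) + e) ^ snd p q \<and>
          (cmod (A $$ q) + e) ^ fst p q * (cmod (A $$ q) + e) ^ snd p q \<le> r ^ fst p q * r ^ snd p q"
        using e(1) e(2)[of q] r by (intro conjI mult_mono power_mono) auto
    qed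
    ultimately have "bounded_series n e (weight n r p)
        (\<lambda>Z. \<Prod>q\<in>?P. (A $$ q + Z $$ q) ^ fst p q * cnj (A $$ q + Z $$ q) ^ snd p q)"
      by (rule bounded_series_mono)
    also have "?this \<longleftrightarrow> bounded_series n e (weight n r p) (\<lambda>Z. monomial n p (A + Z))"
      unfolding entry_monomial_def using shift(2) by (intro bounded_series_cong prod.cong) auto
    finally show "bounded_series n e (cmod (c p) * weight n r p) (\<lambda>Z. c p * monomial n p (A + Z))"
      by (rule bounded_series_cmult[OF e(1)])
  qed (use shift(1) c(3) in auto)
  then obtain d where d: "\<And>Z. Z \<in> origin_ball n e \<Longrightarrow>
      ((\<lambda>p. d p * monomial n p Z) has_sum f (A + Z)) (index_set n)"
    unfolding bounded_series_def by blast
  have "((\<lambda>(\<alpha>, \<beta>). d (\<alpha>, \<beta>) * entry_monomial n \<alpha> \<beta> (X - A)) has_sum f X) (exponents n \<times> exponents n)"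
    if X: "X \<in> mat_ball n A e" for X
  proof -
    have Xc: "X \<in> carrier_mat n n" using X by (simp add: mat_ball_def)
    have "X - A \<in> origin_ball n e" using X Ac by (auto simp: mat_ball_def)
    moreover have "A + (X - A) = X" using Xc Ac by (intro eq_matI) auto
    ultimately show ?thesis using d[of "X - A"] by (simp add: index_set_def case_prod_unfold)
  qed
  then show ?thesis unfolding entry_analytic_at_def using e(1)
    by (intro exI[of _ "\<lambda>\<alpha> \<beta>. d (\<alpha>, \<beta>)"] exI[of _ e]) auto
qed

section \<open>Existence of the reducing map\<close>

text \<open>Defined on functions of all index pairs instead of matrices, so that it can serve as the
  map in \<open>complements\<close>; only entries on the grid are read.\<close>

definition star_tangent :: "nat \<Rightarrow> complex mat \<Rightarrow> entries \<Rightarrow> entries" where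
  "star_tangent n A Y = (\<lambda>(i, j). (\<Sum>k<n. A $$ (k, j) * cnj (Y (k, i))) + (\<Sum>k<n. A $$ (i, k) * Y (k, j)))"

text \<open>The part of \<open>(I + Y)\<^sup>* (A + X) (I + Y) - A\<close> that is not linear in \<open>Y\<close> alone.\<close>

definition remainder ::
  "nat \<Rightarrow> complex mat \<Rightarrow> complex mat \<Rightarrow> entries \<Rightarrow> entries" where
  "remainder n A X Y = (\<lambda>(i, j). X $$ (i, j) + (\<Sum>k<n. cnj (Y (k, i)) * X $$ (k, j)) +
     (\<Sum>k<n. X $$ (i, k) * Y (k, j)) +
     (\<Sum>k<n. \<Sum>l<n. cnj (Y (k, i)) * (A $$ (k, l) + X $$ (k, l)) * Y (l, j)))"

text \<open>The quadratic part of a difference is written as D^H B Y' + Y^H B D. This makes the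
  whole real linear in \<open>D\<close>, with coefficients that are small together with X, Y and
  Y'.\<close>

definition remainder_diff ::
  "nat \<Rightarrow> complex mat \<Rightarrow> complex mat \<Rightarrow> entries \<Rightarrow> entries \<Rightarrow>
    entries \<Rightarrow> entries" where
  "remainder_diff n A X Y Y' D = (\<lambda>(i, j). (\<Sum>k<n. cnj (D (k, i)) * X $$ (k, j)) +
     (\<Sum>k<n. X $$ (i, k) * D (k, j)) +
     (\<Sum>k<n. \<Sum>l<n. cnj (D (k, i)) * (A $$ (k, l) + X $$ (k, l)) * Y' (l, j) +
       cnj (Y (k, i)) * (A $$ (k, l) + X $$ (k, l)) * D (l, j)))"

lemma remainder_diff:
  "remainder n A X Y' q - remainder n A X Y q = remainder_diff n A X Y Y' (\<lambda>p. Y' p - Y p) q"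
proof -
  obtain i j where q: "q = (i, j)" by (cases q)
  have "cnj (Y' (k, i)) * a * Y' (l, j) - cnj (Y (k, i)) * a * Y (l, j) =
      cnj (Y' (k, i) - Y (k, i)) * a * Y' (l, j) + cnj (Y (k, i)) * a * (Y' (l, j) - Y (l, j))" for k l a
    by (simp add: algebra_simps)
  then show ?thesis
    by (simp add: q remainder_def remainder_diff_def sum_subtractf[symmetric] algebra_simps
        del: complex_cnj_diff) (simp add: sum_subtractf algebra_simps)
qed

text \<open>The real linear map P of the overview: \<open>u q\<close> and \<open>v q\<close> are the
  images of the units 1 and i at position q.\<close>

definition combination :: "nat \<Rightarrow> (nat \<times> nat \<Rightarrow> entries) \<Rightarrow> (nat \<times> nat \<Rightarrow> entries) \<Rightarrow>
    entries \<Rightarrow> entries" where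
  "combination n u v G p = (\<Sum>q\<in>grid n n. of_real (Re (G q)) * u q p + of_real (Im (G q)) * v q p)"

lemma combination_diff:
  "combination n u v G p - combination n u v H p = combination n u v (\<lambda>q. G q - H q) p"
  unfolding combination_def sum_subtractf[symmetric] by (intro sum.cong) (simp_all add: algebra_simps)

lemma bounded_series_Re:
  assumes "0 < r" "bounded_series n r K f"
  shows "bounded_series n r K (\<lambda>X. of_real (Re (f X)))"
proof -
  have "bounded_series n r (cmod (1 / 2) * (K + K)) (\<lambda>X. 1 / 2 * (f X + cnj (f X)))"
    using assms by (intro bounded_series_cmult bounded_series_add bounded_series_cnj)
  then show ?thesis by (simp add: complex_add_cnj)
qed

lemma bounded_series_Im:
  assumes "0 < r" "bounded_series n r K f"
  shows "bounded_series n r K (\<lambda>X. of_real (Im (f X)))"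
proof -
  have "bounded_series n r (cmod (- \<i>) * K) (\<lambda>X. - \<i> * f X)"
    using assms by (rule bounded_series_cmult)
  from bounded_series_Re[OF assms(1) this] show ?thesis by simp
qed

lemma bounded_series_combination:
  assumes r: "0 < r" and G: "\<And>q. q \<in> grid n n \<Longrightarrow> bounded_series n r K (\<lambda>X. G X q)"
    and K: "0 \<le> K" and c: "(\<Sum>q\<in>grid n n. cmod (u q p) + cmod (v q p)) \<le> c"
  shows "bounded_series n r (c * K) (\<lambda>X. combination n u v (G X) p)"
proof -
  have "bounded_series n r (\<Sum>q\<in>grid n n. cmod (u q p) * K + cmod (v q p) * K)
      (\<lambda>X. \<Sum>q\<in>grid n n. u q p * of_real (Re (G X q)) + v q p * of_real (Im (G X q)))"
    using r G by (intro bounded_series_sum bounded_series_add bounded_series_cmult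
        bounded_series_Re bounded_series_Im) auto
  moreover have "(\<Sum>q\<in>grid n n. cmod (u q p) * K + cmod (v q p) * K) \<le> c * K"
    using mult_right_mono[OF c K] by (simp add: sum_distrib_right distrib_right)
  ultimately have "bounded_series n r (c * K)
      (\<lambda>X. \<Sum>q\<in>grid n n. u q p * of_real (Re (G X q)) + v q p * of_real (Im (G X q)))"
    by (rule bounded_series_mono)
  then show ?thesis by (simp add: combination_def mult.commute)
qed

lemma bounded_series_sum_const:
  assumes "0 < r" "\<And>k. k < n \<Longrightarrow> bounded_series m r K (f k)"
  shows "bounded_series m r (of_nat n * K) (\<lambda>X. \<Sum>k<n. f k X)"
  using bounded_series_sum[OF assms(1), of "{..<n}" m "\<lambda>_. K" f] assms(2) by simp

text \<open>In the factor of \<open>d\<close>, the part 2 n r stems from the two single sums with X,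
  the part 2 n^2 (a + r) \<rho> from the two double sums. Both tend to 0 with r and \<rho>, which
  produces the contraction.\<close>

lemma bounded_series_remainder_diff:
  assumes r: "0 < r" and A: "\<And>q. q \<in> grid n n \<Longrightarrow> cmod (A $$ q) \<le> a"
    and D: "\<And>q. q \<in> grid n n \<Longrightarrow> bounded_series n r d (\<lambda>X. D X q)"
    and Y: "\<And>q. q \<in> grid n n \<Longrightarrow> bounded_series n r \<rho> (\<lambda>X. Y X q)"
    and Y': "\<And>q. q \<in> grid n n \<Longrightarrow> bounded_series n r \<rho> (\<lambda>X. Y' X q)"
    and q: "q \<in> grid n n"
  shows "bounded_series n r (d * (2 * real n * r + 2 * (real n)\<^sup>2 * (a + r) * \<rho>))
    (\<lambda>X. remainder_diff n A X (Y X) (Y' X) (D X) q)"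
proof -
  obtain i j where ij: "q = (i, j)" "i < n" "j < n" using q by auto
  have AX: "bounded_series n r (a + r) (\<lambda>X. A $$ (k, l) + X $$ (k, l))" if "k < n" "l < n" for k l
  proof (rule bounded_series_add[OF r])
    show "bounded_series n r a (\<lambda>X. A $$ (k, l))"
      using bounded_series_const[OF r] A[of "(k, l)"] that by (auto intro: bounded_series_mono)
    show "bounded_series n r r (\<lambda>X. X $$ (k, l))" using that by (intro bounded_series_entry[OF r]) auto
  qed
  have "bounded_series n r (n * (d * r) + n * (r * d) + n * (n * (d * (a + r) * \<rho> + \<rho> * (a + r) * d)))
    (\<lambda>X. (\<Sum>k<n. cnj (D X (k, i)) * X $$ (k, j)) + (\<Sum>k<n. X $$ (i, k) * D X (k, j)) +
     (\<Sum>k<n. \<Sum>l<n. cnj (D X (k, i)) * (A $$ (k, l) + X $$ (k, l)) * Y' X (l, j) +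
       cnj (Y X (k, i)) * (A $$ (k, l) + X $$ (k, l)) * D X (l, j)))"
    using ij
    by (intro bounded_series_add[OF r] bounded_series_sum_const[OF r] bounded_series_mult[OF r]
        bounded_series_cnj[OF r] bounded_series_entry[OF r] AX D Y Y') auto
  moreover have "n * (d * r) + n * (r * d) + n * (n * (d * (a + r) * \<rho> + \<rho> * (a + r) * d)) =
      d * (2 * real n * r + 2 * (real n)\<^sup>2 * (a + r) * \<rho>)"
    by (simp add: algebra_simps power2_eq_square)
  ultimately show ?thesis by (simp add: remainder_diff_def ij)
qed

text \<open>The equation is solved by iteration; the coefficient norms of the differences of successive
  iterates decrease geometrically.\<close>

lemma fixed_point_series:
  fixes n :: nat and A :: "complex mat" and u v :: "nat \<times> nat \<Rightarrow> entries"
  assumes \<epsilon>: "0 < \<epsilon>"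
  obtains r Y where "0 < r" "\<And>p. p \<in> grid n n \<Longrightarrow> bounded_series n r \<epsilon> (\<lambda>X. Y X p)"
    "\<And>X p. \<lbrakk>X \<in> origin_ball n r; p \<in> grid n n\<rbrakk> \<Longrightarrow>
      Y X p = combination n u v (remainder n A X (Y X)) p"
    "\<And>p. p \<in> grid n n \<Longrightarrow> Y (0\<^sub>m n n) p = 0"
proof -
  let ?P = "grid n n"
  define a where "a = (\<Sum>q\<in>?P. cmod (A $$ q))"
  define c where "c = (\<Sum>p\<in>?P. \<Sum>q\<in>?P. cmod (u q p) + cmod (v q p))"
  have a: "cmod (A $$ q) \<le> a" if "q \<in> ?P" for q
    unfolding a_def using that by (intro member_le_sum) auto
  have c: "(\<Sum>q\<in>?P. cmod (u q p) + cmod (v q p)) \<le> c" if "p \<in> ?P" for p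
    unfolding c_def using that
    by (intro member_le_sum[of p ?P "\<lambda>p. \<Sum>q\<in>?P. cmod (u q p) + cmod (v q p)"] sum_nonneg) auto
  have ac: "0 \<le> a" "0 \<le> c" unfolding a_def c_def by (intro sum_nonneg add_nonneg_nonneg norm_ge_zero)+
  \<comment> \<open>Inserting \<rho> = 2 c r and a + r <= a + 1 into the Lipschitz constant of the
    iteration bounds it by r m.\<close>
  define m where "m = c * (2 * real n + 4 * (real n)\<^sup>2 * (a + 1) * c)"
  have m: "0 \<le> m" using ac by (simp add: m_def)
  \<comment> \<open>The three bounds ensure a + r <= a + 1, a contraction factor of at most 1/2, and
    \<rho> <= \<epsilon>.\<close>
  define r where "r = min 1 (min (1 / (2 * (1 + m))) (\<epsilon> / (2 * c + 1)))"
  have r: "0 < r" "r \<le> 1" using m ac \<epsilon> by (simp_all add: r_def)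
  have rm: "r * m \<le> 1 / 2"
  proof -
    have "r * m \<le> 1 / (2 * (1 + m)) * m" using m by (intro mult_right_mono) (simp_all add: r_def)
    also have "\<dots> \<le> 1 / 2" using m by (simp add: field_simps)
    finally show ?thesis .
  qed
  \<comment> \<open>The sum of a geometric series with ratio 1/2 and first term c r, a bound for the
    first iterate P X. It bounds all iterates.\<close>
  define \<rho> where "\<rho> = 2 * (c * r)"
  have \<rho>: "0 \<le> \<rho>" using ac r by (simp add: \<rho>_def)
  have \<rho>\<epsilon>: "\<rho> \<le> \<epsilon>"
  proof -
    have "\<rho> = r * (2 * c)" by (simp add: \<rho>_def)
    also have "\<dots> \<le> \<epsilon> / (2 * c + 1) * (2 * c)" using ac by (intro mult_right_mono) (simp_all add: r_def)
    also have "\<dots> \<le> \<epsilon>" using ac \<epsilon> by (simp add: field_simps)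
    finally show ?thesis .
  qed
  have contr: "c * (2 * real n * r + 2 * (real n)\<^sup>2 * (a + r) * \<rho>) \<le> 1 / 2"
  proof -
    have "2 * real n * r + 2 * (real n)\<^sup>2 * (a + r) * \<rho> = r * (2 * real n + 4 * (real n)\<^sup>2 * (a + r) * c)"
      by (simp add: \<rho>_def algebra_simps)
    also have "c * \<dots> \<le> c * (r * (2 * real n + 4 * (real n)\<^sup>2 * (a + 1) * c))"
      using r ac by (intro mult_left_mono add_left_mono mult_right_mono) auto
    also have "\<dots> = r * m" by (simp add: m_def)
    finally show ?thesis using rm by linarith
  qed
  define T where "T X Z = (\<lambda>p. combination n u v (remainder n A X Z) p)" for X Z
  define Z where "Z = rec_nat (\<lambda>X. \<lambda>_. 0) (\<lambda>_ Z X. T X (Z X))"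
  have Z: "Z 0 X = (\<lambda>_. 0)" "Z (Suc k) X = T X (Z k X)" for k X by (simp_all add: Z_def)
  define D where "D k X p = Z (Suc k) X p - Z k X p" for k X p
  have D_Suc: "D (Suc k) X p = combination n u v (remainder_diff n A X (Z k X) (Z (Suc k) X) (D k X)) p" for k X p
    unfolding D_def Z(2)[of "Suc k"] Z(2)[of k, symmetric] 
    by (subst (2) Z(2)) (simp add: T_def combination_diff remainder_diff)
  have bounds: "(\<forall>p\<in>?P. bounded_series n r (\<Sum>j<k. c * r * (1 / 2) ^ j) (\<lambda>X. Z k X p)) \<and>
      (\<forall>p\<in>?P. bounded_series n r (c * r * (1 / 2) ^ k) (\<lambda>X. D k X p))" for k
  proof (induction k)
    case 0
    have "bounded_series n r 0 (\<lambda>X. Z 0 X p)" for p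
      using bounded_series_const[OF r(1), of n 0] by (simp add: Z)
    moreover have "bounded_series n r (c * r) (\<lambda>X. D 0 X p)" if "p \<in> ?P" for p
    proof -
      have "bounded_series n r (c * r) (\<lambda>X. combination n u v (\<lambda>q. X $$ q) p)"
        using r c[OF that] by (intro bounded_series_combination bounded_series_entry) auto
      moreover have "D 0 X p = combination n u v (\<lambda>q. X $$ q) p" for X
        by (simp add: D_def Z T_def remainder_def case_prod_unfold)
      ultimately show ?thesis by simp
    qed
    ultimately show ?case by simp
  next
    case (Suc k)
    have Zk: "bounded_series n r (\<Sum>j<Suc k. c * r * (1 / 2) ^ j) (\<lambda>X. Z (Suc k) X p)" if "p \<in> ?P" for p
    proof -
      have "bounded_series n r ((\<Sum>j<k. c * r * (1 / 2) ^ j) + c * r * (1 / 2) ^ k) (\<lambda>X. Z k X p + D k X p)"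
        using Suc that by (intro bounded_series_add[OF r(1)]) auto
      then show ?thesis by (simp add: D_def)
    qed
    have le: "(\<Sum>j<k. c * r * (1 / 2) ^ j) \<le> \<rho>" for k
    proof -
      have "(\<Sum>j<k. (1 / 2 :: real) ^ j) = 2 - 2 * (1 / 2) ^ k" by (induction k) auto
      then have "(\<Sum>j<k. (1 / 2 :: real) ^ j) \<le> 2" by simp
      then have "c * r * (\<Sum>j<k. (1 / 2) ^ j) \<le> c * r * 2" using ac r by (intro mult_left_mono) auto
      then show ?thesis by (simp add: \<rho>_def sum_distrib_left mult_ac)
    qed
    have "bounded_series n r (c * (c * r * (1 / 2) ^ k * (2 * real n * r + 2 * (real n)\<^sup>2 * (a + r) * \<rho>)))
       (\<lambda>X. D (Suc k) X p)" if "p \<in> ?P" for p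
      unfolding D_Suc
    proof (rule bounded_series_combination[where c = c and u = u and v = v and p = p
          and G = "\<lambda>X. remainder_diff n A X (Z k X) (Z (Suc k) X) (D k X)", OF r(1)])
      show "bounded_series n r (c * r * (1 / 2) ^ k * (2 * real n * r + 2 * (real n)\<^sup>2 * (a + r) * \<rho>))
         (\<lambda>X. remainder_diff n A X (Z k X) (Z (Suc k) X) (D k X) q)" if "q \<in> ?P" for q
      proof (rule bounded_series_remainder_diff[OF r(1) a _ _ _ that])
        show "bounded_series n r \<rho> (\<lambda>X. Z k X q)" if "q \<in> ?P" for q
          using Suc that le by (blast intro: bounded_series_mono)
        show "bounded_series n r \<rho> (\<lambda>X. Z (Suc k) X q)" if "q \<in> ?P" for q
          using Zk[OF that] le by (rule bounded_series_mono)
      qed (use Suc in auto)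
      show "0 \<le> c * r * (1 / 2) ^ k * (2 * real n * r + 2 * (real n)\<^sup>2 * (a + r) * \<rho>)"
        using ac r \<rho> by simp
    qed (rule c[OF that])
    moreover have "c * (c * r * (1 / 2) ^ k * (2 * real n * r + 2 * (real n)\<^sup>2 * (a + r) * \<rho>)) \<le> c * r * (1 / 2) ^ Suc k"
    proof -
      have "c * (c * r * (1 / 2) ^ k * (2 * real n * r + 2 * (real n)\<^sup>2 * (a + r) * \<rho>)) =
          (c * r * (1 / 2) ^ k) * (c * (2 * real n * r + 2 * (real n)\<^sup>2 * (a + r) * \<rho>))" by (simp only: mult_ac)
      also have "\<dots> \<le> (c * r * (1 / 2) ^ k) * (1 / 2)"
        using contr ac r by (intro mult_left_mono) auto
      finally show ?thesis by simp
    qed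
    ultimately show ?case using Zk by (blast intro: bounded_series_mono)
  qed
  define Y where "Y X p = (\<Sum>k. D k X p)" for X p
  have geo: "((\<lambda>k. c * r * (1 / 2) ^ k) has_sum \<rho>) UNIV"
  proof (rule norm_summable_imp_has_sum)
    have "(\<lambda>k. (1 / 2 :: real) ^ k) sums 2" using geometric_sums[of "1 / 2 :: real"] by simp
    moreover have "c * r * 2 = \<rho>" by (simp add: \<rho>_def)
    ultimately show "(\<lambda>k. c * r * (1 / 2) ^ k) sums \<rho>" by (metis sums_mult)
    then show "summable (\<lambda>k. norm (c * r * (1 / 2) ^ k))"
      using ac r by (simp add: norm_mult norm_power sums_iff)
  qed
  have norm_sum: "summable (\<lambda>k. norm (D k X p))" if "X \<in> origin_ball n r" "p \<in> ?P" for X p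
  proof (rule summable_comparison_test)
    show "\<exists>N. \<forall>k\<ge>N. norm (norm (D k X p)) \<le> c * r * (1 / 2) ^ k"
    proof (intro exI[of _ 0] allI impI)
      fix k
      have "bounded_series n r (c * r * (1 / 2) ^ k) (\<lambda>X. D k X p)" using bspec[OF conjunct2[OF bounds[of k]] that(2)] .
      from bounded_series_norm_le[OF this that(1)] show "norm (norm (D k X p)) \<le> c * r * (1 / 2) ^ k" by simp
    qed
    show "summable (\<lambda>k. c * r * (1 / 2) ^ k)" using has_sum_imp_sums[OF geo] by (simp add: sums_iff)
  qed
  have hs: "((\<lambda>k. D k X p) has_sum Y X p) UNIV" if "X \<in> origin_ball n r" "p \<in> ?P" for X p
    unfolding Y_def
    by (rule norm_summable_imp_has_sum[OF norm_sum[OF that] summable_sums[OF summable_norm_cancel[OF norm_sum[OF that]]]])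
  have "bounded_series n r \<rho> (\<lambda>X. Y X p)" if "p \<in> ?P" for p
  proof (rule bounded_series_has_sum[OF r(1) _ geo])
    show "bounded_series n r (c * r * (1 / 2) ^ k) (\<lambda>X. D k X p)" for k
      using bspec[OF conjunct2[OF bounds[of k]] that] .
  qed (use hs that in auto)
  then have "bounded_series n r \<epsilon> (\<lambda>X. Y X p)" if "p \<in> ?P" for p
    using bounded_series_mono[OF _ \<rho>\<epsilon>] that by blast
  moreover have "Y X p = combination n u v (remainder n A X (Y X)) p"
    if X: "X \<in> origin_ball n r" and p: "p \<in> ?P" for X p
  proof -
    have lim: "(\<lambda>k. Z k X q) \<longlonglongrightarrow> Y X q" if "q \<in> ?P" for q
    proof -
      have "(\<Sum>j<k. D j X q) = Z k X q" for k
        unfolding D_def by (subst sum_lessThan_telescope) (simp add: Z)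
      then show ?thesis using has_sum_imp_sums[OF hs[OF X that]] by (simp add: sums_def)
    qed
    have "(\<lambda>k. remainder n A X (Z k X) q) \<longlonglongrightarrow> remainder n A X (Y X) q" if "q \<in> ?P" for q
    proof -
      obtain i j where ij: "q = (i, j)" "i < n" "j < n" using \<open>q \<in> ?P\<close> by auto
      show ?thesis unfolding remainder_def ij prod.case using ij
        by (intro tendsto_intros tendsto_cnj lim) auto
    qed
    then have "(\<lambda>k. combination n u v (remainder n A X (Z k X)) p) \<longlonglongrightarrow> combination n u v (remainder n A X (Y X)) p"
      unfolding combination_def by (intro tendsto_intros) auto
    then have "(\<lambda>k. Z (Suc k) X p) \<longlonglongrightarrow> combination n u v (remainder n A X (Y X)) p"
      by (simp add: Z T_def)
    moreover have "(\<lambda>k. Z (Suc k) X p) \<longlonglongrightarrow> Y X p" using lim[OF p] by (rule LIMSEQ_Suc)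
    ultimately show ?thesis by (rule LIMSEQ_unique[symmetric])
  qed
  \<comment> \<open>At X = 0 the remainder vanishes for Y = 0, so the iterates, which start at 0,
    all stay there. This gives S(0) = I.\<close>
  moreover have "Y (0\<^sub>m n n) p = 0" if "p \<in> ?P" for p
  proof -
    have "\<forall>q\<in>?P. Z k (0\<^sub>m n n) q = 0" for k
    proof (induction k)
      case (Suc k)
      then have "remainder n A (0\<^sub>m n n) (Z k (0\<^sub>m n n)) q = 0" if "q \<in> ?P" for q
        using that by (auto simp: remainder_def)
      then show ?case by (simp add: Z T_def combination_def)
    qed (simp add: Z)
    then have "D k (0\<^sub>m n n) p = 0" for k using that unfolding D_def by (metis diff_self)
    then show ?thesis by (simp add: Y_def)
  qed
  ultimately show ?thesis using that r(1) by blast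
qed

section \<open>Congruence by a matrix close to the identity\<close>

lemma mat_adjoint_entry:
  assumes "S \<in> carrier_mat n n" "i < n" "j < n"
  shows "mat_adjoint S $$ (i, j) = cnj (S $$ (j, i))"
  using assms unfolding mat_adjoint_def by (simp add: mat_of_rows_index conjugate_complex_def)

lemma mat_adjoint_carrier: "S \<in> carrier_mat n n \<Longrightarrow> mat_adjoint S \<in> carrier_mat n n"
  unfolding mat_adjoint_def by auto

lemma congruence_entry:
  assumes S: "S \<in> carrier_mat n n" and A: "A \<in> carrier_mat n n" and X: "X \<in> carrier_mat n n"
    and ij: "i < n" "j < n"
  shows "(mat_adjoint S * (A + X) * S) $$ (i, j) =
    (\<Sum>l<n. (\<Sum>k<n. cnj (S $$ (k, i)) * (A $$ (k, l) + X $$ (k, l))) * S $$ (l, j))"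
proof -
  have "(mat_adjoint S * (A + X)) $$ (i, l) = (\<Sum>k<n. cnj (S $$ (k, i)) * (A $$ (k, l) + X $$ (k, l)))"
    if "l < n" for l
    using S A X ij that mat_adjoint_carrier[OF S]
    by (simp add: scalar_prod_def mat_adjoint_entry[OF S] atLeast0LessThan)
  then show ?thesis using S A X ij mat_adjoint_carrier[OF S]
    by (subst index_mult_mat) (simp_all add: scalar_prod_def atLeast0LessThan)
qed

lemma congruence_expand:
  assumes A: "A \<in> carrier_mat n n" and X: "X \<in> carrier_mat n n" and S: "S \<in> carrier_mat n n"
    and Y: "\<And>i j. \<lbrakk>i < n; j < n\<rbrakk> \<Longrightarrow> S $$ (i, j) = (if i = j then 1 else 0) + Y (i, j)"
    and ij: "i < n" "j < n"
  shows "(mat_adjoint S * (A + X) * S) $$ (i, j) =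
    A $$ (i, j) + (remainder n A X Y (i, j) + star_tangent n A Y (i, j))"
proof -
  let ?B = "\<lambda>k l. A $$ (k, l) + X $$ (k, l)"
  have row: "(\<Sum>k<n. cnj (S $$ (k, i)) * ?B k l) = ?B i l + (\<Sum>k<n. cnj (Y (k, i)) * ?B k l)" for l
  proof -
    have "(\<Sum>k<n. cnj (S $$ (k, i)) * ?B k l) =
        (\<Sum>k<n. (if k = i then ?B k l else 0) + cnj (Y (k, i)) * ?B k l)"
      using Y ij by (intro sum.cong) (auto simp: algebra_simps)
    then show ?thesis using ij by (simp add: sum.distrib)
  qed
  have col: "(\<Sum>l<n. f l * S $$ (l, j)) = f j + (\<Sum>l<n. f l * Y (l, j))" for f
  proof -
    have "(\<Sum>l<n. f l * S $$ (l, j)) = (\<Sum>l<n. (if l = j then f l else 0) + f l * Y (l, j))"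
      using Y ij by (intro sum.cong) (auto simp: algebra_simps)
    then show ?thesis using ij by (simp add: sum.distrib)
  qed
  have dbl: "(\<Sum>l<n. (\<Sum>k<n. cnj (Y (k, i)) * ?B k l) * Y (l, j)) =
      (\<Sum>k<n. \<Sum>l<n. cnj (Y (k, i)) * ?B k l * Y (l, j))"
    by (simp add: sum_distrib_right) (rule sum.swap)
  show ?thesis
    unfolding congruence_entry[OF S A X ij] row col
    by (simp add: distrib_right sum.distrib dbl)
       (simp add: remainder_def star_tangent_def algebra_simps sum.distrib)
qed

text \<open>If v is in the kernel, its entry of largest modulus M satisfies M <= n \<epsilon> M,
  which is impossible for v different from 0.\<close>

lemma invertible_near_identity:
  assumes S: "S \<in> carrier_mat n n"
    and Y: "\<And>i j. \<lbrakk>i < n; j < n\<rbrakk> \<Longrightarrow> S $$ (i, j) = (if i = j then 1 else 0) + Y (i, j)"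
    and small: "\<And>i j. \<lbrakk>i < n; j < n\<rbrakk> \<Longrightarrow> cmod (Y (i, j)) \<le> \<epsilon>" and \<epsilon>: "n * \<epsilon> < 1"
  shows "invertible_mat S"
proof -
  have "v = 0\<^sub>v n" if v: "v \<in> carrier_vec n" "S *\<^sub>v v = 0\<^sub>v n" for v
  proof (rule ccontr)
    assume "v \<noteq> 0\<^sub>v n"
    then obtain k where k: "k < n" "v $ k \<noteq> 0" using v(1) by (metis carrier_vecD eq_vecI index_zero_vec)
    define M where "M = Max ((\<lambda>i. cmod (v $ i)) ` {..<n})"
    have "M \<in> (\<lambda>i. cmod (v $ i)) ` {..<n}" unfolding M_def using k(1) by (intro Max_in) auto
    then obtain i where i: "i < n" "M = cmod (v $ i)" by auto
    have M: "cmod (v $ l) \<le> M" if "l < n" for l unfolding M_def using that by (intro Max_ge) auto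
    have M0: "0 < M" using M[OF k(1)] k(2) by (meson less_le_trans zero_less_norm_iff)
    have "(S *\<^sub>v v) $ i = 0" using v(2) i by simp
    then have "0 = (\<Sum>l<n. S $$ (i, l) * v $ l)"
      using v(1) S i by (simp add: scalar_prod_def atLeast0LessThan)
    also have "\<dots> = (\<Sum>l<n. (if l = i then v $ l else 0) + Y (i, l) * v $ l)"
      using Y i by (intro sum.cong) (auto simp: algebra_simps)
    also have "\<dots> = v $ i + (\<Sum>l<n. Y (i, l) * v $ l)" using i by (simp add: sum.distrib)
    finally have "M = cmod (\<Sum>l<n. Y (i, l) * v $ l)"
      using i(2) by (metis add_eq_0_iff norm_minus_cancel)
    also have "\<dots> \<le> (\<Sum>l<n. \<epsilon> * M)"
      by (rule order_trans[OF norm_sum sum_mono])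
         (use small i M in \<open>auto simp: norm_mult intro!: mult_mono intro: order_trans[OF norm_ge_zero small]\<close>)
    also have "\<dots> = n * \<epsilon> * M" by simp
    also have "\<dots> < 1 * M" using \<epsilon> M0 by (intro mult_strict_right_mono)
    finally show False by simp
  qed
  then have "det S \<noteq> 0" using det_0_iff_vec_prod_zero[OF S] by blast
  from det_non_zero_imp_unit[OF S this, of "()"] obtain B where
    "B \<in> carrier_mat n n" "B * S = 1\<^sub>m n" "S * B = 1\<^sub>m n"
    unfolding Units_def ring_mat_def by auto
  then show ?thesis using S unfolding invertible_mat_def inverts_mat_def by auto
qed

lemma symbol_values_0: "0 \<in> symbol_values s"
  by (cases s) auto

lemma symbol_values_add: "\<lbrakk>z \<in> symbol_values s; w \<in> symbol_values s\<rbrakk> \<Longrightarrow> z + w \<in> symbol_values s"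
  by (cases s) auto

lemma symbol_values_scale: "z \<in> symbol_values s \<Longrightarrow> of_real c * z \<in> symbol_values s"
  by (cases s) auto

lemma symbol_values_sum: "(\<And>q. q \<in> N \<Longrightarrow> f q \<in> symbol_values s) \<Longrightarrow> sum f N \<in> symbol_values s"
  by (induction N rule: infinite_finite_induct) (auto intro: symbol_values_0 symbol_values_add)

text \<open>Real coefficients pass through the conjugation in the tangent map; complex ones would
  not.\<close>

lemma star_tangent_sum:
  "star_tangent n A (\<lambda>p. \<Sum>q\<in>N. of_real (a q) * u q p + of_real (b q) * v q p) p =
    (\<Sum>q\<in>N. of_real (a q) * star_tangent n A (u q) p + of_real (b q) * star_tangent n A (v q) p)"
proof -
  obtain i j where p: "p = (i, j)" by (cases p)
  have "(\<Sum>k<n. A $$ (k, j) * cnj (\<Sum>q\<in>N. of_real (a q) * u q (k, i) + of_real (b q) * v q (k, i))) =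
      (\<Sum>q\<in>N. \<Sum>k<n. of_real (a q) * (A $$ (k, j) * cnj (u q (k, i))) + of_real (b q) * (A $$ (k, j) * cnj (v q (k, i))))"
    by (subst sum.swap) (simp add: sum_distrib_left algebra_simps)
  moreover have "(\<Sum>k<n. A $$ (i, k) * (\<Sum>q\<in>N. of_real (a q) * u q (k, j) + of_real (b q) * v q (k, j))) =
      (\<Sum>q\<in>N. \<Sum>k<n. of_real (a q) * (A $$ (i, k) * u q (k, j)) + of_real (b q) * (A $$ (i, k) * v q (k, j)))"
    by (subst sum.swap) (simp add: sum_distrib_left algebra_simps)
  ultimately show ?thesis
    by (simp add: p star_tangent_def sum.distrib sum_distrib_left distrib_left)
qed

text \<open>The tangent map need not be injective, so corrections for 1 and i at each position are
  merely chosen and then extended real linearly. The fixed point Y of P composed with the remainder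
  then gives S = I + Y.\<close>

lemma reducing_map_exists:
  assumes A: "A \<in> carrier_mat n n" and D: "D \<in> carrier_mat n n"
    and solve: "\<And>B. \<exists>X. \<forall>p\<in>grid n n. B p - star_tangent n A X p \<in> symbol_values (D $$ p)"
  shows "\<exists>U S. reducing_map n A D U S"
proof -
  let ?P = "grid n n"
  have "\<exists>X. \<forall>p\<in>?P. (if p = q then z else 0) + star_tangent n A X p \<in> symbol_values (D $$ p)"
    for q z
  proof -
    obtain X where X: "\<forall>p\<in>?P. (if p = q then z else 0) - star_tangent n A X p \<in> symbol_values (D $$ p)"
      using solve[of "\<lambda>p. if p = q then z else 0"] by blast
    have "star_tangent n A (\<lambda>p. - X p) p = - star_tangent n A X p" for p
      by (cases p) (simp add: star_tangent_def sum_negf)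
    then show ?thesis using X by (intro exI[of _ "\<lambda>p. - X p"]) simp
  qed
  then obtain w where w: "\<And>q z p. p \<in> ?P \<Longrightarrow>
      (if p = q then z else 0) + star_tangent n A (w q z) p \<in> symbol_values (D $$ p)" by metis
  \<comment> \<open>This is the defining property of P. It passes from the units to an arbitrary
    \<open>G\<close> because symbol values are closed under real linear combinations.\<close>
  have comb: "G p + star_tangent n A (combination n (\<lambda>q. w q 1) (\<lambda>q. w q \<i>) G) p \<in> symbol_values (D $$ p)"
    if p: "p \<in> ?P" for G p
  proof -
    have "G p = (\<Sum>q\<in>?P. of_real (Re (G q)) * (if p = q then 1 else 0) + of_real (Im (G q)) * (if p = q then \<i> else 0))"
    proof -
      have "(\<Sum>q\<in>?P. of_real (Re (G q)) * (if p = q then 1 else 0) + of_real (Im (G q)) * (if p = q then \<i> else 0)) =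
          (\<Sum>q\<in>?P. if p = q then G q else 0)"
        by (intro sum.cong) (auto simp: complex_eq_iff)
      then show ?thesis using p by (simp add: sum.delta)
    qed
    then have "G p + star_tangent n A (combination n (\<lambda>q. w q 1) (\<lambda>q. w q \<i>) G) p =
       (\<Sum>q\<in>?P. of_real (Re (G q)) * ((if p = q then 1 else 0) + star_tangent n A (w q 1) p) +
          of_real (Im (G q)) * ((if p = q then \<i> else 0) + star_tangent n A (w q \<i>) p))"
      unfolding combination_def star_tangent_sum by (simp add: sum.distrib distrib_left)
    also have "\<dots> \<in> symbol_values (D $$ p)"
      by (intro symbol_values_sum symbol_values_add symbol_values_scale w p)
    finally show ?thesis .
  qed
  \<comment> \<open>Chosen so that n \<epsilon> < 1, which keeps S invertible on the whole
    ball.\<close>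
  define \<epsilon> :: real where "\<epsilon> = 1 / (n + 1)"
  have \<epsilon>: "0 < \<epsilon>" "n * \<epsilon> < 1" by (simp_all add: \<epsilon>_def field_simps)
  obtain r Y where r: "0 < r" and Y: "\<And>p. p \<in> ?P \<Longrightarrow> bounded_series n r \<epsilon> (\<lambda>X. Y X p)"
    "\<And>X p. \<lbrakk>X \<in> origin_ball n r; p \<in> ?P\<rbrakk> \<Longrightarrow>
      Y X p = combination n (\<lambda>q. w q 1) (\<lambda>q. w q \<i>) (remainder n A X (Y X)) p"
    "\<And>p. p \<in> ?P \<Longrightarrow> Y (0\<^sub>m n n) p = 0"
    using fixed_point_series[OF \<epsilon>(1), where n = n and A = A and u = "\<lambda>q. w q 1" and v = "\<lambda>q. w q \<i>"] by blast
  define U where "U = origin_ball n r"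
  define S where "S X = mat n n (\<lambda>(i, j). (if i = j then 1 else 0) + Y X (i, j))" for X
  have Sc: "S X \<in> carrier_mat n n" for X by (simp add: S_def)
  have SY: "S X $$ (i, j) = (if i = j then 1 else 0) + Y X (i, j)" if "i < n" "j < n" for X i j
    using that by (simp add: S_def)
  have Uc: "X \<in> carrier_mat n n" if "X \<in> U" for X using that by (simp add: U_def mat_ball_def)
  have open_U: "open_mats n U"
    unfolding open_mats_def
  proof (intro conjI ballI)
    show "U \<subseteq> carrier_mat n n" using Uc by blast
    fix B assume B: "B \<in> U"
    obtain e where e: "0 < e" "\<And>q. q \<in> ?P \<Longrightarrow> cmod (B $$ q) + e \<le> r"
      using mat_ball_0_margin[OF r, of B n] B U_def by blast
    have "mat_ball n B e \<subseteq> U"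
    proof
      fix X assume X: "X \<in> mat_ball n B e"
      have "cmod (X $$ (i, j)) < r" if "i < n" "j < n" for i j
      proof -
        have "cmod (X $$ (i, j)) \<le> cmod (B $$ (i, j)) + cmod (X $$ (i, j) - B $$ (i, j))"
          using norm_triangle_ineq[of "B $$ (i, j)" "X $$ (i, j) - B $$ (i, j)"] by simp
        moreover have "cmod (X $$ (i, j) - B $$ (i, j)) < e" using X that by (simp add: mat_ball_def)
        moreover have "cmod (B $$ (i, j)) + e \<le> r" using e(2)[of "(i, j)"] that by simp
        ultimately show ?thesis by simp
      qed
      then show "X \<in> U" using X by (auto simp: U_def mat_ball_def)
    qed
    then show "\<exists>\<epsilon>>0. mat_ball n B \<epsilon> \<subseteq> U" using e(1) by blast
  qed
  have zero_U: "0\<^sub>m n n \<in> U" using r by (simp add: U_def mat_ball_def)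
  have S_series: "\<exists>K. bounded_series n r K (\<lambda>X. S X $$ (i, j))" if "i < n" "j < n" for i j
    unfolding SY[OF that]
    using bounded_series_add[OF r bounded_series_const[OF r] Y(1)[of "(i, j)"]] that by blast
  have inv: "invertible_mat (S X)" if "X \<in> U" for X
  proof (rule invertible_near_identity[OF Sc SY _ \<epsilon>(2)])
    show "cmod (Y X (i, j)) \<le> \<epsilon>" if "i < n" "j < n" for i j
      using bounded_series_norm_le[OF Y(1)[of "(i, j)"]] \<open>X \<in> U\<close> that by (simp add: U_def)
  qed
  have in_D: "mat_adjoint (S X) * (A + X) * S X \<in> (\<lambda>M. A + M) ` symbol_space D" if X: "X \<in> U" for X
  proof
    define M where "M = mat n n (\<lambda>p. remainder n A X (Y X) p + star_tangent n A (Y X) p)"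
    \<comment> \<open>The fixed point equation is known on the grid only, but the tangent map reads
      no other entries.\<close>
    have Y_eq: "star_tangent n A (Y X) p =
        star_tangent n A (combination n (\<lambda>q. w q 1) (\<lambda>q. w q \<i>) (remainder n A X (Y X))) p" if "p \<in> ?P" for p
      using that Y(2)[of X] X unfolding star_tangent_def U_def by (auto intro!: arg_cong2[where f = "(+)"] sum.cong)
    show "M \<in> symbol_space D"
      using D comb Y_eq by (auto simp: symbol_space_def M_def)
    show "mat_adjoint (S X) * (A + X) * S X = A + M"
    proof (rule eq_matI)
      show "(mat_adjoint (S X) * (A + X) * S X) $$ (i, j) = (A + M) $$ (i, j)"
        if "i < dim_row (A + M)" "j < dim_col (A + M)" for i j
        using that A congruence_expand[OF A Uc[OF X] Sc SY, of i j X] by (simp add: M_def)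
    qed (use A Sc[of X] mat_adjoint_carrier[OF Sc[of X]] in \<open>auto simp: M_def\<close>)
  qed
  have prod_series: "\<exists>K. bounded_series n r K (\<lambda>X. (mat_adjoint (S X) * (A + X) * S X) $$ (i, j))"
    if ij: "i < n" "j < n" for i j
  proof -
    obtain K where K: "\<And>i j. \<lbrakk>i < n; j < n\<rbrakk> \<Longrightarrow> bounded_series n r (K i j) (\<lambda>X. S X $$ (i, j))"
      using S_series by metis
    have "bounded_series n r (\<Sum>l<n. (\<Sum>k<n. K k i * (cmod (A $$ (k, l)) + r)) * K l j)
       (\<lambda>X. \<Sum>l<n. (\<Sum>k<n. cnj (S X $$ (k, i)) * (A $$ (k, l) + X $$ (k, l))) * S X $$ (l, j))"
      using ij by (intro bounded_series_sum[OF r] bounded_series_mult[OF r] bounded_series_cnj[OF r]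
          bounded_series_add[OF r] bounded_series_const[OF r] bounded_series_entry[OF r] K) auto
    also have "?this \<longleftrightarrow> bounded_series n r (\<Sum>l<n. (\<Sum>k<n. K k i * (cmod (A $$ (k, l)) + r)) * K l j)
       (\<lambda>X. (mat_adjoint (S X) * (A + X) * S X) $$ (i, j))"
      using congruence_entry[OF Sc A Uc ij] by (intro bounded_series_cong) (simp add: U_def)
    finally show ?thesis by blast
  qed
  have "reducing_map n A D U S"
    unfolding reducing_map_def analytic_mat_fun_def
  proof (intro conjI allI impI ballI)
    show "S ` U \<subseteq> carrier_mat n n" using Sc by blast
    show "entry_analytic_at n (\<lambda>X. S X $$ (i, j)) B" if "i < n" "j < n" "B \<in> U" for i j B
      using S_series[OF that(1,2)] bounded_series_analytic[OF r] that(3) unfolding U_def by blast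
    show "entry_analytic_at n (\<lambda>X. (mat_adjoint (S X) * (A + X) * S X) $$ (i, j)) B"
      if "i < n" "j < n" "B \<in> U" for i j B
      using prod_series[OF that(1,2)] bounded_series_analytic[OF r] that(3) unfolding U_def by blast
    show "S (0\<^sub>m n n) = 1\<^sub>m n" by (rule eq_matI) (use Y(3) in \<open>auto simp: S_def\<close>)
  qed (use open_U zero_U inv in_D in auto)
  then show ?thesis by blast
qed

section \<open>Reducing maps give a spanning condition\<close>

lemma symbol_values_limit:
  assumes "(f \<longlongrightarrow> z) F" "F \<noteq> bot" "eventually (\<lambda>t. f t \<in> symbol_values s) F"
  shows "z \<in> symbol_values s"
proof -
  have Im: "Im z = 0" if "eventually (\<lambda>t. Im (f t) = 0) F"
    using tendsto_unique[OF assms(2) tendsto_Im[OF assms(1)] tendsto_eventually[OF that]] .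
  have Re: "Re z = 0" if "eventually (\<lambda>t. Re (f t) = 0) F"
    using tendsto_unique[OF assms(2) tendsto_Re[OF assms(1)] tendsto_eventually[OF that]] .
  have Im': "Im z = 0" if "s = Zero \<or> s = Circ"
    using that by (intro Im eventually_mono[OF assms(3)]) (auto simp: complex_is_Real_iff)
  have Re': "Re z = 0" if "s = Zero \<or> s = Bullet"
    using that by (intro Re eventually_mono[OF assms(3)]) auto
  show ?thesis
    using Im' Re' by (cases s) (auto simp: complex_is_Real_iff complex_eq_iff)
qed

text \<open>Along t B the series is a sum of terms g t^deg. Degree 0 is the value at 0, degree 1
  gives the derivative L, and each term of degree at least 2 is at most (t / \<tau>)^2 times its
  modulus at t = \<tau>. So the error of the difference quotient is of order t.\<close>

lemma entry_analytic_ray_derivative: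
  assumes f: "entry_analytic_at n f (0\<^sub>m n n)" and B: "B \<in> carrier_mat n n"
  shows "\<exists>L. ((\<lambda>t. (f (of_real t \<cdot>\<^sub>m B) - f (0\<^sub>m n n)) / of_real t) \<longlongrightarrow> L) (at_right 0)"
proof -
  let ?P = "grid n n"
  obtain c \<epsilon> where \<epsilon>: "0 < \<epsilon>" and c: "\<And>X. X \<in> origin_ball n \<epsilon> \<Longrightarrow>
      ((\<lambda>(\<alpha>, \<beta>). c \<alpha> \<beta> * entry_monomial n \<alpha> \<beta> (X - 0\<^sub>m n n)) has_sum f X) (exponents n \<times> exponents n)"
    using f unfolding entry_analytic_at_def by blast
  define b where "b = (\<Sum>q\<in>?P. cmod (B $$ q))"
  have b: "cmod (B $$ q) \<le> b" if "q \<in> ?P" for q unfolding b_def using that by (intro member_le_sum) auto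
  have b0: "0 \<le> b" unfolding b_def by (intro sum_nonneg) simp
  \<comment> \<open>Small enough that the whole segment from 0 to \<tau> B lies in the polydisc of
    convergence.\<close>
  define \<tau> where "\<tau> = \<epsilon> / (1 + b)"
  have \<tau>: "0 < \<tau>" "\<tau> * b < \<epsilon>" using \<epsilon> b0 by (simp_all add: \<tau>_def field_simps)
  define deg :: "multi_index \<Rightarrow> nat"
    where "deg p = (\<Sum>q\<in>?P. fst p q + snd p q)" for p
  define g where "g p = c (fst p) (snd p) * monomial n p B" for p
  have in_ball: "of_real t \<cdot>\<^sub>m B \<in> origin_ball n \<epsilon>" if "0 \<le> t" "t \<le> \<tau>" for t
  proof -
    have "t * cmod (B $$ (i, j)) < \<epsilon>" if "i < n" "j < n" for i j
    proof -
      have "t * cmod (B $$ (i, j)) \<le> \<tau> * b"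
        using b[of "(i, j)"] that \<open>0 \<le> t\<close> \<open>t \<le> \<tau>\<close> \<tau>(1) by (intro mult_mono) auto
      then show ?thesis using \<tau>(2) by simp
    qed
    then show ?thesis using B \<open>0 \<le> t\<close> by (auto simp: mat_ball_def norm_mult)
  qed
  have mono: "monomial n p (of_real t \<cdot>\<^sub>m B) = of_real t ^ deg p * monomial n p B" for p t
  proof -
    have "monomial n p (of_real t \<cdot>\<^sub>m B) =
        (\<Prod>q\<in>?P. of_real t ^ (fst p q + snd p q) * ((B $$ q) ^ fst p q * cnj (B $$ q) ^ snd p q))"
      unfolding entry_monomial_def using B
      by (intro prod.cong) (auto simp: power_mult_distrib power_add)
    also have "\<dots> = of_real t ^ deg p * monomial n p B"
      unfolding deg_def power_sum entry_monomial_def by (rule prod.distrib)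
    finally show ?thesis .
  qed
  have sum_f: "((\<lambda>p. g p * of_real t ^ deg p) has_sum f (of_real t \<cdot>\<^sub>m B)) (index_set n)" if "0 \<le> t" "t \<le> \<tau>" for t
  proof -
    have "of_real t \<cdot>\<^sub>m B - 0\<^sub>m n n = of_real t \<cdot>\<^sub>m B" using B by (intro eq_matI) auto
    then show ?thesis
      using c[OF in_ball[OF that]] by (simp add: index_set_def case_prod_unfold mono g_def mult_ac)
  qed
  have zero: "of_real 0 \<cdot>\<^sub>m B = 0\<^sub>m n n" using B by (intro eq_matI) auto
  define G where "G = (\<Sum>\<^sub>\<infinity>p\<in>index_set n. cmod (g p * of_real \<tau> ^ deg p))"
  \<comment> \<open>For complex families unconditional summability is absolute, so the series at
    \<tau> supplies a majorant.\<close>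
  have abs: "(\<lambda>p. cmod (g p * of_real \<tau> ^ deg p)) summable_on index_set n"
    by (rule iffD1[OF summable_on_iff_abs_summable_on_complex has_sum_imp_summable[OF sum_f[of \<tau>]]])
      (use \<tau>(1) in auto)
  define l where "l p = (if deg p = 1 then g p else 0)" for p
  have "(\<lambda>p. cmod (l p)) summable_on index_set n"
  proof (rule abs_summable_on_comparison_test')
    show "(\<lambda>p. cmod (g p * of_real \<tau> ^ deg p) / \<tau>) summable_on index_set n"
      using summable_on_cmult_left[OF abs, of "1 / \<tau>"] by simp
    show "norm (l p) \<le> cmod (g p * of_real \<tau> ^ deg p) / \<tau>" for p
      using \<tau>(1) by (simp add: l_def norm_mult)
  qed
  then have l: "(l has_sum infsum l (index_set n)) (index_set n)"
    by (rule has_sum_infsum[OF abs_summable_summable])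
  define L where "L = infsum l (index_set n)"
  have bound: "cmod ((f (of_real t \<cdot>\<^sub>m B) - f (0\<^sub>m n n)) / of_real t - L) \<le> t * (G / \<tau>\<^sup>2)"
    if t: "0 < t" "t \<le> \<tau>" for t
  proof -
    \<comment> \<open>\<open>of_real 0 ^ deg p\<close> is 1 in degree 0 and 0 otherwise, so
      \<open>h\<close> keeps exactly the terms of degree at least 2.\<close>
    define h where "h p = g p * of_real t ^ deg p + (- (g p * of_real 0 ^ deg p) + - (of_real t * l p))" for p
    have h: "(h has_sum (f (of_real t \<cdot>\<^sub>m B) + (- f (0\<^sub>m n n) + - (of_real t * L)))) (index_set n)"
      unfolding h_def L_def using t \<tau>(1) sum_f[of 0] zero
      by (intro has_sum_add sum_f has_sum_uminusI has_sum_cmult_right l) auto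
    have hb: "cmod (h p) \<le> cmod (g p * of_real \<tau> ^ deg p) * (t / \<tau>)\<^sup>2" for p
    proof -
      consider "deg p = 0" | "deg p = 1" | k where "deg p = Suc (Suc k)"
        by (metis One_nat_def not0_implies_Suc)
      then show ?thesis
      proof cases
        case 3
        have "t ^ deg p = t ^ k * t\<^sup>2" using 3 by (simp add: power2_eq_square)
        also have "\<dots> \<le> \<tau> ^ k * t\<^sup>2" using t by (intro mult_right_mono power_mono) auto
        also have "\<dots> = \<tau> ^ deg p * (t / \<tau>)\<^sup>2" using 3 \<tau>(1) by (simp add: power2_eq_square field_simps)
        finally have "cmod (g p) * t ^ deg p \<le> cmod (g p) * (\<tau> ^ deg p * (t / \<tau>)\<^sup>2)"
          by (intro mult_left_mono) auto
        then show ?thesis using 3 t \<tau>(1) by (simp add: h_def l_def norm_mult norm_power mult.assoc)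
      qed (use t in \<open>simp_all add: h_def l_def\<close>)
    qed
    have hs: "(\<lambda>p. cmod (g p * of_real \<tau> ^ deg p) * (t / \<tau>)\<^sup>2) summable_on index_set n"
      by (rule summable_on_cmult_left[OF abs])
    have h_abs: "h abs_summable_on index_set n" by (rule abs_summable_on_comparison_test'[OF hs hb])
    have "cmod (f (of_real t \<cdot>\<^sub>m B) + (- f (0\<^sub>m n n) + - (of_real t * L))) \<le> (\<Sum>\<^sub>\<infinity>p\<in>index_set n. cmod (h p))"
      using norm_infsum_bound[OF h_abs] infsumI[OF h] by simp
    also have "\<dots> \<le> (\<Sum>\<^sub>\<infinity>p\<in>index_set n. cmod (g p * of_real \<tau> ^ deg p) * (t / \<tau>)\<^sup>2)"
      by (rule infsum_mono[OF h_abs hs hb])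
    also have "\<dots> = G * (t / \<tau>)\<^sup>2" by (simp only: G_def infsum_cmult_left[OF abs])
    finally have *: "cmod (f (of_real t \<cdot>\<^sub>m B) - f (0\<^sub>m n n) - of_real t * L) \<le> G * (t / \<tau>)\<^sup>2"
      by (simp only: diff_conv_add_uminus add.assoc)
    have "(f (of_real t \<cdot>\<^sub>m B) - f (0\<^sub>m n n)) / of_real t - L =
        (f (of_real t \<cdot>\<^sub>m B) - f (0\<^sub>m n n) - of_real t * L) / of_real t" using t by (simp add: field_simps)
    then have "cmod ((f (of_real t \<cdot>\<^sub>m B) - f (0\<^sub>m n n)) / of_real t - L) =
        cmod (f (of_real t \<cdot>\<^sub>m B) - f (0\<^sub>m n n) - of_real t * L) / t" using t by (simp add: norm_divide)
    also have "\<dots> \<le> G * (t / \<tau>)\<^sup>2 / t" using * t by (intro divide_right_mono) auto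
    also have "\<dots> = t * (G / \<tau>\<^sup>2)" using t by (simp add: power2_eq_square)
    finally show ?thesis .
  qed
  have "((\<lambda>t. (f (of_real t \<cdot>\<^sub>m B) - f (0\<^sub>m n n)) / of_real t - L) \<longlongrightarrow> 0) (at_right 0)"
  proof (rule tendsto_0_le)
    show "((\<lambda>t :: real. t) \<longlongrightarrow> 0) (at_right 0)" by (rule tendsto_ident_at)
    show "eventually (\<lambda>t. norm ((f (of_real t \<cdot>\<^sub>m B) - f (0\<^sub>m n n)) / of_real t - L) \<le> norm t * (G / \<tau>\<^sup>2)) (at_right 0)"
      using bound \<tau>(1) by (auto simp: eventually_at_right_field intro!: exI[of _ \<tau>])
  qed
  then show ?thesis by (intro exI[of _ L]) (rule LIM_zero_cancel)
qed

text \<open>With S(t B) = I + t E(t), the reduced matrix differs from A by t Q(t), where Q(t) tends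
  to B plus the tangent vector of Y = lim E(t). Each symbol allows a closed real subspace of values,
  so neither division by t > 0 nor the limit leaves it.\<close>

lemma reducing_map_spans:
  assumes R: "reducing_map n A D U S" and A: "A \<in> carrier_mat n n" and D: "D \<in> carrier_mat n n"
    and B: "B \<in> carrier_mat n n"
  shows "\<exists>Y. \<forall>p\<in>grid n n. B $$ p + star_tangent n A Y p \<in> symbol_values (D $$ p)"
proof -
  have U: "open_mats n U" "0\<^sub>m n n \<in> U" "S ` U \<subseteq> carrier_mat n n" "analytic_mat_fun n S U"
    "S (0\<^sub>m n n) = 1\<^sub>m n" "\<And>X. X \<in> U \<Longrightarrow> mat_adjoint (S X) * (A + X) * S X \<in> (\<lambda>M. A + M) ` symbol_space D"
    using R unfolding reducing_map_def by auto
  obtain \<epsilon> where \<epsilon>: "0 < \<epsilon>" "origin_ball n \<epsilon> \<subseteq> U" using U(1,2) unfolding open_mats_def by blast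
  define tB where "tB t = of_real t \<cdot>\<^sub>m B" for t :: real
  have tBc: "tB t \<in> carrier_mat n n" for t using B by (simp add: tB_def)
  have in_U: "eventually (\<lambda>t. tB t \<in> U) (at_right 0)"
  proof -
    have "((\<lambda>t :: real. cmod (of_real t * B $$ q)) \<longlongrightarrow> cmod (of_real 0 * B $$ q)) (at_right 0)" for q
      by (intro tendsto_intros)
    then have "eventually (\<lambda>t. cmod (of_real t * B $$ q) < \<epsilon>) (at_right 0)" for q
      using \<epsilon>(1) by (intro order_tendstoD(2)) auto
    then have "eventually (\<lambda>t. \<forall>q\<in>grid n n. cmod (of_real t * B $$ q) < \<epsilon>) (at_right 0)"
      by (simp add: eventually_ball_finite_distrib)
    then show ?thesis
    proof (rule eventually_mono)
      fix t assume "\<forall>q\<in>grid n n. cmod (of_real t * B $$ q) < \<epsilon>"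
      then have "tB t \<in> origin_ball n \<epsilon>" using B by (auto simp: mat_ball_def tB_def)
      then show "tB t \<in> U" using \<epsilon>(2) by blast
    qed
  qed
  define E where "E t = (\<lambda>(i, j). (S (tB t) $$ (i, j) - (if i = j then 1 else 0)) / of_real t)" for t
  have "\<exists>L. ((\<lambda>t. E t p) \<longlongrightarrow> L) (at_right 0)" if p: "p \<in> grid n n" for p
  proof -
    obtain i j where ij: "p = (i, j)" "i < n" "j < n" using p by auto
    have "entry_analytic_at n (\<lambda>X. S X $$ (i, j)) (0\<^sub>m n n)"
      using U(2,4) ij unfolding analytic_mat_fun_def by blast
    from entry_analytic_ray_derivative[OF this B] show ?thesis
      using U(5) ij by (simp add: E_def tB_def)
  qed
  then obtain Y where Y: "\<And>p. p \<in> grid n n \<Longrightarrow> ((\<lambda>t. E t p) \<longlongrightarrow> Y p) (at_right 0)" by metis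
  have "B $$ (i, j) + star_tangent n A Y (i, j) \<in> symbol_values (D $$ (i, j))" if ij: "i < n" "j < n" for i j
  proof -
    \<comment> \<open>The increment divided by t, expanded in such a way that the surviving factors
      t are visible and the limit can be taken termwise.\<close>
    define Q where "Q t = B $$ (i, j) + (\<Sum>k<n. of_real t * cnj (E t (k, i)) * B $$ (k, j)) +
       (\<Sum>k<n. B $$ (i, k) * (of_real t * E t (k, j))) +
       (\<Sum>k<n. \<Sum>l<n. cnj (E t (k, i)) * (A $$ (k, l) + of_real t * B $$ (k, l)) * (of_real t * E t (l, j))) +
       star_tangent n A (E t) (i, j)" for t
    have "(Q \<longlongrightarrow> B $$ (i, j) + (\<Sum>k<n. of_real 0 * cnj (Y (k, i)) * B $$ (k, j)) +
       (\<Sum>k<n. B $$ (i, k) * (of_real 0 * Y (k, j))) +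
       (\<Sum>k<n. \<Sum>l<n. cnj (Y (k, i)) * (A $$ (k, l) + of_real 0 * B $$ (k, l)) * (of_real 0 * Y (l, j))) +
       star_tangent n A Y (i, j)) (at_right 0)"
      unfolding Q_def star_tangent_def prod.case using ij
      by (intro tendsto_intros tendsto_cnj Y) auto
    then have lim: "(Q \<longlongrightarrow> B $$ (i, j) + star_tangent n A Y (i, j)) (at_right 0)" by simp
    have "eventually (\<lambda>t. Q t \<in> symbol_values (D $$ (i, j))) (at_right 0)"
      using in_U eventually_at_right_less[of 0]
    proof eventually_elim
      case (elim t)
      have Sc: "S (tB t) \<in> carrier_mat n n" using U(3) elim(1) by blast
      have SE: "S (tB t) $$ (i, j) = (if i = j then 1 else 0) + (\<lambda>p. of_real t * E t p) (i, j)" for i j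
        using elim(2) by (simp add: E_def)
      obtain M where M: "M \<in> symbol_space D" "mat_adjoint (S (tB t)) * (A + tB t) * S (tB t) = A + M"
        using U(6)[OF elim(1)] by blast
      have Mc: "M \<in> carrier_mat n n" using M(1) D by (simp add: symbol_space_def)
      have "M $$ (i, j) = remainder n A (tB t) (\<lambda>p. of_real t * E t p) (i, j) +
          star_tangent n A (\<lambda>p. of_real t * E t p) (i, j)"
        using congruence_expand[OF A tBc[of t] Sc SE ij] ij A Mc unfolding M(2) by simp
      also have "\<dots> = of_real t * Q t"
        using B ij by (simp add: Q_def remainder_def star_tangent_def tB_def sum_distrib_left algebra_simps)
      finally have "of_real (1 / t) * M $$ (i, j) = Q t" using elim(2) by simp
      moreover have "M $$ (i, j) \<in> symbol_values (D $$ (i, j))"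
        using M(1) D ij by (auto simp: symbol_space_def)
      ultimately show ?case using symbol_values_scale[of "M $$ (i, j)" _ "1 / t"] by simp
    qed
    then show ?thesis by (intro symbol_values_limit[OF lim]) auto
  qed
  then show ?thesis by (intro exI[of _ Y]) auto
qed

section \<open>The blocks of the associated matrix\<close>

fun summand_entry :: "summand \<Rightarrow> nat \<Rightarrow> nat \<Rightarrow> complex" where
  "summand_entry (HBlock m a) = H_entry m a"
| "summand_entry (DeltaBlock \<mu> n) = (\<lambda>i j. \<mu> * Delta_entry n \<i> i j)"
| "summand_entry (JBlock n) = jordan_entry 0"

fun valid_summand :: "summand \<Rightarrow> bool" where
  "valid_summand (HBlock m a) = (1 < cmod a)"
| "valid_summand (DeltaBlock \<mu> n) = (cmod \<mu> = 1)"
| "valid_summand (JBlock n) = True"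

lemma summand_dim_simps [simp]:
  "summand_dim (HBlock m a) = 2 * m" "summand_dim (DeltaBlock \<mu> n) = n" "summand_dim (JBlock n) = n"
  by (simp_all add: summand_dim_def H_mat_def Delta_mat_def)

lemma summand_mat_carrier: "summand_mat b \<in> carrier_mat (summand_dim b) (summand_dim b)"
  by (cases b) (auto simp: summand_dim_def H_mat_def Delta_mat_def)

lemma summand_mat_entry:
  assumes "i < summand_dim b" "j < summand_dim b"
  shows "summand_mat b $$ (i, j) = summand_entry b i j"
  using assms
  by (cases b) (auto simp: H_mat_def H_entry_def Delta_mat_def Delta_entry_def jordan_entry_def jordan_block_def)

text \<open>Only the existence of an inverse is used later, so a trivial kernel suffices and no
  formulas for the inverses of H and Delta are written down.\<close>

lemma inverse_entries_exists:
  assumes "\<And>v k. \<lbrakk>\<And>i. i < m \<Longrightarrow> (\<Sum>k<m. M i k * v k) = 0; k < m\<rbrakk> \<Longrightarrow> v k = 0"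
  shows "\<exists>M'. inverse_entries m M M'"
proof -
  define A where "A = mat m m (\<lambda>(i, j). M i j)"
  have A: "A \<in> carrier_mat m m" by (simp add: A_def)
  have "v = 0\<^sub>v m" if v: "v \<in> carrier_vec m" "A *\<^sub>v v = 0\<^sub>v m" for v
  proof (rule eq_vecI)
    fix k assume "k < dim_vec (0\<^sub>v m)"
    then have k: "k < m" by simp
    have "(\<Sum>l<m. M i l * v $ l) = 0" if "i < m" for i
    proof -
      have "(A *\<^sub>v v) $ i = 0" using v(2) that by simp
      then show ?thesis using that v(1) by (simp add: A_def scalar_prod_def atLeast0LessThan)
    qed
    then show "v $ k = 0\<^sub>v m $ k" using assms[of "\<lambda>l. v $ l" k] k by simp
  qed (use v in simp)
  then have "det A \<noteq> 0" using det_0_iff_vec_prod_zero[OF A] by blast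
  from det_non_zero_imp_unit[OF A this, of "()"] obtain B where
    B: "B \<in> carrier_mat m m" "B * A = 1\<^sub>m m" "A * B = 1\<^sub>m m"
    unfolding Units_def ring_mat_def by auto
  have "(\<Sum>k<m. M i k * B $$ (k, j)) = (if i = j then 1 else 0)"
    "(\<Sum>k<m. B $$ (i, k) * M k j) = (if i = j then 1 else 0)" if "i < m" "j < m" for i j
  proof -
    have "(A * B) $$ (i, j) = (if i = j then 1 else 0)" "(B * A) $$ (i, j) = (if i = j then 1 else 0)"
      using B that by auto
    then show "(\<Sum>k<m. M i k * B $$ (k, j)) = (if i = j then 1 else 0)"
      "(\<Sum>k<m. B $$ (i, k) * M k j) = (if i = j then 1 else 0)"
      using that B(1) by (simp_all add: A_def scalar_prod_def atLeast0LessThan)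
  qed
  then show ?thesis unfolding inverse_entries_def by (intro exI[of _ "\<lambda>i j. B $$ (i, j)"]) simp
qed

lemma inverse_entries_H:
  assumes "1 < cmod a"
  shows "\<exists>M'. inverse_entries (2 * m) (H_entry m a) M'"
proof (rule inverse_entries_exists)
  fix v :: "nat \<Rightarrow> complex" and k
  assume v: "\<And>i. i < 2 * m \<Longrightarrow> (\<Sum>k<2 * m. H_entry m a i k * v k) = 0" and k: "k < 2 * m"
  have a: "a \<noteq> 0" using assms by auto
  have high: "v (m + i) = 0" if "i < m" for i using v[of i] that by (simp add: H_row)
  have low: "v i = 0" if "i < m" for i
    using that
  proof (induction "m - i" arbitrary: i rule: less_induct)
    case less
    have "a * v i + (if i + 1 < m then v (i + 1) else 0) = 0"
      using v[of "m + i"] less.prems H_row[of "m + i" m a v] by (cases "i + 1 < m") simp_all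
    moreover have "v (i + 1) = 0" if "i + 1 < m" using that by (intro less.hyps) auto
    ultimately show ?case using a by (auto split: if_splits)
  qed
  show "v k = 0" using high[of "k - m"] low[of k] k by (cases "k < m") auto
qed

lemma inverse_entries_Delta:
  assumes "cmod \<mu> = 1"
  shows "\<exists>M'. inverse_entries n (\<lambda>i j. \<mu> * Delta_entry n \<i> i j) M'"
proof (rule inverse_entries_exists)
  fix v :: "nat \<Rightarrow> complex" and k
  assume v: "\<And>i. i < n \<Longrightarrow> (\<Sum>k<n. \<mu> * Delta_entry n \<i> i k * v k) = 0" and k: "k < n"
  have \<mu>: "\<mu> \<noteq> 0" using assms by auto
  have "v (n - 1 - i) = 0" if "i < n" for i
    using that
  proof (induction i)
    case 0
    then show ?case using v[of 0] Delta_scaled(1)[of 0 n \<mu> \<i> v] \<mu> by simp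
  next
    case (Suc i)
    have "n - Suc i = n - 1 - i" by simp
    then have "v (n - Suc i) = 0" using Suc by simp
    then show ?case using v[of "Suc i"] Delta_scaled(1)[of "Suc i" n \<mu> \<i> v] \<mu> Suc.prems by simp
  qed
  from this[of "n - 1 - k"] show "v k = 0" using k by simp
qed

section \<open>Admissible forms as patterns of value sets\<close>

lemma stars_index [simp]: "\<lbrakk>i < m; j < n\<rbrakk> \<Longrightarrow> stars m n P $$ (i, j) = (if P i j then Star else Zero)"
  by (simp add: stars_def)

lemma stars_dim [simp]: "dim_row (stars m n P) = m" "dim_col (stars m n P) = n"
  "stars m n P \<in> carrier_mat m n"
  by (simp_all add: stars_def)

lemma zeros_index [simp]: "\<lbrakk>i < m; j < n\<rbrakk> \<Longrightarrow> zeros m n $$ (i, j) = Zero"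
  by (simp add: zeros_def)

lemma zeros_dim [simp]: "dim_row (zeros m n) = m" "dim_col (zeros m n) = n"
  by (simp_all add: zeros_def)

lemma forms_carrier:
  "Q \<in> sw_forms n m \<Longrightarrow> Q \<in> carrier_mat n m" "Q \<in> ne_forms n m \<Longrightarrow> Q \<in> carrier_mat n m"
  by (auto simp: sw_forms_def ne_forms_def split: if_splits)

lemma sw_forms_pattern: "Q \<in> sw_forms n m \<Longrightarrow> sw_pattern n m (\<lambda>(i, j). symbol_values (Q $$ (i, j)))"
  by (auto simp: sw_forms_def sw_pattern_def split: if_splits)

lemma ne_forms_pattern: "Q \<in> ne_forms n m \<Longrightarrow> ne_pattern n m (\<lambda>(i, j). symbol_values (Q $$ (i, j)))"
  by (auto simp: ne_forms_def ne_pattern_def split: if_splits)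

lemma nw_forms_pattern: "Q \<in> nw_forms n m \<Longrightarrow> nw_pattern n m (\<lambda>e. symbol_values (Q $$ e))"
  by (auto simp: nw_forms_def nw_pattern_def split: if_splits)

lemma sw_pattern_cong:
  assumes "sw_pattern n m W" "\<And>i j. \<lbrakk>i < n; j < m\<rbrakk> \<Longrightarrow> W' (i, j) = W (i, j)"
  shows "sw_pattern n m W'"
  using assms unfolding sw_pattern_def by simp

lemma ne_pattern_cong:
  assumes "ne_pattern n m W" "\<And>i j. \<lbrakk>i < n; j < m\<rbrakk> \<Longrightarrow> W' (i, j) = W (i, j)"
  shows "ne_pattern n m W'"
  using assms unfolding ne_pattern_def by simp

lemma complements_diag:
  assumes b: "valid_summand b" and D: "D \<in> diag_forms b"
  shows "complements (tangent id (\<lambda>_. summand_dim b) (\<lambda>_. summand_entry b)) (positions id (\<lambda>_. summand_dim b))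
    (\<lambda>(u :: unit, i, j). symbol_values (D $$ (i, j)))"
proof (cases b)
  case (HBlock m a)
  then obtain Q where Q: "Q \<in> sw_forms m m" "D = four_block_mat (zeros m m) (zeros m m) Q (zeros m m)"
    using D by auto
  have Qc: "dim_row Q = m" "dim_col Q = m" using forms_carrier(1)[OF Q(1)] by auto
  have "complements (tangent id (\<lambda>_. 2 * m) (\<lambda>_. H_entry m a)) (positions id (\<lambda>_. 2 * m))
    (\<lambda>(u :: unit, i, j). symbol_values (D $$ (i, j)))"
  proof (rule complements_diag_H)
    show "1 < cmod a" using b HBlock by simp
    show "sw_pattern m m (\<lambda>(i, j). case ((), m + i, j) of (u, i, j) \<Rightarrow> symbol_values (D $$ (i, j)))"
      by (rule sw_pattern_cong[OF sw_forms_pattern[OF Q(1)]]) (simp add: Q(2) Qc)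
  qed (simp add: Q(2) Qc)
  then show ?thesis using HBlock by simp
next
  case (DeltaBlock \<mu> n)
  then have \<mu>: "cmod \<mu> = 1" using b by simp
  then have unit: "cnj \<mu> = 1 / \<mu>"
    by (metis complex_norm_square divide_eq_eq mult.commute norm_zero of_real_1 one_power2 zero_neq_one)
  \<comment> \<open>The middle entry is t w with w = 1 here and w = i for \<open>Bullet\<close>. The
    condition Im (w / mu) nonzero says that mu is not real in the first case and not purely
    imaginary in the second, in agreement with the cases of \<open>diag_forms\<close>.\<close>
  have Circ: "complements (tangent id (\<lambda>_. n) (\<lambda>_ i j. \<mu> * Delta_entry n \<i> i j)) (positions id (\<lambda>_. n))
      (\<lambda>(u :: unit, i, j). symbol_values (half_diag n Circ $$ (i, j)))" if "Im \<mu> \<noteq> 0"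
  proof (rule complements_diag_Delta[OF \<mu>, where w = 1])
    show "Im (1 / \<mu>) \<noteq> 0" unfolding unit[symmetric] using that by simp
    have "\<real> = range (\<lambda>t :: real. of_real t * (1 :: complex))" by (auto simp: Reals_def)
    then show "(case ((), i, j) of (u, i, j) \<Rightarrow> symbol_values (half_diag n Circ $$ (i, j))) =
        (if i = j then (if 2 * i + 1 < n then UNIV else if 2 * i + 1 = n then range (\<lambda>t :: real. of_real t * (1 :: complex))
         else {0}) else {0})" if "i < n" "j < n" for i j
      using that by (simp add: half_diag_def)
  qed
  have Bullet: "complements (tangent id (\<lambda>_. n) (\<lambda>_ i j. \<mu> * Delta_entry n \<i> i j)) (positions id (\<lambda>_. n))
      (\<lambda>(u :: unit, i, j). symbol_values (half_diag n Bullet $$ (i, j)))" if "Re \<mu> \<noteq> 0"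
  proof (rule complements_diag_Delta[OF \<mu>, where w = \<i>])
    have "\<i> / \<mu> = \<i> * cnj \<mu>" by (simp add: unit)
    then show "Im (\<i> / \<mu>) \<noteq> 0" using that by simp
    have "{z. Re z = 0} = range (\<lambda>t :: real. of_real t * \<i>)"
    proof
      show "{z. Re z = 0} \<subseteq> range (\<lambda>t :: real. of_real t * \<i>)"
      proof
        fix z assume "z \<in> {z. Re z = 0}"
        then have "z = of_real (Im z) * \<i>" by (simp add: complex_eq_iff)
        then show "z \<in> range (\<lambda>t :: real. of_real t * \<i>)" by blast
      qed
    qed auto
    then show "(case ((), i, j) of (u, i, j) \<Rightarrow> symbol_values (half_diag n Bullet $$ (i, j))) =
        (if i = j then (if 2 * i + 1 < n then UNIV else if 2 * i + 1 = n then range (\<lambda>t :: real. of_real t * \<i>)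
         else {0}) else {0})" if "i < n" "j < n" for i j
      using that by (simp add: half_diag_def)
  qed
  have "\<mu> \<noteq> 0" using \<mu> by auto
  then have "D = half_diag n Circ \<and> Im \<mu> \<noteq> 0 \<or> D = half_diag n Bullet \<and> Re \<mu> \<noteq> 0"
    using D DeltaBlock by (auto simp: complex_is_Real_iff complex_eq_iff split: if_splits)
  then show ?thesis using Circ Bullet DeltaBlock by auto
next
  case (JBlock n)
  define col where "col = (D = stars n n (\<lambda>i j. j = 0 \<and> even (n - (i + 1))))"
  have D': "D = stars n n (\<lambda>i j. if col then j = 0 \<and> even (n - 1 - i) else i + 1 = n \<and> even j)"
  proof -
    have D1: "D = stars n n (\<lambda>i j. j = 0 \<and> even (n - (i + 1))) \<or> D = stars n n (\<lambda>i j. i + 1 = n \<and> even j)"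
      using D JBlock by (auto simp: alt_forms_def)
    show ?thesis
    proof (cases col)
      case True
      then show ?thesis using col_def by simp
    next
      case False
      then show ?thesis using D1 by (simp add: col_def)
    qed
  qed
  have "complements (tangent id (\<lambda>_. n) (\<lambda>_. jordan_entry 0)) (positions id (\<lambda>_. n))
      (\<lambda>(u :: unit, i, j). symbol_values (D $$ (i, j)))"
    by (rule complements_jordan_zero[where col = "\<lambda>_. col"
          and star = "\<lambda>_ i j. if col then j = 0 \<and> even (n - 1 - i) else i + 1 = n \<and> even j"])
      (auto simp: D')
  then show ?thesis using JBlock by simp
qed

lemma complements_pair_jordan:
  assumes nm: "n \<le> m" and D: "(D1, D2) \<in> offdiag_forms (JBlock m) (JBlock n)"
  shows "complements (tangent Not (\<lambda>u. if u then n else m) (\<lambda>_. jordan_entry 0))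
    (positions Not (\<lambda>u. if u then n else m)) (\<lambda>(u, i, j). symbol_values ((if u then D1 else D2) $$ (i, j)))"
proof -
  have D2: "D2 \<in> alt_forms m n" using D by (auto split: if_splits)
  obtain Q where Q: "Q \<in> alt_forms n m" "D1 = (if even n then Q else star_union Q (P_mat n m))"
    using D by (auto split: if_splits)
  define c1 where "c1 = (Q = stars n m (\<lambda>i j. j = 0 \<and> even (n - (i + 1))))"
  \<comment> \<open>The conjunct \<open>n = m\<close> is essential: for n < m the block of size m x
    n must count as the row form, even if both formulas describe the same matrix, as for n =
    0.\<close>
  define c2 where "c2 = (n = m \<and> D2 = stars m n (\<lambda>i j. j = 0 \<and> even (m - (i + 1))))"
  have Q': "Q = stars n m (\<lambda>i j. if c1 then j = 0 \<and> even (n - 1 - i) else i + 1 = n \<and> even j)"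
    "\<not> c1 \<Longrightarrow> m \<le> n"
  proof -
    have Q1: "Q = stars n m (\<lambda>i j. j = 0 \<and> even (n - (i + 1))) \<or> m \<le> n \<and> Q = stars n m (\<lambda>i j. i + 1 = n \<and> even j)"
      using Q(1) nm by (auto simp: alt_forms_def split: if_splits)
    show "Q = stars n m (\<lambda>i j. if c1 then j = 0 \<and> even (n - 1 - i) else i + 1 = n \<and> even j)"
    proof (cases c1)
      case True
      then show ?thesis using c1_def by simp
    next
      case False
      then show ?thesis using Q1 by (simp add: c1_def)
    qed
    show "m \<le> n" if "\<not> c1" using Q1 that by (simp add: c1_def)
  qed
  have D2': "D2 = stars m n (\<lambda>i j. if c2 then j = 0 \<and> even (m - 1 - i) else i + 1 = m \<and> even j)"
  proof -
    have D21: "n = m \<and> D2 = stars m n (\<lambda>i j. j = 0 \<and> even (m - (i + 1))) \<or> D2 = stars m n (\<lambda>i j. i + 1 = m \<and> even j)"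
      using D2 nm by (auto simp: alt_forms_def split: if_splits)
    show ?thesis
    proof (cases c2)
      case True
      then show ?thesis using c2_def by simp
    next
      case False
      then have "D2 = stars m n (\<lambda>i j. i + 1 = m \<and> even j)" using D21 unfolding c2_def by blast
      then show ?thesis using False by simp
    qed
  qed
  have D1: "D1 $$ (i, j) = (if (if c1 then j = 0 \<and> even (n - 1 - i) else i + 1 = n \<and> even j) \<or>
      n < m \<and> odd n \<and> i + 1 = n \<and> n + 1 \<le> j then Star else Zero)" if "i < n" "j < m" for i j
    using that Q(2) by (auto simp: Q'(1) star_union_def P_mat_def)
  define star where "star u i j \<longleftrightarrow>
      (if (if u then c1 else c2) then j = 0 \<and> even ((if u then n else m) - 1 - i)
       else i + 1 = (if u then n else m) \<and> even j) \<or>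
      (if u then n else m) < (if \<not> u then n else m) \<and> odd (if u then n else m) \<and>
      i + 1 = (if u then n else m) \<and> (if u then n else m) + 1 \<le> j" for u i j
  show ?thesis
  proof (rule complements_jordan_zero[where col = "\<lambda>u. if u then c1 else c2" and star = star])
    fix u i j assume "i < (if u then n else m)" "j < (if \<not> u then n else m)"
    then show "(case (u, i, j) of (u, i, j) \<Rightarrow> symbol_values ((if u then D1 else D2) $$ (i, j))) =
        (if star u i j then UNIV else {0})"
      using nm by (cases u) (auto simp: D1 D2' star_def)
  qed (use nm Q'(2) in \<open>auto simp: star_def c2_def split: if_splits\<close>)
qed

text \<open>The order H, Delta, J makes the first summand invertible in every pair except two Jordan
  blocks. In all other cases the block above the diagonal is prescribed to be zero, and the reduced
  map decides.\<close>

lemma complements_pair: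
  assumes b: "valid_summand b" "valid_summand b'" and D: "(D1, D2) \<in> offdiag_forms b b'"
    and order: "\<And>m n. \<lbrakk>b = JBlock m; b' = JBlock n\<rbrakk> \<Longrightarrow> n \<le> m"
  shows "complements (tangent Not (\<lambda>u. summand_dim (if u then b' else b)) (\<lambda>u. summand_entry (if u then b' else b)))
    (positions Not (\<lambda>u. summand_dim (if u then b' else b)))
    (\<lambda>(u, i, j). symbol_values ((if u then D1 else D2) $$ (i, j)))"
proof -
  let ?goal = ?thesis
  have reduce: ?goal
    if M': "\<exists>M'. inverse_entries (summand_dim b) (summand_entry b) M'"
      and D2: "D2 = zeros (summand_dim b) (summand_dim b')"
      and c: "complements (reduced_tangent (summand_dim b) (summand_dim b') (summand_entry b) (summand_entry b'))
        (grid (summand_dim b') (summand_dim b)) (\<lambda>e. symbol_values (D1 $$ e))"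
  proof -
    obtain M' where inv: "inverse_entries (summand_dim b) (summand_entry b) M'" using M' by blast
    show ?goal
      by (rule complements_pair_invertible[where M' = M' and W' = "\<lambda>e. symbol_values (D1 $$ e)"])
        (use inv c in \<open>simp_all add: D2\<close>)
  qed
  have updown: "(\<forall>i<n. \<forall>j<m. symbol_values (Q $$ (i, j)) = (if i = 0 then UNIV else {0})) \<or>
      (\<forall>i<n. \<forall>j<m. symbol_values (Q $$ (i, j)) = (if i + 1 = n then UNIV else {0}))"
    if "Q \<in> updown_forms n m" for Q n m
    using that by (auto simp: updown_forms_def)
  show ?goal
  proof (cases b)
    case H: (HBlock m a)
    then have a: "1 < cmod a" using b by simp
    note inv = inverse_entries_H[OF a, of m]
    show ?thesis
    proof (cases b')
      case (HBlock n a')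
      then have a': "1 < cmod a'" using b by simp
      show ?thesis
      proof (cases "a = a'")
        case True
        then obtain Q R where QR: "D1 = four_block_mat (zeros n m) Q R (zeros n m)" "D2 = zeros (2 * m) (2 * n)"
          "Q \<in> ne_forms n m" "R \<in> sw_forms n m"
          using D H HBlock by auto
        have dims: "dim_row Q = n" "dim_col Q = m" "dim_row R = n" "dim_col R = m"
          using forms_carrier(2)[OF QR(3)] forms_carrier(1)[OF QR(4)] by auto
        have "complements (reduced_tangent (2 * m) (2 * n) (H_entry m a) (H_entry n a')) (grid (2 * n) (2 * m))
            (\<lambda>e. symbol_values (D1 $$ e))"
        proof (rule complements_H_H[OF a a'])
          show "ne_pattern n m (\<lambda>(i, j). symbol_values (D1 $$ (i, m + j)))"
            by (rule ne_pattern_cong[OF ne_forms_pattern[OF QR(3)]]) (simp add: QR(1) dims)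
          show "sw_pattern n m (\<lambda>(i, j). symbol_values (D1 $$ (n + i, j)))"
            by (rule sw_pattern_cong[OF sw_forms_pattern[OF QR(4)]]) (simp add: QR(1) dims)
        qed (use True in \<open>simp_all add: QR(1) dims\<close>)
        then show ?thesis using inv QR(2) H HBlock by (intro reduce) simp_all
      next
        case False
        then have D12: "D1 = zeros (2 * n) (2 * m)" "D2 = zeros (2 * m) (2 * n)" using D H HBlock by auto
        have "complements (reduced_tangent (2 * m) (2 * n) (H_entry m a) (H_entry n a')) (grid (2 * n) (2 * m))
            (\<lambda>e. symbol_values (D1 $$ e))"
          by (rule complements_H_H[OF a a']) (use False in \<open>simp_all add: D12\<close>)
        then show ?thesis using inv D12 H HBlock by (intro reduce) simp_all
      qed
    next
      case (DeltaBlock \<mu> n)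
      then have \<mu>: "cmod \<mu> = 1" using b by simp
      have D12: "D1 = zeros n (2 * m)" "D2 = zeros (2 * m) n" using D H DeltaBlock by auto
      have "complements (reduced_tangent (2 * m) n (H_entry m a) (\<lambda>i j. \<mu> * Delta_entry n \<i> i j)) (grid n (2 * m))
            (\<lambda>e. symbol_values (D1 $$ e))"
        by (rule complements_H_Delta[OF a \<mu>]) (simp add: D12)
      then show ?thesis using inv D12 H DeltaBlock by (intro reduce) simp_all
    next
      case (JBlock n)
      obtain M' where M': "inverse_entries (2 * m) (H_entry m a) M'" using inv by blast
      have D2: "D2 = zeros (2 * m) n" using D H JBlock by (auto split: if_splits)
      have "complements (reduced_tangent (2 * m) n (H_entry m a) (jordan_entry 0)) (grid n (2 * m))
            (\<lambda>e. symbol_values (D1 $$ e))"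
      proof (rule complements_invertible_jordan[OF M'])
        show "odd n \<Longrightarrow> (\<forall>i<n. \<forall>j<2 * m. symbol_values (D1 $$ (i, j)) = (if i = 0 then UNIV else {0})) \<or>
            (\<forall>i<n. \<forall>j<2 * m. symbol_values (D1 $$ (i, j)) = (if i + 1 = n then UNIV else {0}))"
          using D H JBlock by (intro updown) simp
        show "symbol_values (D1 $$ (i, j)) = {0}" if "even n" "i < n" "j < 2 * m" for i j
          using D H JBlock that by simp
      qed
      then show ?thesis using inv D2 H JBlock by (intro reduce) simp_all
    qed
  next
    case De: (DeltaBlock \<mu> m)
    then have \<mu>: "cmod \<mu> = 1" using b by simp
    note inv = inverse_entries_Delta[OF \<mu>, of m]
    show ?thesis
    proof (cases b')
      case (HBlock n a')
      then show ?thesis using D De by simp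
    next
      case (DeltaBlock \<mu>' n)
      then have \<mu>': "cmod \<mu>' = 1" using b by simp
      have D2: "D2 = zeros m n" using D De DeltaBlock by (auto split: if_splits)
      have "complements (reduced_tangent m n (\<lambda>i j. \<mu> * Delta_entry m \<i> i j) (\<lambda>i j. \<mu>' * Delta_entry n \<i> i j))
          (grid n m) (\<lambda>e. symbol_values (D1 $$ e))"
      proof (rule complements_Delta_Delta[OF \<mu> \<mu>'])
        show "nw_pattern n m (\<lambda>e. symbol_values (D1 $$ e))" if "\<mu> = \<mu>' \<or> \<mu> = - \<mu>'"
          using D De DeltaBlock that by (intro nw_forms_pattern) auto
        show "symbol_values (D1 $$ (i, j)) = {0}" if "\<not> (\<mu> = \<mu>' \<or> \<mu> = - \<mu>')" "i < n" "j < m" for i j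
          using D De DeltaBlock that by simp
      qed
      then show ?thesis using inv D2 De DeltaBlock by (intro reduce) simp_all
    next
      case (JBlock n)
      obtain M' where M': "inverse_entries m (\<lambda>i j. \<mu> * Delta_entry m \<i> i j) M'" using inv by blast
      have D2: "D2 = zeros m n" using D De JBlock by (auto split: if_splits)
      have "complements (reduced_tangent m n (\<lambda>i j. \<mu> * Delta_entry m \<i> i j) (jordan_entry 0)) (grid n m)
            (\<lambda>e. symbol_values (D1 $$ e))"
      proof (rule complements_invertible_jordan[OF M'])
        show "odd n \<Longrightarrow> (\<forall>i<n. \<forall>j<m. symbol_values (D1 $$ (i, j)) = (if i = 0 then UNIV else {0})) \<or>
            (\<forall>i<n. \<forall>j<m. symbol_values (D1 $$ (i, j)) = (if i + 1 = n then UNIV else {0}))"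
          using D De JBlock by (intro updown) simp
        show "symbol_values (D1 $$ (i, j)) = {0}" if "even n" "i < n" "j < m" for i j
          using D De JBlock that by simp
      qed
      then show ?thesis using inv D2 De JBlock by (intro reduce) simp_all
    qed
  next
    case J: (JBlock m)
    show ?thesis
    proof (cases b')
      case (JBlock n)
      have eqs: "(\<lambda>u. summand_dim (if u then b' else b)) = (\<lambda>u. if u then n else m)"
        "(\<lambda>u. summand_entry (if u then b' else b)) = (\<lambda>_. jordan_entry 0)"
        using J JBlock by auto
      show ?thesis unfolding eqs
        by (rule complements_pair_jordan) (use D J JBlock order in auto)
    qed (use D J in simp_all)
  qed
qed

section \<open>Real dimensions\<close>

definition real_subspace :: "nat \<Rightarrow> complex mat set \<Rightarrow> bool" where
  "real_subspace n W \<longleftrightarrow> W \<subseteq> carrier_mat n n \<and> 0\<^sub>m n n \<in> W \<and> (\<forall>M\<in>W. \<forall>N\<in>W. M + N \<in> W) \<and>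
     (\<forall>c :: real. \<forall>M\<in>W. of_real c \<cdot>\<^sub>m M \<in> W)"

definition real_linear :: "complex mat set \<Rightarrow> (complex mat \<Rightarrow> complex mat) \<Rightarrow> bool" where
  "real_linear W f \<longleftrightarrow> (\<forall>M\<in>W. \<forall>N\<in>W. f (M + N) = f M + f N) \<and>
     (\<forall>c :: real. \<forall>M\<in>W. f (of_real c \<cdot>\<^sub>m M) = of_real c \<cdot>\<^sub>m f M)"

lemma real_mat_space_simps:
  "carrier (real_mat_space n) = carrier_mat n n" "zero (real_mat_space n) = 0\<^sub>m n n"
  "add (real_mat_space n) = (+)" "module.smult (real_mat_space n) = (\<lambda>r M. of_real r \<cdot>\<^sub>m M)"
  by (simp_all add: real_mat_space_def)

lemma real_subspace_carrier: "real_subspace n (carrier_mat n n)"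
  by (auto simp: real_subspace_def)

abbreviation real_module :: "nat \<Rightarrow> complex mat set \<Rightarrow> (real, complex mat) module" where
  "real_module n W \<equiv> real_mat_space n\<lparr>carrier := W\<rparr>"

abbreviation real_fin_dim :: "nat \<Rightarrow> complex mat set \<Rightarrow> bool" where
  "real_fin_dim n W \<equiv> vectorspace.fin_dim class_ring (real_module n W)"

lemma real_subspace_vectorspace:
  assumes "real_subspace n W"
  shows "vectorspace class_ring (real_module n W)"
proof -
  have W: "\<And>M. M \<in> W \<Longrightarrow> M \<in> carrier_mat n n" using assms by (auto simp: real_subspace_def)
  have neg: "\<exists>N\<in>W. M + N = 0\<^sub>m n n" if "M \<in> W" for M
  proof
    show "of_real (-1) \<cdot>\<^sub>m M \<in> W" using assms that unfolding real_subspace_def by blast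
    show "M + of_real (-1) \<cdot>\<^sub>m M = 0\<^sub>m n n" using W[OF that] by (intro eq_matI) auto
  qed
  have closed: "\<And>M N. \<lbrakk>M \<in> W; N \<in> W\<rbrakk> \<Longrightarrow> M + N \<in> W" "0\<^sub>m n n \<in> W" "\<And>c M. M \<in> W \<Longrightarrow> of_real c \<cdot>\<^sub>m M \<in> W"
    using assms by (auto simp: real_subspace_def)
  let ?V = "real_module n W"
  show ?thesis
  proof (rule vs_criteria)
    show "field (class_ring :: real ring)" by (rule class_field)
    show "\<zero>\<^bsub>?V\<^esub> \<in> carrier ?V" "\<forall>v w. v \<in> carrier ?V \<and> w \<in> carrier ?V \<longrightarrow> v \<oplus>\<^bsub>?V\<^esub> w \<in> carrier ?V"
      "\<forall>v\<in>carrier ?V. \<exists>w\<in>carrier ?V. v \<oplus>\<^bsub>?V\<^esub> w = \<zero>\<^bsub>?V\<^esub>"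
      "\<forall>c v. c \<in> carrier class_ring \<and> v \<in> carrier ?V \<longrightarrow> c \<odot>\<^bsub>?V\<^esub> v \<in> carrier ?V"
      using closed neg by (simp_all add: real_mat_space_simps)
  qed (auto simp: real_mat_space_simps algebra_simps dest!: W intro!: eq_matI)
qed

lemma real_linear_map:
  assumes "real_subspace n W" "real_subspace n W'" "f ` W \<subseteq> W'" "real_linear W f"
  shows "linear_map class_ring (real_module n W) (real_module n W') f"
proof -
  have "f \<in> LinearCombinations.module_hom class_ring (real_module n W) (real_module n W')"
    using assms(3,4) unfolding LinearCombinations.module_hom_def
    by (auto simp: real_mat_space_simps real_linear_def)
  then show ?thesis
    using real_subspace_vectorspace[OF assms(1)] real_subspace_vectorspace[OF assms(2)]
    unfolding linear_map_def mod_hom_def mod_hom_axioms_def vectorspace_def by blast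
qed

lemma real_dim_rank_nullity:
  assumes "real_subspace n W" "real_subspace n W'" "f ` W = W'" "real_linear W f"
    and fd: "real_fin_dim n W"
  shows "real_dim n W' + real_dim n {M\<in>W. f M = 0\<^sub>m n n} = real_dim n W"
    and "real_fin_dim n W'"
proof -
  interpret linear_map class_ring "real_module n W" "real_module n W'" f
    using assms by (intro real_linear_map) auto
  have im: "imT = W'" using assms(3) by (simp add: im_def)
  have ker: "kerT = {M\<in>W. f M = 0\<^sub>m n n}" by (simp add: ker_def real_mat_space_simps)
  show "real_dim n W' + real_dim n {M\<in>W. f M = 0\<^sub>m n n} = real_dim n W"
    using rank_nullity[OF fd] unfolding im ker by (simp add: real_dim_def)
  show "real_fin_dim n W'"
    using assms(3) by (intro surj_fin_dim[OF fd]) simp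
qed

text \<open>The dimension is transported from the real coordinate space of length 2 n^2 along the
  linear bijection \<open>g\<close>.\<close>

lemma real_dim_carrier:
  shows "real_dim n (carrier_mat n n) = 2 * n\<^sup>2"
    and "real_fin_dim n (carrier_mat n n)"
proof -
  define N where "N = 2 * (n * n)"
  interpret vec_space "TYPE(real)" N .
  let ?V = "module_vec TYPE(real) N" and ?W = "real_module n (carrier_mat n n)"
  \<comment> \<open>Coordinates are interleaved: the pair of positions 2 (i n + j) and 2 (i n + j) +
    1 holds real and imaginary part of the entry (i, j).\<close>
  define g where "g v = mat n n (\<lambda>(i, j). Complex (v $ (2 * (i * n + j))) (v $ (2 * (i * n + j) + 1)))"
    for v :: "real vec"
  have idx: "2 * (i * n + j) + 1 < N" if "i < n" "j < n" for i j
  proof -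
    have "i * n + j < (i + 1) * n" using that by simp
    also have "\<dots> \<le> n * n" using that by (intro mult_right_mono) auto
    finally show ?thesis by (simp add: N_def)
  qed
  have hom: "g \<in> LinearCombinations.module_hom class_ring ?V ?W"
    unfolding LinearCombinations.module_hom_def
  proof (intro CollectI conjI allI impI)
    show "g \<in> carrier ?V \<rightarrow> carrier ?W" by (auto simp: g_def)
    fix v w assume "v \<in> carrier ?V \<and> w \<in> carrier ?V"
    then have vw: "v \<in> carrier_vec N" "w \<in> carrier_vec N" by (auto simp: module_vec_simps)
    have "g (v + w) = g v + g w"
    proof (rule eq_matI)
      fix i j assume "i < dim_row (g v + g w)" "j < dim_col (g v + g w)"
      then have ij: "i < n" "j < n" by (auto simp: g_def)
      show "g (v + w) $$ (i, j) = (g v + g w) $$ (i, j)"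
        using ij idx[OF ij] vw by (simp add: g_def complex_eq_iff)
    qed (auto simp: g_def)
    then show "g (v \<oplus>\<^bsub>?V\<^esub> w) = g v \<oplus>\<^bsub>?W\<^esub> g w" by (simp add: module_vec_simps real_mat_space_simps)
  next
    fix c v assume "c \<in> carrier (class_ring :: real ring) \<and> v \<in> carrier ?V"
    then have v: "v \<in> carrier_vec N" by (auto simp: module_vec_simps)
    have "g (c \<cdot>\<^sub>v v) = of_real c \<cdot>\<^sub>m g v"
    proof (rule eq_matI)
      fix i j assume "i < dim_row (of_real c \<cdot>\<^sub>m g v)" "j < dim_col (of_real c \<cdot>\<^sub>m g v)"
      then have ij: "i < n" "j < n" by (auto simp: g_def)
      show "g (c \<cdot>\<^sub>v v) $$ (i, j) = (of_real c \<cdot>\<^sub>m g v) $$ (i, j)"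
        using ij idx[OF ij] v by (simp add: g_def complex_eq_iff)
    qed (auto simp: g_def)
    then show "g (c \<odot>\<^bsub>?V\<^esub> v) = c \<odot>\<^bsub>?W\<^esub> g v" by (simp add: module_vec_simps real_mat_space_simps)
  qed
  have W: "vectorspace class_ring ?W" by (rule real_subspace_vectorspace[OF real_subspace_carrier])
  have V: "vectorspace class_ring ?V" by (rule vec_vs)
  interpret lm: linear_map class_ring ?V ?W g
    using hom V W unfolding linear_map_def mod_hom_def mod_hom_axioms_def vectorspace_def by blast
  have inj: "inj_on g (carrier ?V)"
  proof (rule inj_onI)
    fix v w assume "v \<in> carrier ?V" "w \<in> carrier ?V" and gvw: "g v = g w"
    then have vw: "v \<in> carrier_vec N" "w \<in> carrier_vec N" by (auto simp: module_vec_simps)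
    show "v = w"
    proof (rule eq_vecI)
      fix k assume "k < dim_vec w"
      then have k: "k < N" using vw by simp
      define i where "i = (k div 2) div n"
      define j where "j = (k div 2) mod n"
      have "k div 2 < n * n" using k by (simp add: N_def)
      moreover from this have "0 < n" by (cases n) auto
      ultimately have ij: "i < n" "j < n" by (simp_all add: i_def j_def less_mult_imp_div_less)
      have kij: "i * n + j = k div 2" by (simp add: i_def j_def)
      have "g v $$ (i, j) = g w $$ (i, j)" using gvw by simp
      then have "v $ (2 * (i * n + j)) = w $ (2 * (i * n + j))" "v $ (2 * (i * n + j) + 1) = w $ (2 * (i * n + j) + 1)"
        using ij by (simp_all add: g_def)
      then have "v $ (2 * (k div 2)) = w $ (2 * (k div 2))" "v $ (2 * (k div 2) + 1) = w $ (2 * (k div 2) + 1)"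
        unfolding kij .
      moreover have "k = 2 * (k div 2) \<or> k = 2 * (k div 2) + 1" by presburger
      ultimately show "v $ k = w $ k" by metis
    qed (use vw in auto)
  qed
  have surj: "g ` carrier ?V = carrier ?W"
  proof
    show "g ` carrier ?V \<subseteq> carrier ?W" by (auto simp: g_def)
    show "carrier ?W \<subseteq> g ` carrier ?V"
    proof
      fix M assume "M \<in> carrier ?W"
      then have M: "M \<in> carrier_mat n n" by simp
      define v where "v = vec N (\<lambda>k. (if even k then Re else Im) (M $$ ((k div 2) div n, (k div 2) mod n)))"
      have "g v = M"
      proof (rule eq_matI)
        fix i j assume "i < dim_row M" "j < dim_col M"
        then have ij: "i < n" "j < n" using M by auto
        have "(i * n + j) div n = i" "(i * n + j) mod n = j" using ij by auto
        then show "g v $$ (i, j) = M $$ (i, j)"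
          using ij idx[OF ij] by (simp add: g_def v_def complex_eq_iff)
      qed (use M in \<open>auto simp: g_def\<close>)
      moreover have "v \<in> carrier ?V" by (simp add: v_def module_vec_simps)
      ultimately show "M \<in> g ` carrier ?V" by blast
    qed
  qed
  have fd: "fin_dim"
    unfolding fin_dim_def using unit_vecs_basis unfolding basis_def by (intro exI[of _ "set (unit_vecs N)"]) auto
  have im: "lm.im = carrier_mat n n" using surj by (simp add: lm.im_def)
  show "real_dim n (carrier_mat n n) = 2 * n\<^sup>2"
    using lm.rank_nullity[OF fd] lm.inj_imp_dim_ker0[OF inj] dim_is_n
    unfolding im by (simp add: real_dim_def N_def power2_eq_square)
  show "vectorspace.fin_dim class_ring ?W"
    by (rule lm.surj_fin_dim[OF fd surj])
qed

lemma real_subspace_symbol_space: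
  assumes "D \<in> carrier_mat n n"
  shows "real_subspace n (symbol_space D)"
  using assms unfolding real_subspace_def symbol_space_def
  by (auto intro!: symbol_values_0 symbol_values_add symbol_values_scale)

definition symbol_projection :: "symbol \<Rightarrow> complex \<Rightarrow> complex" where
  "symbol_projection s z = (case s of Zero \<Rightarrow> 0 | Star \<Rightarrow> z | Circ \<Rightarrow> of_real (Re z) | Bullet \<Rightarrow> \<i> * of_real (Im z))"

lemma symbol_projection:
  "symbol_projection s z \<in> symbol_values s" "z \<in> symbol_values s \<Longrightarrow> symbol_projection s z = z"
  "symbol_projection s (z + w) = symbol_projection s z + symbol_projection s w"
  "symbol_projection s (of_real c * z) = of_real c * symbol_projection s z"
  by (cases s; auto simp: symbol_projection_def complex_eq_iff complex_is_Real_iff)+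

text \<open>The space is the image of all matrices under an entrywise real linear projection. Finite
  dimension is what rank-nullity on a competing D' requires.\<close>

lemma fin_dim_symbol_space:
  assumes D: "D \<in> carrier_mat n n"
  shows "real_fin_dim n (symbol_space D)"
proof (rule real_dim_rank_nullity(2)[OF real_subspace_carrier real_subspace_symbol_space[OF D] _ _ real_dim_carrier(2)])
  let ?f = "\<lambda>M. mat n n (\<lambda>p. symbol_projection (D $$ p) (M $$ p))"
  show "?f ` carrier_mat n n = symbol_space D"
  proof
    show "?f ` carrier_mat n n \<subseteq> symbol_space D"
      using D by (auto simp: symbol_space_def symbol_projection(1))
    show "symbol_space D \<subseteq> ?f ` carrier_mat n n"
    proof
      fix M assume M: "M \<in> symbol_space D"
      then have "M = ?f M" using D by (intro eq_matI) (auto simp: symbol_space_def symbol_projection(2))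
      then show "M \<in> ?f ` carrier_mat n n" using M D by (auto simp: symbol_space_def)
    qed
  qed
  show "real_linear (carrier_mat n n) ?f"
    unfolding real_linear_def by (auto simp: symbol_projection(3,4) intro!: eq_matI)
qed

text \<open>Let p be the projection onto D along T. Its kernel T and image D give the sum of
  dimensions. If D' and T span, then p restricted to D' is still onto D, since d - d' in T means p
  d' = d; hence dim D <= dim D'.\<close>

lemma real_dim_complement:
  assumes D: "real_subspace n D" and T: "real_subspace n T"
    and span: "\<And>M. M \<in> carrier_mat n n \<Longrightarrow> \<exists>d\<in>D. M - d \<in> T"
    and trivial: "\<And>M. \<lbrakk>M \<in> D; M \<in> T\<rbrakk> \<Longrightarrow> M = 0\<^sub>m n n"
  shows "real_dim n D + real_dim n T = 2 * n\<^sup>2"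
    and "\<lbrakk>real_subspace n D'; real_fin_dim n D';
      \<And>M. M \<in> carrier_mat n n \<Longrightarrow> \<exists>d\<in>D'. M - d \<in> T\<rbrakk> \<Longrightarrow> real_dim n D \<le> real_dim n D'"
proof -
  have carrier: "M \<in> carrier_mat n n" if "M \<in> D \<or> M \<in> T" for M
    using that D T by (auto simp: real_subspace_def)
  have diff: "M - N \<in> W" if "real_subspace n W" "M \<in> W" "N \<in> W" for M N W
  proof -
    have "M + of_real (-1) \<cdot>\<^sub>m N \<in> W" using that unfolding real_subspace_def by blast
    moreover have "M + of_real (-1) \<cdot>\<^sub>m N = M - N"
      using that by (intro eq_matI) (auto simp: real_subspace_def)
    ultimately show ?thesis by simp
  qed
  \<comment> \<open>The choice is harmless: directness makes the component in D unique, and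
    linearity is read off from that uniqueness.\<close>
  define p where "p M = (SOME d. d \<in> D \<and> M - d \<in> T)" for M
  have p: "p M \<in> D" "M - p M \<in> T" if "M \<in> carrier_mat n n" for M
    using someI_ex[of "\<lambda>d. d \<in> D \<and> M - d \<in> T"] span[OF that] unfolding p_def by blast+
  have unique: "p M = d" if M: "M \<in> carrier_mat n n" and d: "d \<in> D" "M - d \<in> T" for M d
  proof -
    have c: "p M \<in> carrier_mat n n" "d \<in> carrier_mat n n" using p[OF M] d carrier by auto
    have "(M - d) - (M - p M) \<in> T" using diff[OF T] d p[OF M] by blast
    moreover have "(M - d) - (M - p M) = p M - d" using c M by (intro eq_matI) auto
    ultimately have "p M - d = 0\<^sub>m n n" using diff[OF D] d p[OF M] by (intro trivial) auto
    show ?thesis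
    proof (rule eq_matI)
      fix i j assume "i < dim_row d" "j < dim_col d"
      then show "p M $$ (i, j) = d $$ (i, j)"
        using arg_cong[OF \<open>p M - d = 0\<^sub>m n n\<close>, of "\<lambda>N. N $$ (i, j)"] c by simp
    qed (use c in auto)
  qed
  have lin: "real_linear (carrier_mat n n) p"
    unfolding real_linear_def
  proof (intro conjI ballI allI)
    fix M N :: "complex mat" assume MN: "M \<in> carrier_mat n n" "N \<in> carrier_mat n n"
    have c: "p M \<in> carrier_mat n n" "p N \<in> carrier_mat n n" using p MN carrier by auto
    have "(M + N) - (p M + p N) = (M - p M) + (N - p N)" using MN c by (intro eq_matI) auto
    then show "p (M + N) = p M + p N"
      using MN p[OF MN(1)] p[OF MN(2)] D T by (intro unique) (auto simp: real_subspace_def)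
  next
    fix c :: real and M :: "complex mat" assume M: "M \<in> carrier_mat n n"
    have "p M \<in> carrier_mat n n" using p M carrier by auto
    then have "of_real c \<cdot>\<^sub>m M - of_real c \<cdot>\<^sub>m p M = of_real c \<cdot>\<^sub>m (M - p M)"
      using M by (intro eq_matI) (auto simp: algebra_simps)
    then show "p (of_real c \<cdot>\<^sub>m M) = of_real c \<cdot>\<^sub>m p M"
      using M p[OF M] D T by (intro unique) (auto simp: real_subspace_def)
  qed
  have pD: "p d = d" if "d \<in> D" for d
  proof (rule unique)
    have "d - d = 0\<^sub>m n n" using carrier[of d] that by (intro eq_matI) auto
    then show "d - d \<in> T" using T by (simp add: real_subspace_def)
  qed (use that carrier in auto)
  have pT: "p M = 0\<^sub>m n n \<longleftrightarrow> M \<in> T" if M: "M \<in> carrier_mat n n" for M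
  proof
    have M0: "M - 0\<^sub>m n n = M" using M by (intro eq_matI) auto
    show "M \<in> T" if "p M = 0\<^sub>m n n" using p(2)[OF M] that M0 by simp
    show "p M = 0\<^sub>m n n" if "M \<in> T" using that M0 M D by (intro unique) (auto simp: real_subspace_def)
  qed
  have im: "p ` carrier_mat n n = D"
  proof
    show "p ` carrier_mat n n \<subseteq> D" using p by blast
    show "D \<subseteq> p ` carrier_mat n n"
    proof
      fix d assume "d \<in> D"
      then show "d \<in> p ` carrier_mat n n" using pD[of d] carrier[of d] by (metis image_eqI)
    qed
  qed
  have ker: "{M \<in> carrier_mat n n. p M = 0\<^sub>m n n} = T" using pT carrier by blast
  show "real_dim n D + real_dim n T = 2 * n\<^sup>2"
    using real_dim_rank_nullity(1)[OF real_subspace_carrier D im lin real_dim_carrier(2)]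
    unfolding ker real_dim_carrier(1) .
  assume D': "real_subspace n D'" "real_fin_dim n D'"
    and span': "\<And>M. M \<in> carrier_mat n n \<Longrightarrow> \<exists>d\<in>D'. M - d \<in> T"
  have D'c: "\<And>M. M \<in> D' \<Longrightarrow> M \<in> carrier_mat n n" using D'(1) by (auto simp: real_subspace_def)
  have im': "p ` D' = D"
  proof
    show "p ` D' \<subseteq> D" using p D'c by blast
    show "D \<subseteq> p ` D'"
    proof
      fix d assume d: "d \<in> D"
      then obtain d' where d': "d' \<in> D'" "d - d' \<in> T" using span' carrier by blast
      have "of_real (-1) \<cdot>\<^sub>m (d - d') \<in> T" using d' T unfolding real_subspace_def by blast
      moreover have "of_real (-1) \<cdot>\<^sub>m (d - d') = d' - d"
        using carrier[of d] d D'c[OF d'(1)] by (intro eq_matI) auto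
      ultimately have "p d' = d" using d D'c[OF d'(1)] by (intro unique) auto
      then show "d \<in> p ` D'" using d'(1) by blast
    qed
  qed
  have "real_linear D' p" using lin D'c unfolding real_linear_def by blast
  from real_dim_rank_nullity(1)[OF D'(1) D im' this D'(2)]
  show "real_dim n D \<le> real_dim n D'" by simp
qed

text \<open>Links the tangent space of the statement with the entrywise map. Arbitrary functions X
  may occur on the right because values off the grid have no influence.\<close>

lemma starcong_tangent_eq:
  assumes A: "A \<in> carrier_mat n n"
  shows "starcong_tangent n A = {mat n n (star_tangent n A X) | X. True}"
proof -
  have entry: "mat_adjoint X * A + A * X = mat n n (star_tangent n A (\<lambda>p. X $$ p))"
    if X: "X \<in> carrier_mat n n" for X
  proof (rule eq_matI)
    fix i j assume "i < dim_row (mat n n (star_tangent n A (($$) X)))" "j < dim_col (mat n n (star_tangent n A (($$) X)))"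
    then have ij: "i < n" "j < n" by auto
    then show "(mat_adjoint X * A + A * X) $$ (i, j) = mat n n (star_tangent n A (\<lambda>p. X $$ p)) $$ (i, j)"
      using A X mat_adjoint_carrier[OF X]
      by (simp add: star_tangent_def scalar_prod_def atLeast0LessThan mat_adjoint_entry[OF X] mult.commute)
  qed (use A X mat_adjoint_carrier[OF X] in auto)
  have "mat n n (star_tangent n A X) = mat n n (star_tangent n A (\<lambda>p. mat n n X $$ p))" for X
    by (rule eq_matI) (auto simp: star_tangent_def)
  then show ?thesis unfolding starcong_tangent_def using entry
    by (auto, metis (no_types, lifting) entry mat_carrier)
qed

lemma real_subspace_starcong_tangent:
  assumes A: "A \<in> carrier_mat n n"
  shows "real_subspace n (starcong_tangent n A)"
proof -
  have add: "star_tangent n A X p + star_tangent n A Y p = star_tangent n A (\<lambda>p. X p + Y p) p" for X Y p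
    by (cases p) (simp add: star_tangent_def sum.distrib distrib_left)
  have scale: "of_real c * star_tangent n A X p = star_tangent n A (\<lambda>p. of_real c * X p) p" for c X p
    by (cases p) (simp add: star_tangent_def sum_distrib_left distrib_left mult_ac)
  have zero: "star_tangent n A (\<lambda>_. 0) p = 0" for p by (cases p) (simp add: star_tangent_def)
  show ?thesis
    unfolding real_subspace_def starcong_tangent_eq[OF A]
  proof (intro conjI ballI allI)
    show "0\<^sub>m n n \<in> {mat n n (star_tangent n A X) | X. True}"
      by (intro CollectI exI[of _ "\<lambda>_. 0"] conjI TrueI eq_matI) (auto simp: zero)
    fix M N assume "M \<in> {mat n n (star_tangent n A X) | X. True}" "N \<in> {mat n n (star_tangent n A X) | X. True}"
    then obtain X Y where XY: "M = mat n n (star_tangent n A X)" "N = mat n n (star_tangent n A Y)" by blast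
    show "M + N \<in> {mat n n (star_tangent n A X) | X. True}"
      by (intro CollectI exI[of _ "\<lambda>p. X p + Y p"] conjI TrueI eq_matI) (auto simp: XY add)
  next
    fix c :: real and M assume "M \<in> {mat n n (star_tangent n A X) | X. True}"
    then obtain X where X: "M = mat n n (star_tangent n A X)" by blast
    show "of_real c \<cdot>\<^sub>m M \<in> {mat n n (star_tangent n A X) | X. True}"
      by (intro CollectI exI[of _ "\<lambda>p. of_real c * X p"] conjI TrueI eq_matI) (auto simp: X scale)
  qed auto
qed

section \<open>Assembling the blocks\<close>

definition total_dim :: "summand list \<Rightarrow> nat" where
  "total_dim bs = sum_list (map summand_dim bs)"

lemma canonical_mat_carrier: "canonical_mat bs \<in> carrier_mat (total_dim bs) (total_dim bs)"
proof -
  have "map dim_row (map summand_mat bs) = map summand_dim bs" "map dim_col (map summand_mat bs) = map summand_dim bs"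
    using summand_mat_carrier by auto
  then show ?thesis unfolding canonical_mat_def total_dim_def
    by (intro carrier_matI) (simp_all only: dim_diag_block_mat)
qed

lemma block_start_0 [simp]: "block_start bs 0 = 0"
  by (simp add: block_start_def)

lemma block_start_Cons [simp]: "block_start (b # bs) (Suc k) = summand_dim b + block_start bs k"
  by (simp add: block_start_def)

lemma block_start_Suc:
  "k < length bs \<Longrightarrow> block_start bs (Suc k) = block_start bs k + summand_dim (bs ! k)"
  by (simp add: block_start_def take_Suc_conv_app_nth)

lemma block_start_mono: "k \<le> l \<Longrightarrow> l \<le> length bs \<Longrightarrow> block_start bs k \<le> block_start bs l"
proof (induction l)
  case (Suc l)
  then show ?case using block_start_Suc[of l bs] by (cases "k = Suc l") auto
qed simp

lemma block_start_disjoint: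
  "k < l \<Longrightarrow> l < length bs \<Longrightarrow> block_start bs k + summand_dim (bs ! k) \<le> block_start bs l"
  using block_start_mono[of "Suc k" l bs] block_start_Suc[of k bs] by simp

lemma block_start_bound:
  "k < length bs \<Longrightarrow> block_start bs k + summand_dim (bs ! k) \<le> total_dim bs"
  using block_start_mono[of "Suc k" "length bs" bs] block_start_Suc[of k bs]
  by (simp add: block_start_def total_dim_def)

definition block :: "summand list \<Rightarrow> nat \<Rightarrow> nat set" where
  "block bs k = {block_start bs k..<block_start bs k + summand_dim (bs ! k)}"

lemma block_iff: "p \<in> block bs k \<longleftrightarrow> (\<exists>i<summand_dim (bs ! k). p = block_start bs k + i)"
  unfolding block_def by (auto intro!: exI[of _ "p - block_start bs k"])

lemma block_unique:
  assumes "p \<in> block bs k" "p \<in> block bs l" "k < length bs" "l < length bs"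
  shows "k = l"
  using assms block_start_disjoint[of k l bs] block_start_disjoint[of l k bs]
  by (cases k l rule: linorder_cases) (auto simp: block_def)

lemma block_exists: "p < total_dim bs \<Longrightarrow> \<exists>k<length bs. p \<in> block bs k"
proof (induction bs arbitrary: p)
  case (Cons b bs)
  show ?case
  proof (cases "p < summand_dim b")
    case True
    then show ?thesis by (intro exI[of _ 0]) (simp add: block_def)
  next
    case False
    then have "p - summand_dim b < total_dim bs" using Cons.prems by (auto simp: total_dim_def)
    then obtain k where "k < length bs" "p - summand_dim b \<in> block bs k" using Cons.IH by blast
    then show ?thesis using False by (intro exI[of _ "Suc k"]) (auto simp: block_def)
  qed
qed (simp add: total_dim_def)

lemma canonical_mat_Cons:
  "canonical_mat (b # bs) = four_block_mat (summand_mat b) (0\<^sub>m (summand_dim b) (total_dim bs))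
     (0\<^sub>m (total_dim bs) (summand_dim b)) (canonical_mat bs)"
  using summand_mat_carrier[of b] canonical_mat_carrier[of bs]
  by (auto simp: canonical_mat_def Let_def)

lemma canonical_mat_entry:
  assumes "l < length bs" "j < summand_dim (bs ! l)" "p < total_dim bs"
  shows "canonical_mat bs $$ (p, block_start bs l + j) =
      (if p \<in> block bs l then summand_entry (bs ! l) (p - block_start bs l) j else 0)"
    and "canonical_mat bs $$ (block_start bs l + j, p) =
      (if p \<in> block bs l then summand_entry (bs ! l) j (p - block_start bs l) else 0)"
  using assms
proof (induction bs arbitrary: l p)
  case (Cons b bs)
  note dims = carrier_matD[OF summand_mat_carrier[of b]] carrier_matD[OF canonical_mat_carrier[of bs]]
  have N: "total_dim (b # bs) = summand_dim b + total_dim bs" by (simp add: total_dim_def)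
  {
    case 1
    show ?case
    proof (cases l)
      case 0
      then show ?thesis using 1 by (auto simp: canonical_mat_Cons dims N block_def summand_mat_entry)
    next
      case (Suc l')
      have j: "block_start bs l' + j < total_dim bs" using block_start_bound[of l' bs] 1 Suc by simp
      show ?thesis
      proof (cases "p < summand_dim b")
        case True
        then show ?thesis using j Suc by (auto simp: canonical_mat_Cons dims N block_def)
      next
        case False
        then have "canonical_mat (b # bs) $$ (p, block_start (b # bs) l + j) =
            canonical_mat bs $$ (p - summand_dim b, block_start bs l' + j)"
          using j Suc 1 by (simp add: canonical_mat_Cons dims N add.assoc)
        also have "\<dots> = (if p - summand_dim b \<in> block bs l' then
            summand_entry (bs ! l') (p - summand_dim b - block_start bs l') j else 0)"
          using Cons.IH(1)[of l' "p - summand_dim b"] Suc 1 False N by simp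
        finally show ?thesis using False Suc by (auto simp: block_def)
      qed
    qed
  next
    case 2
    show ?case
    proof (cases l)
      case 0
      then show ?thesis using 2 by (auto simp: canonical_mat_Cons dims N block_def summand_mat_entry)
    next
      case (Suc l')
      have j: "block_start bs l' + j < total_dim bs" using block_start_bound[of l' bs] 2 Suc by simp
      show ?thesis
      proof (cases "p < summand_dim b")
        case True
        then show ?thesis using j Suc by (auto simp: canonical_mat_Cons dims N block_def)
      next
        case False
        then have "canonical_mat (b # bs) $$ (block_start (b # bs) l + j, p) =
            canonical_mat bs $$ (block_start bs l' + j, p - summand_dim b)"
          using j Suc 2 by (simp add: canonical_mat_Cons dims N add.assoc)
        also have "\<dots> = (if p - summand_dim b \<in> block bs l' then
            summand_entry (bs ! l') j (p - summand_dim b - block_start bs l') else 0)"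
          using Cons.IH(2)[of l' "p - summand_dim b"] Suc 2 False N by simp
        finally show ?thesis using False Suc by (auto simp: block_def)
      qed
    qed
  }
qed simp_all

lemma sum_block:
  fixes f :: "nat \<Rightarrow> complex"
  assumes "k < length bs" "\<And>p. \<lbrakk>p < total_dim bs; p \<notin> block bs k\<rbrakk> \<Longrightarrow> f p = 0"
  shows "(\<Sum>p<total_dim bs. f p) = (\<Sum>i<summand_dim (bs ! k). f (block_start bs k + i))"
proof -
  have "(\<Sum>p<total_dim bs. f p) = (\<Sum>p\<in>block bs k. f p)"
    using assms block_start_bound[of k bs] by (intro sum.mono_neutral_right) (auto simp: block_def)
  also have "\<dots> = (\<Sum>i<summand_dim (bs ! k). f (block_start bs k + i))"
    by (rule sum.reindex_bij_witness[of _ "\<lambda>i. block_start bs k + i" "\<lambda>p. p - block_start bs k"])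
      (auto simp: block_def)
  finally show ?thesis .
qed

text \<open>Block diagonality removes all terms outside the k-th and l-th summands, so block (k, l)
  of the tangent map sees only blocks (l, k) and (k, l) of the unknown.\<close>

lemma star_tangent_block:
  assumes k: "k < length bs" "i < summand_dim (bs ! k)" and l: "l < length bs" "j < summand_dim (bs ! l)"
  shows "star_tangent (total_dim bs) (canonical_mat bs) x (block_start bs k + i, block_start bs l + j) =
    (\<Sum>q<summand_dim (bs ! l). summand_entry (bs ! l) q j * cnj (x (block_start bs l + q, block_start bs k + i))) +
    (\<Sum>q<summand_dim (bs ! k). summand_entry (bs ! k) i q * x (block_start bs k + q, block_start bs l + j))"
proof -
  let ?A = "canonical_mat bs"
  have "(\<Sum>p<total_dim bs. ?A $$ (p, block_start bs l + j) * cnj (x (p, block_start bs k + i))) =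
      (\<Sum>q<summand_dim (bs ! l). ?A $$ (block_start bs l + q, block_start bs l + j) * cnj (x (block_start bs l + q, block_start bs k + i)))"
    using canonical_mat_entry(1)[OF l] by (intro sum_block[OF l(1)]) simp
  also have "\<dots> = (\<Sum>q<summand_dim (bs ! l). summand_entry (bs ! l) q j * cnj (x (block_start bs l + q, block_start bs k + i)))"
  proof (intro sum.cong refl)
    fix q assume "q \<in> {..<summand_dim (bs ! l)}"
    then have q: "block_start bs l + q < total_dim bs" "block_start bs l + q \<in> block bs l"
      using block_start_bound[OF l(1)] by (auto simp: block_def)
    show "?A $$ (block_start bs l + q, block_start bs l + j) * cnj (x (block_start bs l + q, block_start bs k + i)) =
        summand_entry (bs ! l) q j * cnj (x (block_start bs l + q, block_start bs k + i))"
      using canonical_mat_entry(1)[OF l q(1)] q(2) by simp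
  qed
  finally have 1: "(\<Sum>p<total_dim bs. ?A $$ (p, block_start bs l + j) * cnj (x (p, block_start bs k + i))) =
      (\<Sum>q<summand_dim (bs ! l). summand_entry (bs ! l) q j * cnj (x (block_start bs l + q, block_start bs k + i)))" .
  have "(\<Sum>p<total_dim bs. ?A $$ (block_start bs k + i, p) * x (p, block_start bs l + j)) =
      (\<Sum>q<summand_dim (bs ! k). ?A $$ (block_start bs k + i, block_start bs k + q) * x (block_start bs k + q, block_start bs l + j))"
    using canonical_mat_entry(2)[OF k] by (intro sum_block[OF k(1)]) simp
  also have "\<dots> = (\<Sum>q<summand_dim (bs ! k). summand_entry (bs ! k) i q * x (block_start bs k + q, block_start bs l + j))"
  proof (intro sum.cong refl)
    fix q assume "q \<in> {..<summand_dim (bs ! k)}"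
    then have q: "block_start bs k + q < total_dim bs" "block_start bs k + q \<in> block bs k"
      using block_start_bound[OF k(1)] by (auto simp: block_def)
    show "?A $$ (block_start bs k + i, block_start bs k + q) * x (block_start bs k + q, block_start bs l + j) =
        summand_entry (bs ! k) i q * x (block_start bs k + q, block_start bs l + j)"
      using canonical_mat_entry(2)[OF k q(1)] q(2) by simp
  qed
  finally show ?thesis using 1 by (simp add: star_tangent_def)
qed

text \<open>The map \<open>h\<close> places block coordinates inside the full matrix, where the
  tangent map restricts to \<open>tangent\<close>. A diagonal block is the instance with one index
  and t = id; a symmetric pair has two indices exchanged by t.\<close>

lemma complements_component:
  fixes t :: "'u \<Rightarrow> 'u" and r :: "'u \<Rightarrow> nat" and bs :: "summand list" and W :: "nat \<times> nat \<Rightarrow> complex set"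
  defines "h \<equiv> \<lambda>(u, i, j). (block_start bs (r u) + i, block_start bs (r (t u)) + j)"
    and "s \<equiv> \<lambda>u. summand_dim (bs ! r u)"
  assumes t: "\<And>u. t (t u) = u" and r: "\<And>u. r u < length bs" and inj: "inj r"
    and c: "complements (tangent t s (\<lambda>u. summand_entry (bs ! r u))) (positions t s) (\<lambda>e. W (h e))"
  shows "complements (star_tangent (total_dim bs) (canonical_mat bs)) (\<Union>u. block bs (r u) \<times> block bs (r (t u))) W"
proof (rule complements_reindex[where h = h and W = W, OF c])
  let ?M = "\<lambda>u. summand_entry (bs ! r u)"
  show "h ` positions t s = (\<Union>u. block bs (r u) \<times> block bs (r (t u)))"
  proof
    show "h ` positions t s \<subseteq> (\<Union>u. block bs (r u) \<times> block bs (r (t u)))"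
      by (fastforce simp: h_def s_def positions_def block_iff)
    show "(\<Union>u. block bs (r u) \<times> block bs (r (t u))) \<subseteq> h ` positions t s"
    proof
      fix e assume "e \<in> (\<Union>u. block bs (r u) \<times> block bs (r (t u)))"
      then obtain u i j where "i < s u" "j < s (t u)" "e = h (u, i, j)"
        by (auto simp: block_iff h_def s_def)
      then show "e \<in> h ` positions t s" by (auto simp: positions_def)
    qed
  qed
  show inj_h: "inj_on h (positions t s)"
  proof (rule inj_onI)
    fix e e' assume "e \<in> positions t s" "e' \<in> positions t s" and eq: "h e = h e'"
    then obtain u i j u' i' j' where e: "e = (u, i, j)" "i < s u" "j < s (t u)"
      "e' = (u', i', j')" "i' < s u'" "j' < s (t u')" by (auto simp: positions_def)
    have "block_start bs (r u) + i \<in> block bs (r u)" "block_start bs (r u) + i \<in> block bs (r u')"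
      using e eq by (auto simp: h_def block_def s_def)
    then have "r u = r u'" using block_unique r by blast
    then have "u = u'" using inj by (simp add: inj_eq)
    then show "e = e'" using e eq by (simp add: h_def)
  qed
  have tangent: "star_tangent (total_dim bs) (canonical_mat bs) x (h e) = tangent t s ?M (\<lambda>e. x (h e)) e"
    if e_pos: "e \<in> positions t s" for x e
  proof -
    obtain u i j where e: "e = (u, i, j)" "i < s u" "j < s (t u)" using e_pos by (auto simp: positions_def)
    show ?thesis
      using star_tangent_block[of "r u" bs i "r (t u)" j x] r e
      by (simp add: e(1) tangent_def h_def s_def t)
  qed
  show "\<exists>y. \<forall>e\<in>positions t s. tangent t s ?M y e = star_tangent (total_dim bs) (canonical_mat bs) x (h e)" for x
    using tangent by (intro exI[of _ "\<lambda>e. x (h e)"]) simp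
  show "\<exists>x. \<forall>e\<in>positions t s. star_tangent (total_dim bs) (canonical_mat bs) x (h e) = tangent t s ?M y e" for y
  proof (intro exI ballI)
    fix e assume e: "e \<in> positions t s"
    have y: "y (the_inv_into (positions t s) h (h v)) = y v" if "v \<in> positions t s" for v
      using the_inv_into_f_f[OF inj_h that] by simp
    obtain u i j where uij: "e = (u, i, j)" "i < s u" "j < s (t u)" using e by (auto simp: positions_def)
    have pos: "(t u, k, i) \<in> positions t s" if "k < s (t u)" for k using that uij by (simp add: positions_def t)
    have pos': "(u, k, j) \<in> positions t s" if "k < s u" for k using that uij by (simp add: positions_def)
    have "tangent t s ?M (\<lambda>e. y (the_inv_into (positions t s) h (h e))) e = tangent t s ?M y e"
      using y[OF pos] y[OF pos'] by (simp add: tangent_def uij(1))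
    then show "star_tangent (total_dim bs) (canonical_mat bs) (\<lambda>p. y (the_inv_into (positions t s) h p)) (h e) =
        tangent t s ?M y e"
      using tangent[OF e, of "\<lambda>p. y (the_inv_into (positions t s) h p)"] by simp
  qed
qed

text \<open>The sets \<open>E (k, l)\<close> with k <= l partition the grid. Each serves both as the
  set of equations and as the set of unknowns of an independent subsystem, so the decompositions of
  the components can be united.\<close>

lemma complements_canonical:
  assumes valid: "\<And>b. b \<in> set bs \<Longrightarrow> valid_summand b"
    and order: "\<And>k l m n. \<lbrakk>k < l; l < length bs; bs ! k = JBlock m; bs ! l = JBlock n\<rbrakk> \<Longrightarrow> n \<le> m"
    and D: "D \<in> associated_symbol_mats bs"
  shows "complements (star_tangent (total_dim bs) (canonical_mat bs)) (grid (total_dim bs) (total_dim bs))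
    (\<lambda>p. symbol_values (D $$ p))"
proof -
  let ?L = "star_tangent (total_dim bs) (canonical_mat bs)"
  define E where "E = (\<lambda>(k, l). block bs k \<times> block bs l \<union> block bs l \<times> block bs k)"
  define C where "C = {(k, l). k \<le> l \<and> l < length bs}"
  have entry: "D $$ (block_start bs k + i, block_start bs l + j) = block_at bs D k l $$ (i, j)"
    if "i < summand_dim (bs ! k)" "j < summand_dim (bs ! l)" for k l i j
    using that by (simp add: block_at_def)
  have union: "(\<Union>c\<in>C. E c) = grid (total_dim bs) (total_dim bs)"
  proof
    have "p < total_dim bs" if "p \<in> block bs k" "k < length bs" for p k
      using that block_start_bound[of k bs] by (auto simp: block_def)
    then show "(\<Union>c\<in>C. E c) \<subseteq> grid (total_dim bs) (total_dim bs)"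
      by (fastforce simp: C_def E_def)
    show "grid (total_dim bs) (total_dim bs) \<subseteq> (\<Union>c\<in>C. E c)"
    proof
      fix e assume "e \<in> grid (total_dim bs) (total_dim bs)"
      then obtain p q where pq: "e = (p, q)" "p < total_dim bs" "q < total_dim bs" by auto
      obtain k l where kl: "k < length bs" "p \<in> block bs k" "l < length bs" "q \<in> block bs l"
        using block_exists pq by metis
      then have "(min k l, max k l) \<in> C" "e \<in> E (min k l, max k l)"
        using pq by (auto simp: C_def E_def min_def max_def)
      then show "e \<in> (\<Union>c\<in>C. E c)" by blast
    qed
  qed
  have "complements ?L (\<Union>c\<in>C. E c) (\<lambda>p. symbol_values (D $$ p))"
  proof (rule complements_Union[where V = E])
    fix c assume "c \<in> C"
    then obtain k l where kl: "c = (k, l)" "k \<le> l" "l < length bs" by (auto simp: C_def)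
    show "complements ?L (E c) (\<lambda>p. symbol_values (D $$ p))"
    proof (cases "k = l")
      case True
      have "complements ?L (\<Union>u :: unit. block bs k \<times> block bs k) (\<lambda>p. symbol_values (D $$ p))"
      proof (rule complements_component[where r = "\<lambda>_. k" and t = id])
        have "block_at bs D k k \<in> diag_forms (bs ! k)" using D kl True by (auto simp: associated_symbol_mats_def)
        then have "complements (tangent id (\<lambda>_. summand_dim (bs ! k)) (\<lambda>_. summand_entry (bs ! k)))
            (positions id (\<lambda>_. summand_dim (bs ! k))) (\<lambda>(u :: unit, i, j). symbol_values (block_at bs D k k $$ (i, j)))"
          using valid kl True by (intro complements_diag) auto
        then show "complements (tangent id (\<lambda>_. summand_dim (bs ! k)) (\<lambda>_. summand_entry (bs ! k)))
            (positions id (\<lambda>_. summand_dim (bs ! k)))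
            (\<lambda>e. symbol_values (D $$ (case e of (u :: unit, i, j) \<Rightarrow> (block_start bs k + i, block_start bs k + j))))"
          by (rule complements_same_image) (auto simp: entry positions_def)
      qed (use kl True in \<open>auto simp: inj_def\<close>)
      then show ?thesis using True kl(1) by (simp add: E_def)
    next
      case False
      then have k: "k < l" using kl by simp
      define r where "r u = (if u then l else k)" for u
      have rb: "bs ! r u = (if u then bs ! l else bs ! k)" for u by (simp add: r_def)
      have "complements ?L (\<Union>u. block bs (r u) \<times> block bs (r (\<not> u))) (\<lambda>p. symbol_values (D $$ p))"
      proof (rule complements_component[where r = r and t = Not])
        have "(block_at bs D l k, block_at bs D k l) \<in> offdiag_forms (bs ! k) (bs ! l)"
          using D kl k by (auto simp: associated_symbol_mats_def)
        then have "complements (tangent Not (\<lambda>u. summand_dim (if u then bs ! l else bs ! k))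
              (\<lambda>u. summand_entry (if u then bs ! l else bs ! k)))
            (positions Not (\<lambda>u. summand_dim (if u then bs ! l else bs ! k)))
            (\<lambda>(u, i, j). symbol_values ((if u then block_at bs D l k else block_at bs D k l) $$ (i, j)))"
          using valid kl k order[OF k kl(3)] by (intro complements_pair) auto
        then show "complements (tangent Not (\<lambda>u. summand_dim (bs ! r u)) (\<lambda>u. summand_entry (bs ! r u)))
            (positions Not (\<lambda>u. summand_dim (bs ! r u)))
            (\<lambda>e. symbol_values (D $$ (case e of (u, i, j) \<Rightarrow> (block_start bs (r u) + i, block_start bs (r (\<not> u)) + j))))"
          unfolding rb
          by (rule complements_same_image) (auto simp: entry positions_def r_def split: if_splits)
      qed (use kl k in \<open>auto simp: r_def inj_def split: if_splits\<close>)
      also have "(\<Union>u. block bs (r u) \<times> block bs (r (\<not> u))) = E c"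
        by (auto simp: E_def kl(1) r_def UNIV_bool)
      finally show ?thesis .
    qed
  next
    fix c e and x y :: "entries" assume "c \<in> C" and e: "e \<in> E c" and xy: "\<forall>v\<in>E c. x v = y v"
    then obtain k l where kl: "c = (k, l)" "k \<le> l" "l < length bs" by (auto simp: C_def)
    obtain a b where ab: "e \<in> block bs a \<times> block bs b" "a < length bs" "b < length bs"
      "block bs a \<times> block bs b \<union> block bs b \<times> block bs a = E c"
    proof (cases "e \<in> block bs k \<times> block bs l")
      case True
      then show ?thesis using kl that[of k l] by (simp add: E_def)
    next
      case False
      then show ?thesis using e kl that[of l k] by (simp add: E_def Un_commute)
    qed
    then obtain i j where ij: "e = (block_start bs a + i, block_start bs b + j)"
      "i < summand_dim (bs ! a)" "j < summand_dim (bs ! b)" by (auto simp: block_iff)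
    have "x (block_start bs b + q, block_start bs a + i) = y (block_start bs b + q, block_start bs a + i)"
      if "q < summand_dim (bs ! b)" for q
      using bspec[OF xy, of "(block_start bs b + q, block_start bs a + i)"] that ij unfolding ab(4)[symmetric]
      by (simp add: block_def)
    moreover have "x (block_start bs a + q, block_start bs b + j) = y (block_start bs a + q, block_start bs b + j)"
      if "q < summand_dim (bs ! a)" for q
      using bspec[OF xy, of "(block_start bs a + q, block_start bs b + j)"] that ij unfolding ab(4)[symmetric]
      by (simp add: block_def)
    ultimately show "?L x e = ?L y e"
      unfolding ij(1) star_tangent_block[OF ab(2) ij(2) ab(3) ij(3)] by simp
  next
    fix c c' assume "c \<in> C" "c' \<in> C" "c \<noteq> c'"
    moreover obtain k l k' l' where c: "c = (k, l)" "c' = (k', l')" by (cases c, cases c')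
    ultimately have kl: "k \<le> l" "l < length bs" "k' \<le> l'" "l' < length bs" "(k, l) \<noteq> (k', l')"
      by (auto simp: C_def)
    then have len: "k < length bs" "k' < length bs" by auto
    have False if "(p, q) \<in> E c" "(p, q) \<in> E c'" for p q
    proof -
      have "p \<in> block bs k \<and> q \<in> block bs l \<or> p \<in> block bs l \<and> q \<in> block bs k"
        "p \<in> block bs k' \<and> q \<in> block bs l' \<or> p \<in> block bs l' \<and> q \<in> block bs k'"
        using that by (auto simp: E_def c)
      then consider "p \<in> block bs k" "p \<in> block bs k'" "q \<in> block bs l" "q \<in> block bs l'"
        | "p \<in> block bs k" "p \<in> block bs l'" "q \<in> block bs l" "q \<in> block bs k'"
        | "p \<in> block bs l" "p \<in> block bs k'" "q \<in> block bs k" "q \<in> block bs l'"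
        | "p \<in> block bs l" "p \<in> block bs l'" "q \<in> block bs k" "q \<in> block bs k'"
        by blast
      then show False
      proof cases
        case 1
        then show ?thesis using block_unique[OF 1(1,2)] block_unique[OF 1(3,4)] kl len by simp
      next
        case 2
        then show ?thesis using block_unique[OF 2(1,2)] block_unique[OF 2(3,4)] kl len by simp
      next
        case 3
        then show ?thesis using block_unique[OF 3(1,2)] block_unique[OF 3(3,4)] kl len by simp
      next
        case 4
        then show ?thesis using block_unique[OF 4(1,2)] block_unique[OF 4(3,4)] kl len by simp
      qed
    qed
    then show "E c \<inter> E c' = {}" by auto
  qed
  then show ?thesis by (simp only: union)
qed

lemma canonical_summands_valid:
  assumes "\<forall>(p, \<nu>)\<in>set Hs. p \<ge> 1 \<and> cmod \<nu> > 1" "\<forall>(\<mu>, q)\<in>set Ds. q \<ge> 1 \<and> cmod \<mu> = 1"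
    and "b \<in> set (canonical_summands Hs Ds Js)"
  shows "valid_summand b"
  using assms by (auto simp: canonical_summands_def)

text \<open>Sortedness is transferred to the whole list through a relation that constrains only
  pairs of Jordan blocks and holds trivially for all others.\<close>

lemma canonical_summands_order:
  assumes "sorted_wrt (\<ge>) Js" "bs = canonical_summands Hs Ds Js"
    "k < l" "l < length bs" "bs ! k = JBlock m" "bs ! l = JBlock n"
  shows "n \<le> m"
proof -
  have "sorted_wrt (\<lambda>b b'. \<forall>m n. b = JBlock m \<longrightarrow> b' = JBlock n \<longrightarrow> n \<le> m) bs"
    unfolding assms(2) canonical_summands_def sorted_wrt_append sorted_wrt_map
    using assms(1) by (auto intro!: sorted_wrt_mono_rel[OF _ sorted_wrt_true] elim: sorted_wrt_mono_rel[rotated])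
  from sorted_wrt_nth_less[OF this assms(3,4)] show ?thesis using assms(5,6) by simp
qed

theorem theorem2p2:
  fixes Hs :: "(nat \<times> complex) list" and Ds :: "(complex \<times> nat) list" and Js :: "nat list"
    and bs :: "summand list" and n :: nat and A :: "complex mat" and D :: "symbol mat"
  assumes H: "\<forall>(p, \<nu>)\<in>set Hs. p \<ge> 1 \<and> cmod \<nu> > 1"
    and Delta: "\<forall>(\<mu>, q)\<in>set Ds. q \<ge> 1 \<and> cmod \<mu> = 1"
    and J: "\<forall>r\<in>set Js. r \<ge> 1" "sorted_wrt (\<ge>) Js"
    and bs: "bs = canonical_summands Hs Ds Js"
    and A: "A = canonical_mat bs" "n = dim_row A"
    and D: "D \<in> associated_symbol_mats bs"
  shows "(\<exists>U S. reducing_map n A D U S) \<and>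
    (\<forall>D'\<in>carrier_mat n n. (\<exists>U' S'. reducing_map n A D' U' S') \<longrightarrow>
       real_dim n (symbol_space D') \<ge> real_dim n (symbol_space D)) \<and>
    int (real_dim n (symbol_space D)) = starcong_codim n A"
proof -
  have n: "n = total_dim bs" using A canonical_mat_carrier[of bs] by auto
  have Ac: "A \<in> carrier_mat n n" using A(1) n canonical_mat_carrier by simp
  have Dc: "D \<in> carrier_mat n n" using D A by (simp add: associated_symbol_mats_def)
  have compl: "complements (star_tangent n A) (grid n n) (\<lambda>p. symbol_values (D $$ p))"
    unfolding n A(1)
    by (rule complements_canonical[OF _ _ D])
      (use canonical_summands_valid[OF H Delta] canonical_summands_order[OF J(2) bs] bs in auto)
  let ?D = "symbol_space D" and ?T = "starcong_tangent n A"
  have span: "\<exists>d\<in>?D. M - d \<in> ?T" if M: "M \<in> carrier_mat n n" for M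
  proof -
    obtain X where X: "\<forall>p\<in>grid n n. M $$ p - star_tangent n A X p \<in> symbol_values (D $$ p)"
      using complements_solve[OF compl, of "\<lambda>p. M $$ p"] by blast
    let ?d = "mat n n (\<lambda>p. M $$ p - star_tangent n A X p)"
    have "?d \<in> ?D" using X Dc by (auto simp: symbol_space_def)
    moreover have "M - ?d = mat n n (star_tangent n A X)" using M by (intro eq_matI) auto
    then have "M - ?d \<in> ?T" unfolding starcong_tangent_eq[OF Ac] by blast
    ultimately show ?thesis by blast
  qed
  have trivial: "M = 0\<^sub>m n n" if MD: "M \<in> ?D" and MT: "M \<in> ?T" for M
  proof -
    obtain X where X: "M = mat n n (star_tangent n A X)" using MT unfolding starcong_tangent_eq[OF Ac] by blast
    have "\<forall>p\<in>grid n n. star_tangent n A X p \<in> symbol_values (D $$ p)"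
      using MD Dc by (auto simp: X symbol_space_def)
    then have "star_tangent n A X p = 0" if "p \<in> grid n n" for p
      by (rule complements_trivial[OF compl _ that])
    then show ?thesis unfolding X by (intro eq_matI) auto
  qed
  note dims = real_dim_complement(1)[OF real_subspace_symbol_space[OF Dc] real_subspace_starcong_tangent[OF Ac] span trivial]
  have "\<exists>U S. reducing_map n A D U S"
    using complements_solve[OF compl] by (intro reducing_map_exists[OF Ac Dc])
  moreover have "real_dim n (symbol_space D') \<ge> real_dim n (symbol_space D)"
    if D': "D' \<in> carrier_mat n n" and red: "\<exists>U' S'. reducing_map n A D' U' S'" for D'
  proof (rule real_dim_complement(2)[OF real_subspace_symbol_space[OF Dc] real_subspace_starcong_tangent[OF Ac]
        _ _ real_subspace_symbol_space[OF D'] fin_dim_symbol_space[OF D']])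
    show "\<exists>d\<in>?D. M - d \<in> ?T" if "M \<in> carrier_mat n n" for M by (rule span[OF that])
    show "M = 0\<^sub>m n n" if "M \<in> ?D" "M \<in> ?T" for M by (rule trivial[OF that])
    \<comment> \<open>A reducing map for \<open>D'\<close> yields only that \<open>D'\<close> and
      the tangent space span. No directness is available for \<open>D'\<close>, and the inequality
      does not require it.\<close>
    fix M :: "complex mat" assume M: "M \<in> carrier_mat n n"
    obtain U' S' where "reducing_map n A D' U' S'" using red by blast
    from reducing_map_spans[OF this Ac D' M] obtain Y where
      Y: "\<forall>p\<in>grid n n. M $$ p + star_tangent n A Y p \<in> symbol_values (D' $$ p)" by blast
    let ?d = "mat n n (\<lambda>p. M $$ p + star_tangent n A Y p)"
    have neg: "star_tangent n A (\<lambda>p. - Y p) p = - star_tangent n A Y p" for p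
      by (cases p) (simp add: star_tangent_def sum_negf)
    have "?d \<in> symbol_space D'" using Y D' by (auto simp: symbol_space_def)
    moreover have "M - ?d = mat n n (star_tangent n A (\<lambda>p. - Y p))"
      using M by (intro eq_matI) (auto simp: neg)
    then have "M - ?d \<in> ?T" unfolding starcong_tangent_eq[OF Ac] by blast
    ultimately show "\<exists>d\<in>symbol_space D'. M - d \<in> ?T" by blast
  qed
  moreover have "int (real_dim n (symbol_space D)) = starcong_codim n A"
    using dims unfolding starcong_codim_def by (simp flip: of_nat_power of_nat_mult)
  ultimately show ?thesis by blast
qed

end
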